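(* Let $D$ be a link diagram with a chosen base point $b$. (i) We have the following short exact sequence of chain complexes: $$0\to\mathcal{C}_+(D)\xrightarrow{\phi}\mathcal{C}(D)\xrightarrow{\psi}\mathcal{C}^-(D)\to 0.$$ (ii) We have the following long exact sequence of homology: $$\cdots\to H^r_{i,j}(D)\xrightarrow{\phi_*}H_{i,j}(D)\xrightarrow{\psi_*}H^{\bar r}_{i,j}(D)\xrightarrow{\partial}H^r_{i-2,j}(D)\to\cdots$$ where $H^{\bar r}_{i,j}(D)$ is the homology of $\mathcal{C}^-(D)$. The boundary map can be roughly interpreted for a state $S\in S_-(D)$ as $d(S)$ restricted to $\mathcal{C}_+(D)$.
   Context: Khovanov homology (framed unoriented version). A link diagram $D$ is a diagram on the disc of an unoriented framed link in the 3-ball. A Kauffman state $s$ of $D$ assigns to each crossing a marker $+1$ or $-1$. The smoothing of a crossing given by a positive marker joins the two regions swept out when the over-strand is rotated counterclockwise towards the under-strand (Kauffman's $A$-smoothing); a negative marker gives the other smoothing. $D_s$ is the system of circles obtained by smoothing all crossings according to $s$, and $\sigma(s)$ is the number of positive markers minus the number of negative markers. An enhanced state $S$ is a Kauffman state $s$ with a sign $+$ or $-$ assigned to each circle of $D_s$; $D_S=D_s$, $\sigma(S)=\sigma(s)$, and $\tau(S)$ is the number of positive circles minus the number of negative circles. $\mathcal{C}_{i,j}(D)$ is the free abelian group on the enhanced states $S$ with $\sigma(S)=i$ and $\sigma(S)+2\tau(S)=j$, and $\mathcal{C}(D)=\bigoplus_{i,j}\mathcal{C}_{i,j}(D)$.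 After ordering the crossings, the differential $d_{i,j}:\mathcal{C}_{i,j}(D)\to\mathcal{C}_{i-2,j}(D)$ is $d(S)=\sum_{S'}(-1)^{t(S:S')}[S:S']S'$, summed over enhanced states $S'$ generating $\mathcal{C}_{i-2,j}(D)$, where $[S:S']=1$ if the markers of $S$ and $S'$ differ at exactly one crossing $c$ and all circles of $D_S$ and $D_{S'}$ not touching $c$ have the same signs in $S$ and $S'$, and $[S:S']=0$ otherwise; $t(S:S')$ is the number of negative markers of $S$ at crossings bigger than $c$. $H_{i,j}(D)=\ker(d_{i,j})/d_{i+2,j}(\mathcal{C}_{i+2,j}(D))$. Reduced homology. Choose a base point $b$ on $D$ (not a crossing). $S_+(D)$ (resp. $S_-(D)$) is the set of enhanced states in which the circle containing $b$ is positive (resp. negative). $\mathcal{C}_+(D)$ and $\mathcal{C}_-(D)$ are the subgroups of $\mathcal{C}(D)$ spanned by $S_+(D)$ and $S_-(D)$, so $\mathcal{C}(D)=\mathcal{C}_+(D)\oplus\mathcal{C}_-(D)$ as graded groups. $\mathcal{C}_+(D)$ is a chain subcomplex of $\mathcal{C}(D)$; its homology $H^r_{i,j}(D)$ is the reduced Khovanov homology of $(D,b)$. $\mathcal{C}_-(D)$ need not be a subcomplex, but $\mathcal{C}^-(D)=\mathcal{C}(D)/\mathcal{C}_+(D)$ is a graded chain complex which, as a graded abelian group, can be identified with $\mathcal{C}_-(D)$. The map $\phi:\mathcal{C}_+(D)\to\mathcal{C}(D)$ is the inclusion, $\psi:\mathcal{C}(D)\to\mathcal{C}^-(D)$ is the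 quotient map, and $\phi_*,\psi_*$ are the induced maps on homology. *)

theory Defs
  imports "HOL-Algebra.Free_Abelian_Groups" "HOL-Combinatorics.Orbits"
begin

section \<open>Link diagrams\<close>

text \<open>
  A diagram is given by a planar diagram (PD) code. The edges are the pieces into which the
  crossings cut the diagram; a closed component without crossings is an edge that occurs at no
  crossing. A crossing is the list of the four edge ends met when going once around it
  counterclockwise, starting at an end of the under-strand: positions 0 and 2 belong to the
  under-strand, positions 1 and 3 to the over-strand. The diagram is unoriented, so either end
  of the under-strand may come first; an edge with both ends at the same crossing is listed
  twice there. The position of a crossing in the list is its place in the chosen ordering of
  the crossings.
\<close>

record 'e diagram =
  edges :: "'e set"
  crossings :: "'e list list"

definition ncross :: "'e diagram \<Rightarrow> nat" where
  "ncross D = length (crossings D)"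

text \<open>The edge ends (darts) are the pairs of a crossing and a position at that crossing.\<close>

definition darts :: "'e diagram \<Rightarrow> (nat \<times> nat) set" where
  "darts D = {..<ncross D} \<times> {..<4}"

definition edge_of :: "'e diagram \<Rightarrow> nat \<times> nat \<Rightarrow> 'e" where
  "edge_of D d = crossings D ! fst d ! snd d"

definition other_end :: "'e diagram \<Rightarrow> nat \<times> nat \<Rightarrow> nat \<times> nat" where
  "other_end D d = (THE d'. d' \<in> darts D \<and> d' \<noteq> d \<and> edge_of D d' = edge_of D d)"

text \<open>
  Walk from an end to the other end of its edge and leave along the end just clockwise of it:
  this follows the boundary of the region on the left, so the regions
  correspond to the orbits (for each connected piece of the diagram separately).
\<close>

definition face_step :: "'e diagram \<Rightarrow> nat \<times> nat \<Rightarrow> nat \<times> nat" where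
  "face_step D d = (case other_end D d of (k, p) \<Rightarrow> (k, (p + 3) mod 4))"

definition faces :: "'e diagram \<Rightarrow> (nat \<times> nat) set set" where
  "faces D = orbit (face_step D) ` darts D"

definition adjacent_crossings :: "'e diagram \<Rightarrow> (nat \<times> nat) set" where
  "adjacent_crossings D = {(k, l). k < ncross D \<and> l < ncross D \<and>
     set (crossings D ! k) \<inter> set (crossings D ! l) \<noteq> {}}"

definition pieces :: "'e diagram \<Rightarrow> nat set set" where
  "pieces D = {..<ncross D} // (adjacent_crossings D)\<^sup>*"

text \<open>
  The last condition is planarity in the form of Euler's formula: \<open>V - E + F = 2\<close> summed over
  the connected pieces with crossings, where \<open>V\<close> is the number of crossings and \<open>E = 2 V\<close>
  the number of edges. Crossingless circles do not enter it.
\<close>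

definition link_diagram :: "'e diagram \<Rightarrow> bool" where
  "link_diagram D \<longleftrightarrow>
     finite (edges D) \<and>
     (\<forall>c \<in> set (crossings D). length c = 4 \<and> set c \<subseteq> edges D) \<and>
     (\<forall>e \<in> edges D. card {d \<in> darts D. edge_of D d = e} \<in> {0, 2}) \<and>
     int (ncross D) - 2 * int (ncross D) + int (card (faces D)) = 2 * int (card (pieces D))"


section \<open>Enhanced Kauffman states\<close>

definition kauffman_states :: "'e diagram \<Rightarrow> (nat \<Rightarrow> int) set" where
  "kauffman_states D = {..<ncross D} \<rightarrow>\<^sub>E {1, -1}"

text \<open>
  Rotating the over-strand (ends 1, 3) counterclockwise sweeps out the region between the ends
  1 and 2 and the one between the ends 3 and 0. Joining these two regions leaves 0 connected
  to 1 and 2 connected to 3.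
\<close>

definition smoothing :: "'e list \<Rightarrow> int \<Rightarrow> ('e \<times> 'e) set" where
  "smoothing c m =
     (if m = 1 then {(c ! 0, c ! 1), (c ! 2, c ! 3)}
      else {(c ! 1, c ! 2), (c ! 3, c ! 0)})"

definition joined :: "'e diagram \<Rightarrow> (nat \<Rightarrow> int) \<Rightarrow> ('e \<times> 'e) set" where
  "joined D s = (\<Union>k<ncross D. smoothing (crossings D ! k) (s k))"

text \<open>A circle of the smoothed diagram is represented by the set of edges it runs through.\<close>

definition circles :: "'e diagram \<Rightarrow> (nat \<Rightarrow> int) \<Rightarrow> 'e set set" where
  "circles D s = edges D // (joined D s \<union> (joined D s)\<inverse>)\<^sup>*"

type_synonym 'e estate = "(nat \<Rightarrow> int) \<times> ('e set \<Rightarrow> int)"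

definition enhanced_states :: "'e diagram \<Rightarrow> 'e estate set" where
  "enhanced_states D =
     (SIGMA s : kauffman_states D. circles D s \<rightarrow>\<^sub>E {1, -1})"

definition sigma_deg :: "'e diagram \<Rightarrow> 'e estate \<Rightarrow> int" where
  "sigma_deg D S = (\<Sum>k<ncross D. fst S k)"

definition tau_deg :: "'e diagram \<Rightarrow> 'e estate \<Rightarrow> int" where
  "tau_deg D S = (\<Sum>\<gamma>\<in>circles D (fst S). snd S \<gamma>)"

definition gens :: "'e diagram \<Rightarrow> int \<Rightarrow> int \<Rightarrow> 'e estate set" where
  "gens D i j = {S \<in> enhanced_states D.
     sigma_deg D S = i \<and> sigma_deg D S + 2 * tau_deg D S = j}"


section \<open>The Khovanov differential\<close>

definition differ_at :: "'e diagram \<Rightarrow> 'e estate \<Rightarrow> 'e estate \<Rightarrow> nat \<Rightarrow> bool" where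
  "differ_at D S S' c \<longleftrightarrow> {k. k < ncross D \<and> fst S k \<noteq> fst S' k} = {c}"

definition incidence :: "'e diagram \<Rightarrow> 'e estate \<Rightarrow> 'e estate \<Rightarrow> int" where
  "incidence D S S' =
     (if \<exists>c. differ_at D S S' c \<and>
             (\<forall>\<gamma> \<in> circles D (fst S) \<union> circles D (fst S').
                \<gamma> \<inter> set (crossings D ! c) = {} \<longrightarrow> snd S \<gamma> = snd S' \<gamma>)
      then 1 else 0)"

definition t_exponent :: "'e diagram \<Rightarrow> 'e estate \<Rightarrow> 'e estate \<Rightarrow> nat" where
  "t_exponent D S S' =
     card {k. k < ncross D \<and> (THE c. differ_at D S S' c) < k \<and> fst S k = -1}"

definition khov_d :: "'e diagram \<Rightarrow> int \<Rightarrow> int \<Rightarrow> ('e estate \<Rightarrow>\<^sub>0 int) \<Rightarrow> ('e estate \<Rightarrow>\<^sub>0 int)"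
  where
  "khov_d D i j = frag_extend (\<lambda>S. \<Sum>S'\<in>gens D (i - 2) j.
     frag_cmul ((-1) ^ t_exponent D S S' * incidence D S S') (frag_of S'))"


section \<open>Bigraded chain complexes\<close>

text \<open>
  The differential has bidegree \<open>(-2, 0)\<close>. Groups are written multiplicatively, as
  always in \<open>HOL-Algebra\<close>.
\<close>

record 'g bicomplex =
  grp :: "int \<Rightarrow> int \<Rightarrow> 'g monoid"
  bdry :: "int \<Rightarrow> int \<Rightarrow> 'g \<Rightarrow> 'g"

definition chain_complex :: "'g bicomplex \<Rightarrow> bool" where
  "chain_complex C \<longleftrightarrow>
     (\<forall>i j. comm_group (grp C i j) \<and>
            bdry C i j \<in> hom (grp C i j) (grp C (i - 2) j) \<and>
            (\<forall>x \<in> carrier (grp C i j).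
               bdry C (i - 2) j (bdry C i j x) = \<one>\<^bsub>grp C (i - 4) j\<^esub>))"

definition chain_map ::
  "'g bicomplex \<Rightarrow> 'h bicomplex \<Rightarrow> (int \<Rightarrow> int \<Rightarrow> 'g \<Rightarrow> 'h) \<Rightarrow> bool" where
  "chain_map A B f \<longleftrightarrow>
     (\<forall>i j. f i j \<in> hom (grp A i j) (grp B i j) \<and>
            (\<forall>x \<in> carrier (grp A i j).
               f (i - 2) j (bdry A i j x) = bdry B i j (f i j x)))"

definition cycles :: "'g bicomplex \<Rightarrow> int \<Rightarrow> int \<Rightarrow> 'g set" where
  "cycles C i j = kernel (grp C i j) (grp C (i - 2) j) (bdry C i j)"

definition boundaries :: "'g bicomplex \<Rightarrow> int \<Rightarrow> int \<Rightarrow> 'g set" where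
  "boundaries C i j = bdry C (i + 2) j ` carrier (grp C (i + 2) j)"

definition homology :: "'g bicomplex \<Rightarrow> int \<Rightarrow> int \<Rightarrow> 'g set monoid" where
  "homology C i j = (grp C i j)\<lparr>carrier := cycles C i j\<rparr> Mod boundaries C i j"

definition hclass :: "'g bicomplex \<Rightarrow> int \<Rightarrow> int \<Rightarrow> 'g \<Rightarrow> 'g set" where
  "hclass C i j z = boundaries C i j #>\<^bsub>grp C i j\<^esub> z"

text \<open>
  Maps on quotients are written with \<^const>\<open>the_elem\<close>: the set of the values at all
  representatives is a singleton whenever the map is well defined.
\<close>

definition homology_map ::
  "'h bicomplex \<Rightarrow> (int \<Rightarrow> int \<Rightarrow> 'g \<Rightarrow> 'h) \<Rightarrow> int \<Rightarrow> int \<Rightarrow> 'g set \<Rightarrow> 'h set" where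
  "homology_map B f i j X = the_elem ((\<lambda>z. hclass B i j (f i j z)) ` X)"

text \<open>
  The connecting homomorphism of \<open>0 \<rightarrow> A \<rightarrow> B \<rightarrow> Q \<rightarrow> 0\<close>: lift a cycle representing \<open>X\<close>
  along \<open>g\<close> to \<open>B\<close>, apply the differential of \<open>B\<close>, and pull the result back along \<open>f\<close>.
\<close>

definition connecting_map ::
  "'a bicomplex \<Rightarrow> 'b bicomplex \<Rightarrow> (int \<Rightarrow> int \<Rightarrow> 'a \<Rightarrow> 'b) \<Rightarrow> (int \<Rightarrow> int \<Rightarrow> 'b \<Rightarrow> 'q) \<Rightarrow>
   int \<Rightarrow> int \<Rightarrow> 'q set \<Rightarrow> 'a set" where
  "connecting_map A B f g i j X = the_elem {hclass A (i - 2) j a | a c.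
     a \<in> carrier (grp A (i - 2) j) \<and> c \<in> carrier (grp B i j) \<and>
     g i j c \<in> X \<and> f (i - 2) j a = bdry B i j c}"

text \<open>The library's \<open>exact_seq\<close> requires all groups to have elements of one type.\<close>

definition exact_at ::
  "'a monoid \<Rightarrow> ('a \<Rightarrow> 'b) \<Rightarrow> 'b monoid \<Rightarrow> ('b \<Rightarrow> 'c) \<Rightarrow> 'c monoid \<Rightarrow> bool" where
  "exact_at G f H g K \<longleftrightarrow>
     group G \<and> group H \<and> group K \<and> f \<in> hom G H \<and> g \<in> hom H K \<and>
     f ` carrier G = kernel H K g"

definition short_exact_complexes ::
  "'a bicomplex \<Rightarrow> (int \<Rightarrow> int \<Rightarrow> 'a \<Rightarrow> 'b) \<Rightarrow> 'b bicomplex \<Rightarrow> (int \<Rightarrow> int \<Rightarrow> 'b \<Rightarrow> 'q) \<Rightarrow>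
   'q bicomplex \<Rightarrow> bool" where
  "short_exact_complexes A f B g Q \<longleftrightarrow>
     chain_complex A \<and> chain_complex B \<and> chain_complex Q \<and>
     chain_map A B f \<and> chain_map B Q g \<and>
     (\<forall>i j. inj_on (f i j) (carrier (grp A i j)) \<and>
            exact_at (grp A i j) (f i j) (grp B i j) (g i j) (grp Q i j) \<and>
            g i j ` carrier (grp B i j) = carrier (grp Q i j))"


section \<open>The Khovanov complex and its reduced versions\<close>

text \<open>A base point that is not a crossing is given by the edge on which it lies.\<close>

definition base_circle :: "'e diagram \<Rightarrow> 'e \<Rightarrow> (nat \<Rightarrow> int) \<Rightarrow> 'e set" where
  "base_circle D b s = (THE \<gamma>. \<gamma> \<in> circles D s \<and> b \<in> \<gamma>)"

definition S_plus :: "'e diagram \<Rightarrow> 'e \<Rightarrow> 'e estate set" where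
  "S_plus D b = {S \<in> enhanced_states D. snd S (base_circle D b (fst S)) = 1}"

definition S_minus :: "'e diagram \<Rightarrow> 'e \<Rightarrow> 'e estate set" where
  "S_minus D b = {S \<in> enhanced_states D. snd S (base_circle D b (fst S)) = -1}"

definition khovanov :: "'e diagram \<Rightarrow> ('e estate \<Rightarrow>\<^sub>0 int) bicomplex" where
  "khovanov D = \<lparr>grp = (\<lambda>i j. free_Abelian_group (gens D i j)), bdry = khov_d D\<rparr>"

definition khovanov_plus :: "'e diagram \<Rightarrow> 'e \<Rightarrow> ('e estate \<Rightarrow>\<^sub>0 int) bicomplex" where
  "khovanov_plus D b =
     \<lparr>grp = (\<lambda>i j. free_Abelian_group (gens D i j \<inter> S_plus D b)), bdry = khov_d D\<rparr>"

text \<open>The graded group spanned by \<open>S_minus\<close>, in general not a subcomplex.\<close>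

definition C_minus :: "'e diagram \<Rightarrow> 'e \<Rightarrow> int \<Rightarrow> int \<Rightarrow> ('e estate \<Rightarrow>\<^sub>0 int) monoid" where
  "C_minus D b i j = free_Abelian_group (gens D i j \<inter> S_minus D b)"

definition phi :: "int \<Rightarrow> int \<Rightarrow> ('e estate \<Rightarrow>\<^sub>0 int) \<Rightarrow> ('e estate \<Rightarrow>\<^sub>0 int)" where
  "phi i j x = x"

definition psi ::
  "'e diagram \<Rightarrow> 'e \<Rightarrow> int \<Rightarrow> int \<Rightarrow> ('e estate \<Rightarrow>\<^sub>0 int) \<Rightarrow> ('e estate \<Rightarrow>\<^sub>0 int) set" where
  "psi D b i j x = carrier (grp (khovanov_plus D b) i j) #>\<^bsub>grp (khovanov D) i j\<^esub> x"

definition khovanov_quot :: "'e diagram \<Rightarrow> 'e \<Rightarrow> ('e estate \<Rightarrow>\<^sub>0 int) set bicomplex" where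
  "khovanov_quot D b =
     \<lparr>grp = (\<lambda>i j. grp (khovanov D) i j Mod carrier (grp (khovanov_plus D b) i j)),
      bdry = (\<lambda>i j X. the_elem ((\<lambda>x. psi D b (i - 2) j (khov_d D i j x)) ` X))\<rparr>"

text \<open>The projection onto the first summand of \<open>C = C_plus \<oplus> C_minus\<close>.\<close>

definition plus_part :: "'e diagram \<Rightarrow> 'e \<Rightarrow> ('e estate \<Rightarrow>\<^sub>0 int) \<Rightarrow> ('e estate \<Rightarrow>\<^sub>0 int)" where
  "plus_part D b = frag_extend (\<lambda>S. if S \<in> S_plus D b then frag_of S else 0)"

definition khov_connecting ::
  "'e diagram \<Rightarrow> 'e \<Rightarrow> int \<Rightarrow> int \<Rightarrow> ('e estate \<Rightarrow>\<^sub>0 int) set set \<Rightarrow> ('e estate \<Rightarrow>\<^sub>0 int) set"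
  where
  "khov_connecting D b = connecting_map (khovanov_plus D b) (khovanov D) phi (psi D b)"

end

theory Submission
  imports Defs
begin

text \<open>
  The long exact sequence follows from the short exact sequence by the usual zigzag construction,
  which works for every short exact sequence of complexes (locale \<open>short_exact\<close>). In the short exact
  sequence, exactness itself is immediate, because \<open>psi\<close> is the projection to the quotient by a
  subgroup. The content is that the Khovanov differential squares to zero, and that it maps the span
  of the states that are positive at the base point to itself.

  Both properties are visible in a multiplicative description of the complex. At a Kauffman state
  \<open>s\<close>, let \<open>x\<^sub>e\<close> be a variable for every edge, with \<open>x\<^sub>e = x\<^sub>f\<close> when \<open>e\<close> and \<open>f\<close> lie on the same circle
  and with vanishing squares. The squarefree monomials in the circles are the enhanced states over
  \<open>s\<close>: the factors are the positive circles. So a list of edges defines a \<open>monomial\<close> at every state,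
  which is an enhanced state or zero. Changing the marker at a crossing from \<open>1\<close> to \<open>-1\<close> maps a monomial
  to the same monomial if two circles merge, and multiplies it by \<open>x\<^sub>0 + x\<^sub>2\<close> if a circle splits, where
  \<open>x\<^sub>0\<close> and \<open>x\<^sub>2\<close> belong to the two ends of the under-strand, which lie on the two new circles
  (\<open>flip_monomial_merge\<close>, \<open>flip_monomial_split\<close>). Hence the changes at two crossings commute
  (\<open>flip_commute\<close>), and with the signs of the differential they anticommute
  (\<open>khov_d_khov_d_frag_of\<close>). A factor that belongs to the base point is never lost, so positive states
  are mapped to positive states (\<open>keys_flip_S_plus\<close>).

  The description presupposes that changing a marker merges two circles or splits one. On a surface of
  positive genus a circle may also be turned into one circle, and then the square of the
  differential need not vanish. So planarity has to be used, in the form of Euler's formula.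
  It yields an orientation of the edges such that in and out alternate around every crossing
  (\<open>ex_alternating\<close>): signs for such an orientation live on a double cover of the diagram, and if
  the cover did not fall apart over some piece, it would violate the inequality \<open>V - E + F \<le> 2 K\<close>
  for maps with \<open>K\<close> components (\<open>euler_inequality\<close>). Every smoothing respects this orientation. The
  circles of a state are therefore the cycles of a permutation of the edges, a change of marker composes
  this permutation with a transposition, and this merges two cycles or splits one
  (\<open>cyc_transpose_iff\<close>, \<open>same_circle_flip\<close>).
\<close>

section \<open>Equivalence closures and their classes\<close>

definition conn :: "('a \<times> 'a) set \<Rightarrow> ('a \<times> 'a) set" where
  "conn r = (r \<union> r\<inverse>)\<^sup>*"

lemma equiv_conn: "equiv UNIV (conn r)"
  unfolding conn_def
  by (rule equivI) (auto simp: refl_rtrancl trans_rtrancl intro: sym_rtrancl sym_Un_converse)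

lemma subset_conn: "r \<subseteq> conn r"
  unfolding conn_def by auto

lemma conn_sym: "(x, y) \<in> conn r \<Longrightarrow> (y, x) \<in> conn r"
  using equiv_conn[of r] by (meson equivE symD)

lemma conn_trans: "(x, y) \<in> conn r \<Longrightarrow> (y, z) \<in> conn r \<Longrightarrow> (x, z) \<in> conn r"
  unfolding conn_def by (rule rtrancl_trans)

lemma conn_refl [simp]: "(x, x) \<in> conn r"
  unfolding conn_def by simp

lemma conn_least:
  assumes "equiv UNIV R" and "r \<subseteq> R"
  shows "conn r \<subseteq> R"
proof
  have R: "refl R" "sym R" "trans R"
    using assms(1) by (auto elim: equivE)
  fix p assume "p \<in> conn r"
  then obtain x y where p: "p = (x, y)" "(x, y) \<in> (r \<union> r\<inverse>)\<^sup>*"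
    unfolding conn_def by (cases p) auto
  have "(x, y) \<in> R"
    using p(2)
  proof (induction rule: rtrancl_induct)
    case base
    show ?case using R(1) by (simp add: refl_onD)
  next
    case (step y z)
    have "(y, z) \<in> R" using step(2) assms(2) R(2) by (auto dest: symD)
    with step(3) R(3) show ?case by (auto dest: transD)
  qed
  with p show "p \<in> R" by simp
qed

lemma conn_eqI: "r \<subseteq> conn r' \<Longrightarrow> r' \<subseteq> conn r \<Longrightarrow> conn r = conn r'"
  by (simp add: conn_least equiv_conn subset_antisym)

lemma conn_mono: "r \<subseteq> r' \<Longrightarrow> conn r \<subseteq> conn r'"
  by (meson conn_least equiv_conn order_trans subset_conn)

lemma conn_closed:
  assumes "\<And>x y. (x, y) \<in> r \<Longrightarrow> x \<in> A \<longleftrightarrow> y \<in> A" and "(x, y) \<in> conn r"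
  shows "x \<in> A \<longleftrightarrow> y \<in> A"
proof -
  have "equiv UNIV {(x, y). x \<in> A \<longleftrightarrow> y \<in> A}"
    by (rule equivI) (auto simp: refl_on_def sym_def trans_def)
  then have "conn r \<subseteq> {(x, y). x \<in> A \<longleftrightarrow> y \<in> A}"
    by (rule conn_least) (use assms(1) in auto)
  with assms(2) show ?thesis by auto
qed

text \<open>
  The result of merging the classes of \<open>x\<close> and \<open>y\<close>, written out explicitly so that it can be
  compared with \<open>R\<close> class by class.
\<close>

definition glue :: "('a \<times> 'a) set \<Rightarrow> 'a \<Rightarrow> 'a \<Rightarrow> ('a \<times> 'a) set" where
  "glue R x y = R \<union> (R `` {x, y}) \<times> (R `` {x, y})"

lemma equiv_glue:
  assumes "equiv UNIV R"
  shows "equiv UNIV (glue R x y)"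
proof (rule equivI)
  have R: "refl R" "sym R" "trans R"
    using assms by (auto elim: equivE)
  show "refl (glue R x y)"
    using R(1) by (auto simp: glue_def refl_on_def)
  show "sym (glue R x y)"
    using R(2) by (auto simp: glue_def sym_def)
  show "trans (glue R x y)"
  proof (rule transI)
    fix u v w assume uv: "(u, v) \<in> glue R x y" and vw: "(v, w) \<in> glue R x y"
    have up: "v \<in> R `` {x, y}" if "u \<in> R `` {x, y}" "(u, v) \<in> R" for u v
      using that R(3) by (auto dest: transD)
    show "(u, w) \<in> glue R x y"
    proof (cases "v \<in> R `` {x, y}")
      case True
      then have "u \<in> R `` {x, y}" "w \<in> R `` {x, y}"
        using uv vw up[of v] R(2) unfolding glue_def by (blast dest: symD)+
      then show ?thesis by (auto simp: glue_def)
    next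
      case False
      then have "(u, v) \<in> R" "(v, w) \<in> R"
        using uv vw unfolding glue_def by blast+
      then show ?thesis using R(3) by (auto simp: glue_def dest: transD)
    qed
  qed
qed simp

text \<open>
  Adding one pair to a relation merges at most two classes. Everything below that counts
  circles, faces or pieces adds one pair at a time.
\<close>

lemma conn_insert: "conn (insert (x, y) r) = glue (conn r) x y"
proof
  show "conn (insert (x, y) r) \<subseteq> glue (conn r) x y"
    by (rule conn_least[OF equiv_glue[OF equiv_conn]])
      (use subset_conn[of r] in \<open>auto simp: glue_def Image_iff\<close>)
  let ?C = "conn (insert (x, y) r)"
  have le: "conn r \<subseteq> ?C" by (rule conn_mono) auto
  have xy: "(x, y) \<in> ?C" using subset_conn[of "insert (x, y) r"] by auto
  have "(x, u) \<in> ?C" if "u \<in> conn r `` {x, y}" for u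
    using that le xy by (auto intro: conn_trans)
  then have "(u, v) \<in> ?C" if "u \<in> conn r `` {x, y}" "v \<in> conn r `` {x, y}" for u v
    using that by (meson conn_sym conn_trans)
  then show "glue (conn r) x y \<subseteq> ?C"
    using le unfolding glue_def by blast
qed

lemma glue_absorb:
  assumes "equiv UNIV R" and "(x, y) \<in> R"
  shows "glue R x y = R"
proof -
  have R: "sym R" "trans R"
    using assms by (auto elim: equivE)
  show ?thesis
    using assms(2) R unfolding glue_def sym_def trans_def by blast
qed

lemma glue_cong:
  assumes "equiv UNIV R" "(x, x') \<in> R" "(y, y') \<in> R"
  shows "glue R x y = glue R x' y'"
proof -
  have "R `` {x, y} = R `` {x} \<union> R `` {y}" "R `` {x', y'} = R `` {x'} \<union> R `` {y'}" by auto
  then have "R `` {x, y} = R `` {x', y'}"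
    using equiv_class_eq[OF assms(1,2)] equiv_class_eq[OF assms(1,3)] by simp
  then show ?thesis by (simp add: glue_def)
qed

text \<open>
  Two elements related only after the merging lie in the two merged classes, one in each.
\<close>

lemma glue_new:
  assumes "equiv UNIV R" "(u, v) \<in> glue R x y" "(u, v) \<notin> R"
  shows "R `` {u} = R `` {x} \<and> R `` {v} = R `` {y} \<or> R `` {u} = R `` {y} \<and> R `` {v} = R `` {x}"
proof -
  have iff: "(p, q) \<in> R \<longleftrightarrow> R `` {p} = R `` {q}" for p q
    using assms(1) by (simp add: eq_equiv_class_iff)
  have "u \<in> R `` {x, y}" "v \<in> R `` {x, y}" using assms(2,3) by (auto simp: glue_def)
  then show ?thesis using assms(3) unfolding Image_iff by (auto simp: iff)
qed

lemma glue_mono: "R \<subseteq> glue R x y"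
  by (auto simp: glue_def)

lemma glue_pair: "equiv UNIV R \<Longrightarrow> (x, y) \<in> glue R x y"
  by (auto simp: glue_def elim!: equivE dest: refl_onD)

lemma quotient_glue:
  assumes R: "equiv UNIV R" and "x \<in> A" "y \<in> A" and xy: "(x, y) \<notin> R"
  defines "Z \<equiv> A // R - {R `` {x}, R `` {y}}"
  shows "A // R = insert (R `` {x}) (insert (R `` {y}) Z)"
    and "A // glue R x y = insert (R `` {x} \<union> R `` {y}) Z"
    and "R `` {x} \<noteq> R `` {y}" and "R `` {x} \<union> R `` {y} \<notin> Z"
proof -
  have R': "refl R" "sym R" "trans R"
    using R by (auto elim: equivE)
  have cls: "R `` {u} = R `` {v} \<longleftrightarrow> (u, v) \<in> R" for u v
    using R by (simp add: eq_equiv_class_iff)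
  have rfl: "(u, u) \<in> R" for u
    using R'(1) by (simp add: refl_onD)
  have sy: "(u, x) \<in> R \<longleftrightarrow> (x, u) \<in> R" "(u, y) \<in> R \<longleftrightarrow> (y, u) \<in> R" for u
    using R'(2) by (auto dest: symD)
  show "A // R = insert (R `` {x}) (insert (R `` {y}) Z)"
    using assms(2,3) by (auto simp: Z_def quotientI)
  show "R `` {x} \<noteq> R `` {y}"
    using xy by (simp add: cls)
  have gl: "glue R x y `` {u} =
      (if (x, u) \<in> R \<or> (y, u) \<in> R then R `` {x} \<union> R `` {y} else R `` {u})" for u
  proof (cases "(x, u) \<in> R \<or> (y, u) \<in> R")
    case True
    then have 1: "R `` {u} = R `` {x} \<or> R `` {u} = R `` {y}"
      by (metis cls)
    have "u \<in> R `` {x, y}" using True by auto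
    then have "(R \<union> R `` {x, y} \<times> R `` {x, y}) `` {u} = R `` {u} \<union> R `` {x, y}" by blast
    moreover have "R `` {x, y} = R `` {x} \<union> R `` {y}" by blast
    ultimately show ?thesis using True 1 unfolding glue_def by auto
  next
    case False
    then have "u \<notin> R `` {x, y}" by auto
    then show ?thesis using False unfolding glue_def by auto
  qed
  show "A // glue R x y = insert (R `` {x} \<union> R `` {y}) Z"
  proof
    show "A // glue R x y \<subseteq> insert (R `` {x} \<union> R `` {y}) Z"
    proof
      fix \<gamma> assume "\<gamma> \<in> A // glue R x y"
      then obtain u where u: "u \<in> A" "\<gamma> = glue R x y `` {u}" by (rule quotientE)
      show "\<gamma> \<in> insert (R `` {x} \<union> R `` {y}) Z"
      proof (cases "(x, u) \<in> R \<or> (y, u) \<in> R")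
        case False
        then have "R `` {u} \<noteq> R `` {x}" "R `` {u} \<noteq> R `` {y}" by (simp_all add: cls sy)
        then show ?thesis using u False unfolding gl Z_def by (simp add: quotientI)
      qed (simp add: u gl)
    qed
    show "insert (R `` {x} \<union> R `` {y}) Z \<subseteq> A // glue R x y"
    proof (intro insert_subsetI subsetI)
      show "R `` {x} \<union> R `` {y} \<in> A // glue R x y"
        using quotientI[OF assms(2), of "glue R x y"] rfl[of x] by (simp add: gl)
    next
      fix \<gamma> assume "\<gamma> \<in> Z"
      then obtain u where u: "u \<in> A" "\<gamma> = R `` {u}" "(x, u) \<notin> R" "(y, u) \<notin> R"
        unfolding Z_def by (metis DiffD1 DiffD2 cls insertI1 insertI2 quotientE)
      then have "\<gamma> = glue R x y `` {u}" by (simp add: gl)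
      with u(1) show "\<gamma> \<in> A // glue R x y" by (auto intro: quotientI)
    qed
  qed
  show "R `` {x} \<union> R `` {y} \<notin> Z"
  proof
    assume "R `` {x} \<union> R `` {y} \<in> Z"
    then obtain u where u: "R `` {x} \<union> R `` {y} = R `` {u}"
      by (auto simp: Z_def quotient_def)
    then have "x \<in> R `` {u}" "y \<in> R `` {u}" using rfl by blast+
    then show False using xy R' by (auto dest: symD transD)
  qed
qed

lemma card_quotient_glue:
  assumes "equiv UNIV R" and "x \<in> A" "y \<in> A" and "(x, y) \<notin> R" and "finite A"
  shows "card (A // R) = Suc (card (A // glue R x y))"
proof -
  note q = quotient_glue[OF assms(1-4)]
  have fin: "finite (A // R)"
    using assms(5) by (simp add: quotient_def)
  show ?thesis
    using q(3,4) fin by (subst q(1), subst q(2)) (simp add: card_insert_if)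
qed

lemma finite_quot: "finite A \<Longrightarrow> finite (A // R)"
  by (simp add: quotient_def)

text \<open>
  Invariants bound the number of classes from below: an invariant is constant on classes, so
  distinct values need distinct classes. This replaces an exact determination of the classes.
\<close>

lemma card_image_le_quotient:
  assumes "finite A" and "\<And>x y. (x, y) \<in> r \<Longrightarrow> h x = h y"
  shows "card (h ` A) \<le> card (A // conn r)"
proof -
  have "equiv UNIV {(x, y). h x = h y}"
    by (rule equivI) (auto simp: refl_on_def sym_def trans_def)
  then have c: "h x = h y" if "(x, y) \<in> conn r" for x y
    using conn_least[of "{(x, y). h x = h y}" r] assms(2) that by auto
  have "h ` A \<subseteq> (\<lambda>X. h (SOME x. x \<in> X)) ` (A // conn r)"
  proof
    fix v assume "v \<in> h ` A"
    then obtain x where x: "x \<in> A" "v = h x" by auto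
    have "(x, SOME y. y \<in> conn r `` {x}) \<in> conn r"
      using someI[of "\<lambda>y. y \<in> conn r `` {x}" x] by simp
    then have "v = h (SOME y. y \<in> conn r `` {x})"
      using c x(2) by blast
    with x(1) show "v \<in> (\<lambda>X. h (SOME x. x \<in> X)) ` (A // conn r)"
      by (intro image_eqI[where x = "conn r `` {x}"]) (auto intro: quotientI)
  qed
  then show ?thesis
    using assms(1) by (intro surj_card_le[where f = "\<lambda>X. h (SOME x. x \<in> X)"])
      (simp_all add: quotient_def)
qed

section \<open>Cycles of a permutation\<close>

definition graph_of :: "('a \<Rightarrow> 'a) \<Rightarrow> ('a \<times> 'a) set" where
  "graph_of f = {(x, f x) | x. True}"

lemma in_graph_of [simp]: "(x, y) \<in> graph_of f \<longleftrightarrow> y = f x"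
  by (auto simp: graph_of_def)

abbreviation cyc :: "('a \<Rightarrow> 'a) \<Rightarrow> ('a \<times> 'a) set" where
  "cyc f \<equiv> conn (graph_of f)"

lemma cyc_step: "(x, f x) \<in> cyc f"
  using subset_conn[of "graph_of f"] by auto

lemma cyc_funpow: "(x, (f ^^ n) x) \<in> cyc f"
  by (induction n) (auto intro: conn_trans cyc_step)

text \<open>
  \<open>f\<close> and \<open>f \<circ> transpose x y\<close> differ only in exchanging the images of \<open>x\<close> and \<open>y\<close>, so they
  generate the same relation once \<open>x\<close> and \<open>y\<close> are identified.
\<close>

lemma cyc_compose_transpose:
  "glue (cyc (f \<circ> transpose x y)) x y = glue (cyc f) x y"
proof -
  let ?g = "f \<circ> transpose x y"
  have *: "(u, f' u) \<in> conn (insert (x, y) (graph_of (f' \<circ> transpose x y)))" for u f'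
  proof -
    let ?C = "conn (insert (x, y) (graph_of (f' \<circ> transpose x y)))"
    have t: "(transpose x y u, f' u) \<in> ?C"
      using subset_conn[of "insert (x, y) (graph_of (f' \<circ> transpose x y))"] by auto
    have "(x, y) \<in> ?C"
      using subset_conn[of "insert (x, y) (graph_of (f' \<circ> transpose x y))"] by auto
    then have "(u, transpose x y u) \<in> ?C"
      by (auto simp: transpose_def intro: conn_sym)
    with t show ?thesis by (rule conn_trans[rotated])
  qed
  have ff: "?g \<circ> transpose x y = f"
    by (simp add: comp_assoc)
  have "conn (insert (x, y) (graph_of ?g)) = conn (insert (x, y) (graph_of f))"
  proof (rule conn_eqI)
    show "insert (x, y) (graph_of ?g) \<subseteq> conn (insert (x, y) (graph_of f))"
      using *[of _ ?g] subset_conn[of "insert (x, y) (graph_of f)"]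
      unfolding ff by (auto simp: graph_of_def)
    show "insert (x, y) (graph_of f) \<subseteq> conn (insert (x, y) (graph_of ?g))"
      using *[of _ f] subset_conn[of "insert (x, y) (graph_of ?g)"]
      by (auto simp: graph_of_def)
  qed
  then show ?thesis by (simp add: conn_insert)
qed

lemma permutes_return:
  assumes "f permutes A" and "finite A"
  obtains k where "0 < k" "(f ^^ k) x = x"
proof -
  have "permutation f" using assms by (auto simp: permutation_permutes)
  then have "x \<in> orbit f x" by (rule permutation_self_in_orbit)
  then show ?thesis using that by (auto simp: orbit_altdef)
qed

lemma cyc_imp_funpow:
  assumes f: "f permutes A" "finite A" and "(x, y) \<in> cyc f"
  obtains k where "0 < k" "(f ^^ k) x = y"
proof -
  have "\<exists>k>0. (f ^^ k) x = y"
    using assms(3) unfolding conn_def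
  proof (induction rule: rtrancl_induct)
    case base
    show ?case using permutes_return[OF f] by metis
  next
    case (step y z)
    then obtain k where k: "0 < k" "(f ^^ k) x = y" by auto
    show ?case
    proof (cases "z = f y")
      case True
      then show ?thesis using k by (intro exI[of _ "Suc k"]) auto
    next
      case False
      then have y: "y = f z" using step(2) by auto
      obtain m where m: "0 < m" "(f ^^ m) z = z" using permutes_return[OF f] by metis
      have "(f ^^ (m - 1)) y = (f ^^ Suc (m - 1)) z"
        unfolding y by (simp add: funpow_swap1)
      with m have "(f ^^ (m - 1)) y = z" by simp
      then have "(f ^^ (m - 1 + k)) x = z" using k by (simp add: funpow_add)
      then show ?thesis using k(1) by (intro exI[of _ "m - 1 + k"]) auto
    qed
  qed
  then show ?thesis using that by auto
qed

text \<open>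
  The cycle structure changes in exactly one of two ways. If \<open>x\<close> and \<open>y\<close> lie on different
  cycles, the new permutation runs through the cycle of \<open>x\<close>, starting at \<open>f x\<close>, after \<open>y\<close>, and
  the cycles merge. If they lie on one cycle, the arc from \<open>f x\<close> to \<open>y\<close> closes up to a cycle
  that avoids \<open>x\<close>.
\<close>

lemma cyc_transpose_iff:
  assumes f: "f permutes A" "finite A" and xy: "x \<in> A" "y \<in> A" "x \<noteq> y"
  shows "(x, y) \<in> cyc (f \<circ> transpose x y) \<longleftrightarrow> (x, y) \<notin> cyc f"
proof
  let ?g = "f \<circ> transpose x y"
  have g: "?g permutes A"
    by (intro permutes_compose f permutes_swap_id xy)
  have gy: "?g y = f x" and gx: "?g x = f y" by auto
  have gu: "?g u = f u" if "u \<noteq> x" "u \<noteq> y" for u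
    using that by auto
  {
    assume "(x, y) \<notin> cyc f"
    obtain k where k: "0 < k" "(f ^^ k) x = x" "\<forall>i. 0 < i \<and> i < k \<longrightarrow> (f ^^ i) x \<noteq> x"
    proof -
      define k where "k = (LEAST k. 0 < k \<and> (f ^^ k) x = x)"
      have "\<exists>k. 0 < k \<and> (f ^^ k) x = x" using permutes_return[OF f] by metis
      then have "0 < k \<and> (f ^^ k) x = x" unfolding k_def by (rule LeastI_ex)
      then show ?thesis using that[of k] not_less_Least[of _ "\<lambda>k. 0 < k \<and> (f ^^ k) x = x"]
        unfolding k_def by blast
    qed
    have "i < k \<Longrightarrow> (f x, (f ^^ Suc i) x) \<in> cyc ?g" for i
    proof (induction i)
      case (Suc i)
      have "(f ^^ Suc i) x \<noteq> y"
        using \<open>(x, y) \<notin> cyc f\<close> cyc_funpow by metis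
      then have "?g ((f ^^ Suc i) x) = (f ^^ Suc (Suc i)) x"
        using gu[of "(f ^^ Suc i) x"] k(3)[rule_format, of "Suc i"] Suc.prems by simp
      then have "((f ^^ Suc i) x, (f ^^ Suc (Suc i)) x) \<in> cyc ?g"
        using cyc_step[of "(f ^^ Suc i) x" ?g] by simp
      with Suc.IH[OF Suc_lessD[OF Suc.prems]] show ?case by (rule conn_trans)
    qed simp
    from this[of "k - 1"] k have "(f x, x) \<in> cyc ?g" by simp
    moreover have "(y, f x) \<in> cyc ?g" using cyc_step[of y ?g] gy by simp
    ultimately show "(x, y) \<in> cyc ?g" by (meson conn_sym conn_trans)
  }
  show "(x, y) \<in> cyc ?g \<Longrightarrow> (x, y) \<notin> cyc f"
  proof
    assume gc: "(x, y) \<in> cyc ?g" and fc: "(x, y) \<in> cyc f"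
    obtain k where k: "0 < k" "(f ^^ k) x = y" "\<forall>i. 0 < i \<and> i < k \<longrightarrow> (f ^^ i) x \<noteq> y"
    proof -
      define k where "k = (LEAST k. 0 < k \<and> (f ^^ k) x = y)"
      have "\<exists>k. 0 < k \<and> (f ^^ k) x = y" using cyc_imp_funpow[OF f fc] by metis
      then have "0 < k \<and> (f ^^ k) x = y" unfolding k_def by (rule LeastI_ex)
      then show ?thesis using that[of k] not_less_Least[of _ "\<lambda>k. 0 < k \<and> (f ^^ k) x = y"]
        unfolding k_def by blast
    qed
    \<comment> \<open>The arc from \<open>f x\<close> to \<open>y\<close>; \<open>k\<close> is minimal, so it does not pass through \<open>x\<close>.\<close>
    define H where "H = {(f ^^ i) x | i. 0 < i \<and> i \<le> k}"
    have nx: "(f ^^ i) x \<noteq> x" if "0 < i" "i \<le> k" for i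
    proof
      assume e: "(f ^^ i) x = x"
      with k xy have "i \<noteq> k" by auto
      then have "(f ^^ (k - i)) ((f ^^ i) x) = y"
        using that k(2) funpow_add[of "k - i" i f] by simp
      then show False using k(3) e that \<open>i \<noteq> k\<close> by auto
    qed
    then have "x \<notin> H" unfolding H_def by (auto dest: sym)
    have "y \<in> H" using k by (auto simp: H_def)
    have sub: "?g ` H \<subseteq> H"
    proof
      fix v assume "v \<in> ?g ` H"
      then obtain i where i: "0 < i" "i \<le> k" "v = ?g ((f ^^ i) x)" by (auto simp: H_def)
      show "v \<in> H"
      proof (cases "i = k")
        case True
        then have "v = (f ^^ 1) x" using i k gy by simp
        then show ?thesis using k(1) unfolding H_def
          by (intro CollectI exI[of _ 1]) auto
      next
        case False
        then have "v = (f ^^ Suc i) x"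
          using i k(3) nx[of i] gu[of "(f ^^ i) x"] by simp
        moreover have "0 < Suc i" "Suc i \<le> k" using i False by auto
        ultimately show ?thesis unfolding H_def by blast
      qed
    qed
    have "finite H" unfolding H_def by simp
    then have "?g ` H = H"
      using sub by (rule endo_inj_surj) (rule inj_on_subset[OF permutes_inj[OF g] subset_UNIV])
    then have "u \<in> H \<longleftrightarrow> v \<in> H" if "(u, v) \<in> graph_of ?g" for u v
      using that inj_image_mem_iff[OF permutes_inj[OF g], of u H] by simp
    from conn_closed[OF this gc] show False using \<open>x \<notin> H\<close> \<open>y \<in> H\<close> by auto
  qed
qed

section \<open>Euler's inequality and source-sink orientations\<close>

text \<open>
  The genus of a combinatorial map is nonnegative: for a vertex permutation \<open>g\<close> and an edge
  involution \<open>a\<close>, the numbers of vertices, edges, faces and components satisfy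
  \<open>V - E + F \<le> 2 K\<close>. It appears multiplied by 2, because \<open>a\<close> moves the \<open>2 E\<close> darts that belong to
  edges; its fixed points are free ends. If all ends are free, the faces are the cycles of \<open>g\<close>, and
  so are the components, so that equality holds.

  Gluing in one more edge composes the face permutation with a transposition. Either a face is cut in two and the components stay the same, or two faces merge and at most
  two components merge.
\<close>

lemma euler_inequality:
  assumes A: "finite A" and g: "g permutes A" and a: "a permutes A" "a \<circ> a = id"
  shows "2 * (card (A // cyc g) + card (A // cyc (g \<circ> a))) \<le>
    card {x. a x \<noteq> x} + 4 * card (A // conn (graph_of g \<union> graph_of a))"
  using a
proof (induction "card {x. a x \<noteq> x}" arbitrary: a rule: less_induct)
  case less
  have fin: "finite {x. a x \<noteq> x}"
    using A less.prems(1) by (rule_tac finite_subset[OF _ A]) (auto simp: permutes_def)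
  show ?case
  proof (cases "\<exists>x. a x \<noteq> x")
    case False
    then have "a = id" by auto
    have "conn (graph_of g \<union> graph_of id) = cyc g"
      by (rule conn_eqI) (use subset_conn[of "graph_of g"] subset_conn[of "graph_of g \<union> graph_of id"] in auto)
    then show ?thesis using \<open>a = id\<close> by simp
  next
    case True
    then obtain x where x: "a x \<noteq> x" by auto
    define y where "y = a x"
    have ay: "a y = x" using less.prems(2) unfolding y_def by (metis comp_apply id_apply)
    have aa: "a (a z) = z" for z using less.prems(2) by (metis comp_apply id_apply)
    have xA: "x \<in> A" using x less.prems(1) by (auto simp: permutes_def)
    have yA: "y \<in> A" unfolding y_def using xA less.prems(1) by (simp add: permutes_in_image)
    have xy: "x \<noteq> y" using x y_def by auto
    define b where "b = a \<circ> transpose x y"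
    have bx: "b x = x" "b y = y" using ay y_def by (auto simp: b_def)
    have bz: "b z = a z" if "z \<noteq> x" "z \<noteq> y" for z using that by (auto simp: b_def)
    have az: "a z \<noteq> x" "a z \<noteq> y" if "z \<noteq> x" "z \<noteq> y" for z
      using that aa y_def ay by metis+
    have b: "b permutes A" unfolding b_def
      by (intro permutes_compose less.prems permutes_swap_id xA yA)
    have "b (b z) = z" for z
      by (cases "z = x \<or> z = y") (use bx bz az aa in auto)
    then have bb: "b \<circ> b = id" by auto
    have a: "a = b \<circ> transpose x y" by (simp add: b_def comp_assoc)
    have supp: "{z. a z \<noteq> z} = insert x (insert y {z. b z \<noteq> z})"
    proof (rule Set.set_eqI)
      fix z show "z \<in> {z. a z \<noteq> z} \<longleftrightarrow> z \<in> insert x (insert y {z. b z \<noteq> z})"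
        by (cases "z = x \<or> z = y") (use bz x ay xy in auto)
    qed
    have card_supp: "card {z. a z \<noteq> z} = card {z. b z \<noteq> z} + 2"
      using fin bx xy unfolding supp by simp
    define f where "f = g \<circ> b"
    have f: "f permutes A" unfolding f_def by (intro permutes_compose b g)
    have ga: "g \<circ> a = f \<circ> transpose x y" by (simp add: a f_def comp_assoc)
    define K where "K = conn (graph_of g \<union> graph_of b)"
    have eqK: "equiv UNIV K" unfolding K_def by (rule equiv_conn)
    have Ka: "conn (graph_of g \<union> graph_of a) = glue K x y"
    proof -
      have "conn (graph_of g \<union> graph_of a) = conn (insert (x, y) (graph_of g \<union> graph_of b))"
      proof (rule conn_eqI)
        let ?L = "conn (graph_of g \<union> graph_of a)"
        let ?R = "conn (insert (x, y) (graph_of g \<union> graph_of b))"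
        have R: "(x, y) \<in> ?R" "(z, b z) \<in> ?R" "(z, g z) \<in> ?R" for z
          using subset_conn[of "insert (x, y) (graph_of g \<union> graph_of b)"] by auto
        have "(z, a z) \<in> ?R" for z
          using R(1) conn_sym[OF R(1)] R(2)[of z] bz[of z] ay y_def by metis
        with R show "graph_of g \<union> graph_of a \<subseteq> ?R" by (auto simp: graph_of_def)
        have L: "(z, a z) \<in> ?L" "(z, g z) \<in> ?L" for z
          using subset_conn[of "graph_of g \<union> graph_of a"] by auto
        have "(z, b z) \<in> ?L" for z
          using L(1)[of z] bz[of z] bx conn_refl by metis
        with L show "insert (x, y) (graph_of g \<union> graph_of b) \<subseteq> ?L"
          by (auto simp: graph_of_def y_def)
      qed
      then show ?thesis by (simp add: conn_insert K_def)
    qed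
    have IH: "2 * (card (A // cyc g) + card (A // cyc f)) \<le> card {x. b x \<noteq> x} + 4 * card (A // K)"
      unfolding f_def K_def by (rule less.hyps) (use b bb card_supp in auto)
    show ?thesis
    proof (cases "(x, y) \<in> cyc f")
      case True
      then have "(x, y) \<notin> cyc (g \<circ> a)"
        unfolding ga using cyc_transpose_iff[OF f A xA yA xy] by blast
      then have "card (A // cyc (g \<circ> a)) = Suc (card (A // glue (cyc (g \<circ> a)) x y))"
        by (rule card_quotient_glue[OF equiv_conn xA yA _ A])
      also have "glue (cyc (g \<circ> a)) x y = cyc f"
        unfolding ga cyc_compose_transpose by (rule glue_absorb[OF equiv_conn True])
      finally have 1: "card (A // cyc (g \<circ> a)) = Suc (card (A // cyc f))" .
      have "graph_of f \<subseteq> K"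
      proof -
        have "(z, b z) \<in> K" "(b z, g (b z)) \<in> K" for z
          unfolding K_def using subset_conn[of "graph_of g \<union> graph_of b"] by auto
        then have "(z, f z) \<in> K" for z
          unfolding f_def comp_apply K_def by (meson conn_trans)
        then show ?thesis by (auto simp: graph_of_def)
      qed
      then have "cyc f \<subseteq> K" by (rule conn_least[OF eqK])
      then have "glue K x y = K" using True by (intro glue_absorb[OF eqK]) auto
      then show ?thesis using IH 1 card_supp unfolding Ka by simp
    next
      case False
      then have "(x, y) \<in> cyc (g \<circ> a)"
        unfolding ga using cyc_transpose_iff[OF f A xA yA xy] by blast
      then have "cyc (g \<circ> a) = glue (cyc f) x y"
        using glue_absorb[OF equiv_conn, of x y "graph_of (g \<circ> a)"]
        unfolding ga cyc_compose_transpose by simp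
      then have 1: "card (A // cyc f) = Suc (card (A // cyc (g \<circ> a)))"
        using card_quotient_glue[OF equiv_conn xA yA False A] by simp
      have "card (A // K) \<le> Suc (card (A // glue K x y))"
      proof (cases "(x, y) \<in> K")
        case True
        then show ?thesis using glue_absorb[OF eqK True] by simp
      next
        case False
        then show ?thesis using card_quotient_glue[OF eqK xA yA False A] by simp
      qed
      then show ?thesis using IH 1 card_supp unfolding Ka by simp
    qed
  qed
qed

text \<open>
  The hypothesis \<open>euler\<close> says that the map is planar, and \<open>ev\<close>, which alternates around the
  vertices, that their degrees are even. Consider the double cover of the map whose darts are the pairs of a dart and a sign, and in
  which both the rotation and the passage along an edge reverse the sign. Vertices of even
  degree, edges and faces all lift to two copies, so the Euler characteristic doubles. By
  Euler's inequality the cover then has at least twice as many components as the map, hence no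
  component of the cover contains both lifts of a dart. Choosing one of the two lifts of each component
  singles out a sign for every dart, and this sign alternates as required.
\<close>

lemma source_sink_orientation:
  fixes \<gamma> \<alpha> :: "'a \<Rightarrow> 'a" and ev :: "'a \<Rightarrow> bool"
  assumes A: "finite A" and \<gamma>: "\<gamma> permutes A" and \<alpha>: "\<alpha> permutes A" "\<alpha> \<circ> \<alpha> = id"
    and nofix: "\<And>x. x \<in> A \<Longrightarrow> \<alpha> x \<noteq> x"
    and even: "\<And>x. x \<in> A \<Longrightarrow> ev (\<gamma> x) \<noteq> ev x"
    and euler: "card A + 4 * card (A // conn (graph_of \<gamma> \<union> graph_of \<alpha>)) \<le>
      2 * (card (A // cyc \<gamma>) + card (A // cyc (\<gamma> \<circ> \<alpha>)))"
  shows "\<exists>ori :: 'a \<Rightarrow> bool. \<forall>x \<in> A. ori (\<gamma> x) \<noteq> ori x \<and> ori (\<alpha> x) \<noteq> ori x"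
proof -
  \<comment> \<open>The sign is reversed over \<open>A\<close> only, so that lifts of permutations of \<open>A\<close> permute \<open>?A\<close>.\<close>
  define lift where "lift = (\<lambda>h :: 'a \<Rightarrow> 'a. \<lambda>(x, u :: bool). (h x, u \<noteq> (x \<in> A)))"
  let ?A = "A \<times> (UNIV :: bool set)"
  have lift_permutes: "lift h permutes ?A" if h: "h permutes A" for h
  proof (rule inj_imp_permutes)
    show "inj_on (lift h) ?A"
      using permutes_inj[OF h] by (auto simp: inj_on_def lift_def)
  qed (use A permutes_in_image[OF h] permutes_not_in[OF h] in \<open>auto simp: lift_def\<close>)
  define K where "K = conn (graph_of \<gamma> \<union> graph_of \<alpha>)"
  define R where "R = conn (graph_of (lift \<gamma>) \<union> graph_of (lift \<alpha>))"
  have Kc: "(x, \<gamma> x) \<in> K" "(x, \<alpha> x) \<in> K" for x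
    using subset_conn[of "graph_of \<gamma> \<union> graph_of \<alpha>"] by (auto simp: K_def)
  have Rc: "((x, u), (\<gamma> x, u \<noteq> (x \<in> A))) \<in> R" "((x, u), (\<alpha> x, u \<noteq> (x \<in> A))) \<in> R" for x u
    using subset_conn[of "graph_of (lift \<gamma>) \<union> graph_of (lift \<alpha>)"] by (auto simp: R_def lift_def)
  have mem: "\<gamma> x \<in> A \<longleftrightarrow> x \<in> A" "\<alpha> x \<in> A \<longleftrightarrow> x \<in> A" for x
    using \<gamma> \<alpha>(1) by (simp_all add: permutes_in_image)
  have out: "\<gamma> x = x" "\<alpha> x = x" if "x \<notin> A" for x
    using that \<gamma> \<alpha>(1) by (simp_all add: permutes_not_in)
  have aa: "\<alpha> (\<alpha> x) = x" for x using \<alpha>(2) by (metis comp_apply id_apply)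
  have cyc_eq: "cyc h `` {h x} = cyc h `` {x}" for h :: "'a \<Rightarrow> 'a" and x
    using equiv_class_eq[OF equiv_conn cyc_step] by metis

  have le\<gamma>: "2 * card (A // cyc \<gamma>) \<le> card (?A // cyc (lift \<gamma>))"
  proof -
    \<comment> \<open>Around a vertex, parity and sign both alternate, so their difference is invariant.\<close>
    define i where "i = (\<lambda>(x, u). (cyc \<gamma> `` {x}, if x \<in> A then ev x \<noteq> u else u))"
    have "card (i ` ?A) \<le> card (?A // cyc (lift \<gamma>))"
    proof (rule card_image_le_quotient)
      fix p q assume "(p, q) \<in> graph_of (lift \<gamma>)"
      then show "i p = i q"
        by (cases p) (use even mem in \<open>auto simp: i_def lift_def cyc_eq\<close>)
    qed (use A in simp)
    moreover have "i ` ?A = (A // cyc \<gamma>) \<times> UNIV"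
    proof
      show "i ` ?A \<subseteq> (A // cyc \<gamma>) \<times> UNIV" by (auto simp: i_def intro: quotientI)
      show "(A // cyc \<gamma>) \<times> UNIV \<subseteq> i ` ?A"
      proof
        fix p assume "p \<in> (A // cyc \<gamma>) \<times> (UNIV :: bool set)"
        then obtain x u where "x \<in> A" "p = (cyc \<gamma> `` {x}, u)" by (auto elim!: quotientE)
        then have "p = i (x, ev x \<noteq> u)" "x \<in> A" by (auto simp: i_def)
        then show "p \<in> i ` ?A" by blast
      qed
    qed
    ultimately show ?thesis by (simp add: card_cartesian_product)
  qed

  have lef: "2 * card (A // cyc (\<gamma> \<circ> \<alpha>)) \<le> card (?A // cyc (lift \<gamma> \<circ> lift \<alpha>))"
  proof -
    \<comment> \<open>A step along a face reverses the sign twice.\<close>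
    define i where "i = (\<lambda>(x, u :: bool). (cyc (\<gamma> \<circ> \<alpha>) `` {x}, u))"
    have "card (i ` ?A) \<le> card (?A // cyc (lift \<gamma> \<circ> lift \<alpha>))"
    proof (rule card_image_le_quotient)
      fix p q assume "(p, q) \<in> graph_of (lift \<gamma> \<circ> lift \<alpha>)"
      then show "i p = i q"
        using cyc_eq[of "\<gamma> \<circ> \<alpha>" "fst p"]
        by (cases p) (use mem in \<open>auto simp: i_def lift_def\<close>)
    qed (use A in simp)
    moreover have "i ` ?A = (A // cyc (\<gamma> \<circ> \<alpha>)) \<times> UNIV"
    proof
      show "i ` ?A \<subseteq> (A // cyc (\<gamma> \<circ> \<alpha>)) \<times> UNIV" by (auto simp: i_def intro: quotientI)
      show "(A // cyc (\<gamma> \<circ> \<alpha>)) \<times> UNIV \<subseteq> i ` ?A"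
      proof
        fix p assume "p \<in> (A // cyc (\<gamma> \<circ> \<alpha>)) \<times> (UNIV :: bool set)"
        then obtain x u where "x \<in> A" "p = i (x, u)" by (auto elim!: quotientE simp: i_def)
        then show "p \<in> i ` ?A" by blast
      qed
    qed
    ultimately show ?thesis by (simp add: card_cartesian_product)
  qed

  have euler': "2 * (card (?A // cyc (lift \<gamma>)) + card (?A // cyc (lift \<gamma> \<circ> lift \<alpha>)))
      \<le> 2 * card A + 4 * card (?A // R)"
  proof -
    have "lift \<alpha> \<circ> lift \<alpha> = id"
      by (rule ext) (auto simp: lift_def aa mem split: if_splits)
    moreover have "{p. lift \<alpha> p \<noteq> p} = ?A"
      using nofix out by (auto simp: lift_def)
    ultimately show ?thesis
      using euler_inequality[OF _ lift_permutes[OF \<gamma>] lift_permutes[OF \<alpha>(1)]] A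
      by (simp add: R_def card_cartesian_product)
  qed
  have K': "2 * card (A // K) \<le> card (?A // R)"
  proof -
    have "2 * k \<le> k'" if "a + 4 * k \<le> 2 * (c + f)" "2 * (c' + f') \<le> 2 * a + 4 * k'"
      "2 * c \<le> c'" "2 * f \<le> f'" for a k c f c' f' k' :: nat
      using that by (simp add: algebra_simps)
    from this[OF euler euler' le\<gamma> lef] show ?thesis unfolding K_def .
  qed

  have R_sym: "(p, q) \<in> R \<Longrightarrow> (q, p) \<in> R" and R_trans: "(p, q) \<in> R \<Longrightarrow> (q, r) \<in> R \<Longrightarrow> (p, r) \<in> R"
    for p q r unfolding R_def by (auto intro: conn_sym conn_trans)
  \<comment> \<open>Related darts have related lifts, up to a sign \<open>w\<close> that is common to both lifts.\<close>
  define S where "S = {(x, y). \<exists>w. \<forall>u. ((x, u), (y, u \<noteq> w)) \<in> R}"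
  have KS: "K \<subseteq> S"
    unfolding K_def
  proof (rule conn_least)
    show "equiv UNIV S"
    proof (rule equivI)
      show "refl S"
        unfolding S_def R_def by (auto simp: refl_on_def intro!: exI[of _ False])
      show "sym S"
      proof (rule symI)
        fix x y assume "(x, y) \<in> S"
        then obtain w where w: "\<And>u. ((x, u), (y, u \<noteq> w)) \<in> R" by (auto simp: S_def)
        have "((y, u), (x, u \<noteq> w)) \<in> R" for u
          using R_sym[OF w[of "u \<noteq> w"]] by (cases u; cases w) auto
        then show "(y, x) \<in> S" by (auto simp: S_def)
      qed
      show "trans S"
      proof (rule transI)
        fix x y z assume "(x, y) \<in> S" "(y, z) \<in> S"
        then obtain w w' where w: "\<And>u. ((x, u), (y, u \<noteq> w)) \<in> R" "\<And>u. ((y, u), (z, u \<noteq> w')) \<in> R"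
          unfolding S_def by blast
        have "((x, u), (z, u \<noteq> (w \<noteq> w'))) \<in> R" for u
          using R_trans[OF w(1)[of u] w(2)[of "u \<noteq> w"]] by (cases u; cases w; cases w') auto
        then show "(x, z) \<in> S" unfolding S_def by blast
      qed
    qed simp
    have "(x, \<gamma> x) \<in> S" "(x, \<alpha> x) \<in> S" for x
      using Rc unfolding S_def by blast+
    then show "graph_of \<gamma> \<union> graph_of \<alpha> \<subseteq> S" by (auto simp: graph_of_def)
  qed

  \<comment> \<open>Every component of the cover contains a lift of the representative \<open>rep X\<close> of a component
    \<open>X\<close> of the map. As the cover has at least twice as many components as the map, the two
    lifts of \<open>rep X\<close> lie in different ones.\<close>
  define rep where "rep = (\<lambda>X. SOME x :: 'a. x \<in> X)"
  define r where "r = (\<lambda>x. rep (K `` {x}))"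
  have rK: "(x, r x) \<in> K" for x
    using someI[of "\<lambda>y. y \<in> K `` {x}" x] by (simp add: r_def rep_def K_def)
  have r_cong: "r x = r y" if "(x, y) \<in> K" for x y
    using that equiv_class_eq[OF equiv_conn] unfolding r_def K_def by metis
  have near: "\<exists>w. \<forall>u. ((r x, u), (x, u \<noteq> w)) \<in> R" for x
  proof -
    have "(r x, x) \<in> K" using rK[of x] unfolding K_def by (rule conn_sym)
    with KS have "(r x, x) \<in> S" by (rule subsetD)
    then show ?thesis by (simp add: S_def)
  qed
  define cl where "cl = (\<lambda>(X, u). R `` {(rep X, u)})"
  have "?A // R \<subseteq> cl ` ((A // K) \<times> UNIV)"
  proof
    fix Y assume "Y \<in> ?A // R"
    then obtain x u where x: "x \<in> A" "Y = R `` {(x, u)}" by (auto elim!: quotientE)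
    obtain w where "\<And>u. ((r x, u), (x, u \<noteq> w)) \<in> R" using near[of x] by auto
    from this[of "u \<noteq> w"] have "((r x, u \<noteq> w), (x, u)) \<in> R" by (cases u; cases w) auto
    then have "Y = cl (K `` {x}, u \<noteq> w)"
      using equiv_class_eq[OF equiv_conn] unfolding x(2) cl_def R_def r_def by fastforce
    then show "Y \<in> cl ` ((A // K) \<times> UNIV)" using x(1) by (auto intro: quotientI)
  qed
  then have "card (?A // R) \<le> card (cl ` ((A // K) \<times> UNIV))"
    by (rule card_mono[rotated]) (use A in \<open>simp add: finite_quot\<close>)
  then have "card ((A // K) \<times> (UNIV :: bool set)) \<le> card (cl ` ((A // K) \<times> UNIV))"
    using K' by (simp add: card_cartesian_product)
  then have inj: "inj_on cl ((A // K) \<times> UNIV)"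
    using card_image_le[of "(A // K) \<times> (UNIV :: bool set)" cl] A
    by (intro eq_card_imp_inj_on) (simp_all add: finite_quot)
  have sep: "((r x, True), (r x, False)) \<notin> R" if "x \<in> A" for x
  proof
    assume "((r x, True), (r x, False)) \<in> R"
    then have "R `` {(r x, True)} = R `` {(r x, False)}"
      unfolding R_def by (rule equiv_class_eq[OF equiv_conn])
    then have "cl (K `` {x}, True) = cl (K `` {x}, False)" by (simp add: cl_def r_def)
    then show False
      using inj_onD[OF inj, of "(K `` {x}, True)" "(K `` {x}, False)"] quotientI[OF that, of K] by simp
  qed

  define ori where "ori = (\<lambda>x. ((r x, True), (x, True)) \<in> R)"
  have flip: "((r x, True), (x, False)) \<in> R \<longleftrightarrow> \<not> ori x" if x: "x \<in> A" for x
  proof -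
    obtain w where w: "\<And>u. ((r x, u), (x, u \<noteq> w)) \<in> R" using near[of x] by auto
    show ?thesis
    proof (cases w)
      case True
      then have "((r x, True), (x, False)) \<in> R" "((x, True), (r x, False)) \<in> R"
        using w[of True] R_sym[OF w[of False]] by auto
      then show ?thesis using sep[OF x] R_trans unfolding ori_def by metis
    next
      case False
      then have "((r x, True), (x, True)) \<in> R" "((x, False), (r x, False)) \<in> R"
        using w[of True] R_sym[OF w[of False]] by auto
      then show ?thesis using sep[OF x] R_trans unfolding ori_def by metis
    qed
  qed
  have step: "ori (h x) \<noteq> ori x" if "x \<in> A" "h = \<gamma> \<or> h = \<alpha>" for h x
  proof -
    have "(x, h x) \<in> K" using that(2) Kc by auto
    then have r: "r (h x) = r x" using r_cong by metis
    have "((x, False), (h x, True)) \<in> R"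
      using that Rc[of x False] by auto
    then have "ori (h x) \<longleftrightarrow> ((r x, True), (x, False)) \<in> R"
      unfolding ori_def r using R_trans R_sym by metis
    then show ?thesis using flip[OF that(1)] by simp
  qed
  show ?thesis
    by (intro exI[of _ ori] ballI conjI) (use step in auto)
qed

section \<open>Counting lemmas and smoothing partners\<close>

lemma nat_less_4: "(p :: nat) < 4 \<longleftrightarrow> p = 0 \<or> p = 1 \<or> p = 2 \<or> p = 3"
  by auto

text \<open>
  The position to which the smoothing with marker \<open>m\<close> connects position \<open>p\<close> of a crossing.
\<close>

definition partner :: "int \<Rightarrow> nat \<Rightarrow> nat" where
  "partner m p = (if (m = 1) = even p then (p + 1) mod 4 else (p + 3) mod 4)"

lemma distinct_map_mono:
  assumes "distinct (map f w)" "\<And>x y. x \<in> set w \<Longrightarrow> y \<in> set w \<Longrightarrow> g x = g y \<Longrightarrow> f x = f y"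
  shows "distinct (map g w)"
  using assms unfolding distinct_map inj_on_def by blast

lemma card_subset_insert:
  assumes "X \<subseteq> insert a Z" "a \<notin> Z" "finite Z"
  shows "card X = card (X \<inter> Z) + of_bool (a \<in> X)"
proof -
  have "X = (X \<inter> Z) \<union> (if a \<in> X then {a} else {})" using assms(1) by auto
  moreover have "card ((X \<inter> Z) \<union> (if a \<in> X then {a} else {})) = card (X \<inter> Z) + of_bool (a \<in> X)"
    using assms(2,3) by simp
  ultimately show ?thesis by simp
qed

lemma card_subset_insert2:
  assumes "X \<subseteq> insert a (insert b Z)" "a \<notin> Z" "b \<notin> Z" "a \<noteq> b" "finite Z"
  shows "card X = card (X \<inter> Z) + of_bool (a \<in> X) + of_bool (b \<in> X)"
proof -
  have "card X = card (X \<inter> insert b Z) + of_bool (a \<in> X)"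
    using assms by (intro card_subset_insert) auto
  also have "card (X \<inter> insert b Z) = card (X \<inter> insert b Z \<inter> Z) + of_bool (b \<in> X \<inter> insert b Z)"
    using assms by (intro card_subset_insert) auto
  also have "X \<inter> insert b Z \<inter> Z = X \<inter> Z" by auto
  finally show ?thesis by simp
qed

lemma poly_mapping_self_neg:
  fixes x :: "'a \<Rightarrow>\<^sub>0 int"
  assumes "x = - x"
  shows "x = 0"
proof (rule poly_mapping_eqI)
  fix k
  have "Poly_Mapping.lookup x k = Poly_Mapping.lookup (- x) k" using assms by (rule arg_cong)
  then have "Poly_Mapping.lookup x k = - Poly_Mapping.lookup x k" by (simp only: lookup_uminus)
  then show "Poly_Mapping.lookup x k = Poly_Mapping.lookup 0 k" by simp
qed

lemma sum_antisymmetric: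
  fixes T :: "'a \<Rightarrow> 'a \<Rightarrow> 'b \<Rightarrow>\<^sub>0 int"
  assumes "\<And>x y. x \<in> A \<Longrightarrow> y \<in> A \<Longrightarrow> T x y = - T y x"
  shows "(\<Sum>x\<in>A. \<Sum>y\<in>A. T x y) = 0"
proof (rule poly_mapping_self_neg)
  have "(\<Sum>x\<in>A. \<Sum>y\<in>A. T x y) = (\<Sum>x\<in>A. \<Sum>y\<in>A. - T y x)"
    using assms by (intro sum.cong refl)
  also have "\<dots> = - (\<Sum>y\<in>A. \<Sum>x\<in>A. T y x)"
    by (subst sum.swap) (simp add: sum_negf)
  finally show "(\<Sum>x\<in>A. \<Sum>y\<in>A. T x y) = - (\<Sum>x\<in>A. \<Sum>y\<in>A. T x y)" .
qed

section \<open>A source-sink orientation of a planar diagram\<close>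

locale planar_diagram =
  fixes D :: "'e diagram"
  assumes link_diagram: "link_diagram D"
begin

lemma finite_edges: "finite (edges D)"
  using link_diagram by (simp add: link_diagram_def)

lemma length_crossing: "k < ncross D \<Longrightarrow> length (crossings D ! k) = 4"
  using link_diagram by (simp add: link_diagram_def ncross_def)

lemma crossing_edges: "k < ncross D \<Longrightarrow> set (crossings D ! k) \<subseteq> edges D"
  using link_diagram by (simp add: link_diagram_def ncross_def)

lemma edge_of_in_edges: "d \<in> darts D \<Longrightarrow> edge_of D d \<in> edges D"
  using crossing_edges[of "fst d"] length_crossing[of "fst d"]
  by (force simp: darts_def edge_of_def)

lemma finite_darts: "finite (darts D)"
  by (simp add: darts_def)

lemma ex1_other_end:
  assumes "d \<in> darts D"
  shows "\<exists>!d'. d' \<in> darts D \<and> d' \<noteq> d \<and> edge_of D d' = edge_of D d"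
proof -
  let ?X = "{d' \<in> darts D. edge_of D d' = edge_of D d}"
  have "card ?X \<in> {0, 2}"
    using link_diagram edge_of_in_edges[OF assms] by (auto simp: link_diagram_def)
  moreover have "d \<in> ?X" "finite ?X" using assms finite_darts by auto
  then have "card ?X \<noteq> 0" by (metis card_0_eq empty_iff)
  ultimately have "card ?X = 2" by simp
  then obtain a b where "?X = {a, b}" "a \<noteq> b" by (auto simp: card_2_iff)
  then obtain d' where X: "?X = {d, d'}" "d' \<noteq> d" using \<open>d \<in> ?X\<close> by (metis doubleton_eq_iff insertE singletonD)
  show ?thesis
  proof (rule ex1I[of _ d'])
    show "d' \<in> darts D \<and> d' \<noteq> d \<and> edge_of D d' = edge_of D d" using X by blast
    fix z assume "z \<in> darts D \<and> z \<noteq> d \<and> edge_of D z = edge_of D d"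
    then have "z \<in> {d, d'}" "z \<noteq> d" unfolding X(1)[symmetric] by auto
    then show "z = d'" by simp
  qed
qed

lemma other_end:
  assumes "d \<in> darts D"
  shows "other_end D d \<in> darts D" "other_end D d \<noteq> d" "edge_of D (other_end D d) = edge_of D d"
  using theI'[OF ex1_other_end[OF assms]] unfolding other_end_def by auto

lemma other_endI:
  assumes "d \<in> darts D" "d' \<in> darts D" "d' \<noteq> d" "edge_of D d' = edge_of D d"
  shows "other_end D d = d'"
  using ex1_other_end[OF assms(1)] other_end[OF assms(1)] assms(2-4) by blast

lemma other_end_invol: "d \<in> darts D \<Longrightarrow> other_end D (other_end D d) = d"
  using other_end[of d] by (intro other_endI) auto

text \<open>
  A source-sink orientation of the diagram: \<open>ori d\<close> says that the edge leaves the crossing at the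
  dart \<open>d\<close>. In and out alternate around every crossing, and every edge has one end of each kind.
\<close>

definition alternating :: "(nat \<times> nat \<Rightarrow> bool) \<Rightarrow> bool" where
  "alternating ori \<longleftrightarrow>
    (\<forall>d \<in> darts D. ori (fst d, (snd d + 3) mod 4) \<noteq> ori d \<and> ori (other_end D d) \<noteq> ori d)"

text \<open>
  This is the only place where planarity enters. The bounds needed for
  \<open>source_sink_orientation\<close> are one-sided: crossings and faces are invariants of the rotation
  and of the face permutation, and every component of the map comes from some piece.
\<close>

theorem ex_alternating: "\<exists>ori. alternating ori"
proof -
  define \<gamma> where "\<gamma> = (\<lambda>d. if d \<in> darts D then (fst d, (snd d + 3) mod 4) else d)"
  define \<alpha> where "\<alpha> = (\<lambda>d. if d \<in> darts D then other_end D d else d)"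
  have \<gamma>: "\<gamma> permutes darts D"
  proof (rule inj_imp_permutes)
    have unrot: "((p + 3) mod 4 + 1) mod 4 = p" if "p < 4" for p :: nat
      using that by (simp add: mod_simps)
    show "inj_on \<gamma> (darts D)"
    proof (rule inj_on_inverseI)
      fix d assume "d \<in> darts D"
      then show "(\<lambda>d. (fst d, (snd d + 1) mod 4)) (\<gamma> d) = d"
        using unrot[of "snd d"] by (auto simp: \<gamma>_def darts_def)
    qed
  qed (auto simp: \<gamma>_def finite_darts darts_def)
  have \<alpha>\<alpha>: "\<alpha> \<circ> \<alpha> = id"
    by (rule ext) (simp add: \<alpha>_def other_end other_end_invol)
  have \<alpha>: "\<alpha> permutes darts D"
  proof (rule inj_imp_permutes)
    show "inj_on \<alpha> (darts D)" by (metis \<alpha>\<alpha> inj_on_id inj_on_imageI2)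
  qed (auto simp: \<alpha>_def finite_darts other_end)
  define K where "K = conn (graph_of \<gamma> \<union> graph_of \<alpha>)"
  have Kc: "(d, \<gamma> d) \<in> K" "(d, \<alpha> d) \<in> K" for d
    using subset_conn[of "graph_of \<gamma> \<union> graph_of \<alpha>"] by (auto simp: K_def)
  have K_sym: "(d, d') \<in> K \<Longrightarrow> (d', d) \<in> K" for d d' unfolding K_def by (rule conn_sym)
  have K_trans: "(d, d') \<in> K \<Longrightarrow> (d', d'') \<in> K \<Longrightarrow> (d, d'') \<in> K" for d d' d''
    unfolding K_def by (rule conn_trans)

  have rot: "((k, p), (k, 0)) \<in> K" if "k < ncross D" "p < 4" for k p
    using that(2)
  proof (induction p)
    case 0
    show ?case by (simp add: K_def)
  next
    case (Suc p)
    have "(Suc p + 3) mod 4 = p" using Suc.prems by simp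
    then have "\<gamma> (k, Suc p) = (k, p)" using that(1) Suc.prems by (simp add: \<gamma>_def darts_def)
    with Kc(1)[of "(k, Suc p)"] Suc show ?case by (auto intro: K_trans)
  qed
  have adj: "l < ncross D \<and> (\<forall>p<4. \<forall>q<4. ((k, p), (l, q)) \<in> K)"
    if "(k, l) \<in> (adjacent_crossings D)\<^sup>*" "k < ncross D" for k l
    using that(1)
  proof (induction rule: rtrancl_induct)
    case base
    show ?case using that(2) rot K_sym K_trans by blast
  next
    case (step l m)
    have lm: "l < ncross D" "m < ncross D" and "set (crossings D ! l) \<inter> set (crossings D ! m) \<noteq> {}"
      using step(2) by (auto simp: adjacent_crossings_def)
    then obtain e where "e \<in> set (crossings D ! l)" "e \<in> set (crossings D ! m)" by blast
    then obtain i j where ij: "i < 4" "j < 4" "crossings D ! l ! i = e" "crossings D ! m ! j = e"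
      using lm length_crossing by (metis in_set_conv_nth)
    have "((l, i), (m, j)) \<in> K"
    proof (cases "(l, i) = (m, j)")
      case True
      then show ?thesis by (simp add: K_def)
    next
      case False
      then have "other_end D (l, i) = (m, j)"
        using lm ij by (intro other_endI) (auto simp: darts_def edge_of_def)
      then have "\<alpha> (l, i) = (m, j)" using lm ij by (simp add: \<alpha>_def darts_def)
      then show ?thesis using Kc(2)[of "(l, i)"] by simp
    qed
    then have "((k, p), (m, q)) \<in> K" if "p < 4" "q < 4" for p q
      using step.IH that ij rot[OF lm(2)] K_sym K_trans by meson
    then show ?case using lm by blast
  qed

  have cards: "card (darts D // K) \<le> card (pieces D)"
  proof -
    have "darts D // K \<subseteq> (\<lambda>P. K `` {(SOME k. k \<in> P, 0)}) ` pieces D"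
    proof
      fix X assume "X \<in> darts D // K"
      then obtain k p where kp: "k < ncross D" "p < 4" "X = K `` {(k, p)}"
        by (auto elim!: quotientE simp: darts_def)
      define P where "P = (adjacent_crossings D)\<^sup>* `` {k}"
      have "(SOME k. k \<in> P) \<in> P" by (rule someI[of _ k]) (simp add: P_def)
      then have "((k, p), (SOME k. k \<in> P, 0)) \<in> K"
        using adj[OF _ kp(1)] kp(2) unfolding P_def by auto
      then have "X = K `` {(SOME k. k \<in> P, 0)}"
        unfolding kp(3) K_def by (rule equiv_class_eq[OF equiv_conn])
      moreover have "P \<in> pieces D" using kp(1) by (auto simp: P_def pieces_def intro: quotientI)
      ultimately show "X \<in> (\<lambda>P. K `` {(SOME k. k \<in> P, 0)}) ` pieces D" by blast
    qed
    then show ?thesis by (rule surj_card_le[rotated]) (simp add: pieces_def finite_quot)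
  qed

  have cardv: "ncross D \<le> card (darts D // cyc \<gamma>)"
  proof -
    have "card (fst ` darts D) \<le> card (darts D // cyc \<gamma>)"
      by (rule card_image_le_quotient[OF finite_darts]) (auto simp: \<gamma>_def)
    moreover have "fst ` darts D = {..<ncross D}"
      by (simp add: darts_def lessThan_empty_iff)
    ultimately show ?thesis by simp
  qed

  have cardf: "card (faces D) \<le> card (darts D // cyc (\<gamma> \<circ> \<alpha>))"
  proof -
    have perm: "permutation (\<gamma> \<circ> \<alpha>)"
      unfolding permutation_permutes using permutes_compose[OF \<alpha> \<gamma>] finite_darts by blast
    have step: "face_step D d = (\<gamma> \<circ> \<alpha>) d" if "d \<in> darts D" for d
      using that other_end(1)[OF that]
      by (simp add: face_step_def \<gamma>_def \<alpha>_def split: prod.split)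
    have "orbit (face_step D) d = orbit (\<gamma> \<circ> \<alpha>) d" if "d \<in> darts D" for d
    proof (rule orbit_cong0[OF that])
      show "face_step D \<in> darts D \<rightarrow> darts D"
        using step permutes_in_image[OF permutes_compose[OF \<alpha> \<gamma>]] by auto
    qed (use step in auto)
    then have "faces D = orbit (\<gamma> \<circ> \<alpha>) ` darts D"
      by (auto simp: faces_def)
    moreover have "card (orbit (\<gamma> \<circ> \<alpha>) ` darts D) \<le> card (darts D // cyc (\<gamma> \<circ> \<alpha>))"
      by (rule card_image_le_quotient[OF finite_darts])
        (auto simp del: comp_apply simp: permutation_orbit_step[OF perm])
    ultimately show ?thesis by simp
  qed

  have "int (ncross D) - 2 * int (ncross D) + int (card (faces D)) = 2 * int (card (pieces D))"
    using link_diagram by (simp add: link_diagram_def)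
  then have "card (faces D) = ncross D + 2 * card (pieces D)" by linarith
  then have euler: "card (darts D) + 4 * card (darts D // conn (graph_of \<gamma> \<union> graph_of \<alpha>)) \<le>
      2 * (card (darts D // cyc \<gamma>) + card (darts D // cyc (\<gamma> \<circ> \<alpha>)))"
    using cards cardv cardf unfolding K_def by (simp add: darts_def)
  have nofix: "\<alpha> d \<noteq> d" if "d \<in> darts D" for d
    using that other_end by (simp add: \<alpha>_def)
  have parity: "even (snd (\<gamma> d)) \<noteq> even (snd d)" if "d \<in> darts D" for d
  proof -
    have "snd d < 4" using that by (auto simp: darts_def)
    then have "even ((snd d + 3) mod 4) \<noteq> even (snd d)" by presburger
    then show ?thesis using that by (simp add: \<gamma>_def)
  qed
  have "\<exists>ori :: nat \<times> nat \<Rightarrow> bool. \<forall>d \<in> darts D. ori (\<gamma> d) \<noteq> ori d \<and> ori (\<alpha> d) \<noteq> ori d"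
    by (rule source_sink_orientation[where ev = "\<lambda>d. even (snd d)",
        OF finite_darts \<gamma> \<alpha> \<alpha>\<alpha> nofix parity euler])
  then obtain ori :: "nat \<times> nat \<Rightarrow> bool"
    where ori: "\<forall>d \<in> darts D. ori (\<gamma> d) \<noteq> ori d \<and> ori (\<alpha> d) \<noteq> ori d" ..
  have "alternating ori"
    unfolding alternating_def
  proof (intro ballI conjI)
    fix d assume "d \<in> darts D"
    then show "ori (fst d, (snd d + 3) mod 4) \<noteq> ori d" "ori (other_end D d) \<noteq> ori d"
      using bspec[OF ori, of d] by (simp_all add: \<gamma>_def \<alpha>_def)
  qed
  then show ?thesis by (rule exI[of _ ori])
qed

section \<open>State circles as cycles of a permutation\<close>

text \<open>
  Following the orientation, an edge ends at its head, where the smoothing passes it on to the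
  edge at the partner position. By alternation the partner dart points out, so this defines a
  permutation whose cycles are the circles of the state.
\<close>

definition head :: "(nat \<times> nat \<Rightarrow> bool) \<Rightarrow> 'e \<Rightarrow> nat \<times> nat" where
  "head ori e = (THE d. d \<in> darts D \<and> edge_of D d = e \<and> \<not> ori d)"

definition next_edge :: "(nat \<times> nat \<Rightarrow> bool) \<Rightarrow> (nat \<Rightarrow> int) \<Rightarrow> 'e \<Rightarrow> 'e" where
  "next_edge ori s e = (if e \<in> edge_of D ` darts D
     then edge_of D (fst (head ori e), partner (s (fst (head ori e))) (snd (head ori e))) else e)"

lemma dart_eqI:
  assumes "alternating ori" "d \<in> darts D" "d' \<in> darts D" "edge_of D d = edge_of D d'" "ori d = ori d'"
  shows "d = d'"
proof (rule ccontr)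
  assume "d \<noteq> d'"
  then have "other_end D d = d'" using assms by (intro other_endI) auto
  moreover have "ori (other_end D d) \<noteq> ori d" using assms(1,2) by (simp add: alternating_def)
  ultimately show False using assms(5) by simp
qed

lemma head_eq:
  assumes "alternating ori" "d \<in> darts D" "\<not> ori d"
  shows "head ori (edge_of D d) = d"
  unfolding head_def
proof (rule the_equality)
  fix d' assume "d' \<in> darts D \<and> edge_of D d' = edge_of D d \<and> \<not> ori d'"
  then show "d' = d" using dart_eqI[OF assms(1), of d' d] assms(2,3) by simp
qed (use assms in simp)

lemma ex_dart_with_sign:
  assumes "alternating ori" "e \<in> edge_of D ` darts D"
  shows "\<exists>k p. (k, p) \<in> darts D \<and> edge_of D (k, p) = e \<and> ori (k, p) = b"
proof -
  obtain d where d: "d \<in> darts D" "edge_of D d = e" using assms(2) by auto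
  have "ori (other_end D d) \<noteq> ori d" using assms(1) d by (simp add: alternating_def)
  then have "\<exists>d'. d' \<in> darts D \<and> edge_of D d' = e \<and> ori d' = b"
    using d other_end[OF d(1)] by (cases "ori d = b") blast+
  then show ?thesis by auto
qed

lemma next_edge_eq:
  assumes "alternating ori" "(k, p) \<in> darts D" "\<not> ori (k, p)"
  shows "next_edge ori s (edge_of D (k, p)) = edge_of D (k, partner (s k) p)"
  using head_eq[OF assms] assms(2) by (simp add: next_edge_def)

lemma alternating_rotate:
  assumes "alternating ori" "k < ncross D"
  shows "ori (k, 1) \<noteq> ori (k, 0)" "ori (k, 2) = ori (k, 0)" "ori (k, 3) \<noteq> ori (k, 0)"
proof -
  have *: "ori (k, (p + 3) mod 4) \<noteq> ori (k, p)" if "p < 4" for p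
    using assms that by (force simp: alternating_def darts_def)
  have "ori (k, 0) \<noteq> ori (k, 1)" "ori (k, 1) \<noteq> ori (k, 2)" "ori (k, 2) \<noteq> ori (k, 3)"
    using *[of 1] *[of 2] *[of 3] by simp_all
  then show "ori (k, 1) \<noteq> ori (k, 0)" "ori (k, 2) = ori (k, 0)" "ori (k, 3) \<noteq> ori (k, 0)"
    by auto
qed

lemma partner_less: "partner m p < 4"
  by (simp add: partner_def)

lemma partner_simps:
  "m = 1 \<Longrightarrow> partner m 0 = 1" "m = 1 \<Longrightarrow> partner m 1 = 0"
  "m = 1 \<Longrightarrow> partner m 2 = 3" "m = 1 \<Longrightarrow> partner m 3 = 2"
  "m \<noteq> 1 \<Longrightarrow> partner m 0 = 3" "m \<noteq> 1 \<Longrightarrow> partner m 1 = 2"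
  "m \<noteq> 1 \<Longrightarrow> partner m 2 = 1" "m \<noteq> 1 \<Longrightarrow> partner m 3 = 0"
  by (simp_all add: partner_def)

lemma partner_partner: "p < 4 \<Longrightarrow> partner m (partner m p) = p"
  by (cases "m = 1") (auto simp: nat_less_4 partner_simps simp del: One_nat_def)

lemma alternating_partner:
  assumes "alternating ori" "k < ncross D" "p < 4"
  shows "ori (k, partner m p) \<noteq> ori (k, p)"
  using alternating_rotate[OF assms(1,2)] assms(3)
  by (cases "m = 1") (auto simp: nat_less_4 partner_simps simp del: One_nat_def)

text \<open>
  The image of an edge is determined by its tail, the outgoing dart, from which the head of the
  original edge is recovered as the partner. Edges without crossings are fixed.
\<close>

lemma next_edge_permutes:
  assumes ori: "alternating ori"
  shows "next_edge ori s permutes edges D"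
proof (rule inj_imp_permutes[OF _ finite_edges])
  let ?f = "next_edge ori s"
  have dart: "\<exists>k p. (k, p) \<in> darts D \<and> e = edge_of D (k, p) \<and> \<not> ori (k, p)
      \<and> ?f e = edge_of D (k, partner (s k) p) \<and> (k, partner (s k) p) \<in> darts D \<and> ori (k, partner (s k) p)"
    if e: "e \<in> edge_of D ` darts D" for e
  proof -
    obtain k p where d: "(k, p) \<in> darts D" "edge_of D (k, p) = e" "\<not> ori (k, p)"
      using ex_dart_with_sign[OF ori e, of False] by auto
    then have "k < ncross D" "p < 4" by (auto simp: darts_def)
    then have "(k, partner (s k) p) \<in> darts D" "ori (k, partner (s k) p)"
      using alternating_partner[OF ori, of k p "s k"] d(3) partner_less by (auto simp: darts_def)
    then show ?thesis using next_edge_eq[OF ori d(1,3), of s] d by auto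
  qed
  have nodart: "?f e = e" if "e \<notin> edge_of D ` darts D" for e
    using that by (simp add: next_edge_def)
  show "?f e \<in> edges D" if "e \<in> edges D" for e
    using dart[of e] nodart[of e] that edge_of_in_edges by (cases "e \<in> edge_of D ` darts D") auto
  show "?f e = e" if "e \<notin> edges D" for e
    using that edge_of_in_edges by (intro nodart) auto
  show "inj_on ?f (edges D)"
  proof (rule inj_onI)
    fix e e' assume eq: "?f e = ?f e'"
    have iff: "?f e \<in> edge_of D ` darts D \<longleftrightarrow> e \<in> edge_of D ` darts D" for e
      using dart[of e] nodart[of e] by (cases "e \<in> edge_of D ` darts D") auto
    show "e = e'"
    proof (cases "e \<in> edge_of D ` darts D")
      case True
      then have "e' \<in> edge_of D ` darts D" using iff eq by metis
      obtain k p where d: "(k, p) \<in> darts D" "e = edge_of D (k, p)" "?f e = edge_of D (k, partner (s k) p)"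
        "(k, partner (s k) p) \<in> darts D" "ori (k, partner (s k) p)"
        using dart[OF True] by blast
      obtain k' p' where d': "(k', p') \<in> darts D" "e' = edge_of D (k', p')" "?f e' = edge_of D (k', partner (s k') p')"
        "(k', partner (s k') p') \<in> darts D" "ori (k', partner (s k') p')"
        using dart[OF \<open>e' \<in> edge_of D ` darts D\<close>] by blast
      have "(k, partner (s k) p) = (k', partner (s k') p')"
        using d d' eq by (intro dart_eqI[OF ori]) auto
      then have "k = k'" "partner (s k) p = partner (s k) p'" by auto
      moreover have "p < 4" "p' < 4" using d(1) d'(1) by (simp_all add: darts_def)
      ultimately have "p = p'" by (metis partner_partner)
      then show ?thesis using d(2) d'(2) \<open>k = k'\<close> by simp
    next
      case False
      then have "e' \<notin> edge_of D ` darts D" using iff eq by metis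
      with False show ?thesis using nodart eq by simp
    qed
  qed
qed

lemma joined_partner:
  assumes "k < ncross D" "p < 4"
  shows "(edge_of D (k, p), edge_of D (k, partner (s k) p)) \<in> conn (joined D s)"
proof -
  let ?c = "crossings D ! k"
  have "smoothing ?c (s k) \<subseteq> conn (joined D s)"
    using assms(1) subset_conn[of "joined D s"] by (auto simp: joined_def)
  then have 1: "s k = 1 \<Longrightarrow> (?c ! 0, ?c ! 1) \<in> conn (joined D s) \<and> (?c ! 2, ?c ! 3) \<in> conn (joined D s)"
    and 2: "s k \<noteq> 1 \<Longrightarrow> (?c ! 1, ?c ! 2) \<in> conn (joined D s) \<and> (?c ! 3, ?c ! 0) \<in> conn (joined D s)"
    by (simp_all add: smoothing_def)
  show ?thesis
    using assms(2) 1 2 conn_sym[of _ _ "joined D s"]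
    by (cases "s k = 1") (auto simp: nat_less_4 partner_simps edge_of_def simp del: One_nat_def)
qed

lemma conn_joined:
  assumes ori: "alternating ori"
  shows "conn (joined D s) = cyc (next_edge ori s)"
proof (rule conn_eqI)
  let ?f = "next_edge ori s"
  have step: "(edge_of D (k, p), edge_of D (k, partner (s k) p)) \<in> cyc ?f" if kp: "k < ncross D" "p < 4" for k p
  proof (cases "ori (k, p)")
    case False
    then show ?thesis
      using next_edge_eq[OF ori _ False, of s] kp cyc_step[of "edge_of D (k, p)" ?f] by (simp add: darts_def)
  next
    case True
    let ?q = "partner (s k) p"
    have "\<not> ori (k, ?q)" using alternating_partner[OF ori kp, of "s k"] True by simp
    then have "?f (edge_of D (k, ?q)) = edge_of D (k, p)"
      using next_edge_eq[OF ori, of k ?q s] kp partner_less partner_partner[OF kp(2)] by (simp add: darts_def)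
    then show ?thesis using cyc_step[of "edge_of D (k, ?q)" ?f] by (simp add: conn_sym)
  qed
  have "smoothing (crossings D ! k) (s k) \<subseteq> cyc ?f" if k: "k < ncross D" for k
    using step[OF k, of 0] step[OF k, of 2] conn_sym[OF step[OF k, of 2]] step[OF k, of 3]
    by (cases "s k = 1") (auto simp: smoothing_def partner_simps edge_of_def simp del: One_nat_def)
  then show "joined D s \<subseteq> cyc ?f" by (auto simp: joined_def)
  show "graph_of ?f \<subseteq> conn (joined D s)"
  proof
    fix x assume "x \<in> graph_of ?f"
    then obtain e where x: "x = (e, ?f e)" by (auto simp: graph_of_def)
    show "x \<in> conn (joined D s)"
    proof (cases "e \<in> edge_of D ` darts D")
      case True
      obtain k p where d: "(k, p) \<in> darts D" "edge_of D (k, p) = e" "\<not> ori (k, p)"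
        using ex_dart_with_sign[OF ori True, of False] by auto
      then have "(edge_of D (k, p), edge_of D (k, partner (s k) p)) \<in> conn (joined D s)"
        by (intro joined_partner) (auto simp: darts_def)
      then show ?thesis using next_edge_eq[OF ori d(1,3), of s] d(2) x by simp
    next
      case False
      then show ?thesis using x by (simp add: next_edge_def)
    qed
  qed
qed

text \<open>
  The two smoothings at \<open>c\<close> match the two incoming darts with the two outgoing ones in the two
  possible ways, so they differ by exchanging the incoming edges. The incoming darts
  are at the positions \<open>i\<close> and \<open>i + 2\<close>.
\<close>

lemma next_edge_flip:
  assumes ori: "alternating ori" and c: "c < ncross D" "s c = 1"
    and i: "i = 0 \<or> i = 1" "\<not> ori (c, i)"
  shows "next_edge ori (s(c := -1)) =
      next_edge ori s \<circ> transpose (edge_of D (c, i)) (edge_of D (c, i + 2))" (is "?f' = ?f \<circ> _")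
    and "edge_of D (c, i) \<noteq> edge_of D (c, i + 2)"
proof -
  let ?x = "edge_of D (c, i)" and ?y = "edge_of D (c, i + 2)"
  note r = alternating_rotate[OF ori c(1)]
  have i2: "\<not> ori (c, i + 2)" using i r by (auto simp: numeral_2_eq_2 numeral_3_eq_3)
  have darts: "(c, i) \<in> darts D" "(c, i + 2) \<in> darts D" using c i by (auto simp: darts_def)
  show ne: "?x \<noteq> ?y"
  proof
    assume "?x = ?y"
    then have "(c, i) = (c, i + 2)" by (intro dart_eqI[OF ori darts]) (use i i2 in auto)
    then show False by simp
  qed
  show "?f' = ?f \<circ> transpose ?x ?y"
  proof
    fix e
    have x: "?f' ?x = edge_of D (c, partner (-1) i)" "?f ?x = edge_of D (c, partner 1 i)"
      using next_edge_eq[OF ori darts(1) i(2)] c(2) by auto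
    have y: "?f' ?y = edge_of D (c, partner (-1) (i + 2))" "?f ?y = edge_of D (c, partner 1 (i + 2))"
      using next_edge_eq[OF ori darts(2) i2] c(2) by auto
    consider "e = ?x" | "e = ?y" | "e \<noteq> ?x" "e \<noteq> ?y" "e \<in> edge_of D ` darts D" | "e \<notin> edge_of D ` darts D"
      by blast
    then show "?f' e = (?f \<circ> transpose ?x ?y) e"
    proof cases
      case 1
      have "partner (-1) i = partner 1 (i + 2)" using i(1) by (auto simp: partner_def)
      then show ?thesis using 1 x y by simp
    next
      case 2
      have "partner (-1) (i + 2) = partner 1 i" using i(1) by (auto simp: partner_def)
      then show ?thesis using 2 x y by simp
    next
      case 3
      obtain k p where d: "(k, p) \<in> darts D" "edge_of D (k, p) = e" "\<not> ori (k, p)"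
        using ex_dart_with_sign[OF ori 3(3), of False] by auto
      have "k \<noteq> c"
      proof
        assume [simp]: "k = c"
        have "p = 0 \<or> p = 1 \<or> p = 2 \<or> p = 3" using d(1) by (auto simp: darts_def)
        then have "p = i \<or> p = i + 2" using d(3) i r by (auto simp: numeral_2_eq_2 numeral_3_eq_3)
        then show False using 3(1,2) d(2) by auto
      qed
      then show ?thesis
        using next_edge_eq[OF ori d(1,3)] d(2) 3(1,2) by simp
    next
      case 4
      then have "e \<noteq> ?x" "e \<noteq> ?y" using darts by auto
      then show ?thesis using 4 by (simp add: next_edge_def)
    qed
  qed
qed

definition same_circle :: "(nat \<Rightarrow> int) \<Rightarrow> ('e \<times> 'e) set" where
  "same_circle s = conn (joined D s)"

lemma equiv_same_circle: "equiv UNIV (same_circle s)"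
  unfolding same_circle_def by (rule equiv_conn)

lemma circles_eq: "circles D s = edges D // same_circle s"
  by (simp add: circles_def same_circle_def conn_def)

lemma same_circle_crossing:
  assumes "k < ncross D"
  shows "s k = 1 \<Longrightarrow> (crossings D ! k ! 0, crossings D ! k ! 1) \<in> same_circle s"
    "s k = 1 \<Longrightarrow> (crossings D ! k ! 2, crossings D ! k ! 3) \<in> same_circle s"
    "s k \<noteq> 1 \<Longrightarrow> (crossings D ! k ! 1, crossings D ! k ! 2) \<in> same_circle s"
    "s k \<noteq> 1 \<Longrightarrow> (crossings D ! k ! 3, crossings D ! k ! 0) \<in> same_circle s"
  using joined_partner[OF assms, of 0 s] joined_partner[OF assms, of 2 s]
    joined_partner[OF assms, of 1 s] joined_partner[OF assms, of 3 s]
  by (auto simp: same_circle_def partner_simps edge_of_def simp del: One_nat_def)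

text \<open>
  This is \<open>cyc_transpose_iff\<close>, moved from the two incoming edges to positions 0 and 2; it says that
  a change of marker never turns one circle into one. Moving the edges costs
  nothing when 0 is incoming; when 1 is incoming, positions 1 and 3 are joined to 0 and 2 by both
  smoothings, in one order or the other.
\<close>

lemma same_circle_flip:
  assumes c: "c < ncross D" "s c = 1"
  defines "x \<equiv> crossings D ! c ! 0" and "y \<equiv> crossings D ! c ! 2"
  shows "((x, y) \<in> same_circle (s(c := -1)) \<longleftrightarrow> (x, y) \<notin> same_circle s) \<and>
    glue (same_circle (s(c := -1))) x y = glue (same_circle s) x y"
proof -
  let ?s' = "s(c := -1)" and ?q = "\<lambda>i. edge_of D (c, i)"
  let ?R = "same_circle s" and ?R' = "same_circle (s(c := -1))"
  note R = equivE[OF equiv_same_circle[of s]] and R' = equivE[OF equiv_same_circle[of ?s']]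
  obtain ori where ori: "alternating ori" using ex_alternating by blast
  have "\<exists>i. (i = 0 \<or> i = 1) \<and> \<not> ori (c, i)"
    using alternating_rotate(1)[OF ori c(1)] by (cases "ori (c, 0)") auto
  then obtain i where i: "i = 0 \<or> i = 1" "\<not> ori (c, i)" by auto
  note fl = next_edge_flip[of ori c s i, OF ori c i]
  have q_in: "?q j \<in> edges D" if "j < 4" for j
    using that c(1) by (intro edge_of_in_edges) (simp add: darts_def)
  have main: "(?q i, ?q (i + 2)) \<in> ?R' \<longleftrightarrow> (?q i, ?q (i + 2)) \<notin> ?R"
    "glue ?R' (?q i) (?q (i + 2)) = glue ?R (?q i) (?q (i + 2))"
    unfolding same_circle_def conn_joined[OF ori] fl(1)
    using cyc_transpose_iff[OF next_edge_permutes[OF ori] finite_edges q_in q_in fl(2)] i(1)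
    by (auto simp: cyc_compose_transpose)
  have x: "x = ?q 0" and y: "y = ?q 2" by (simp_all add: x_def y_def edge_of_def)
  have sym: "(u, v) \<in> ?R \<Longrightarrow> (v, u) \<in> ?R" "(u, v) \<in> ?R' \<Longrightarrow> (v, u) \<in> ?R'" for u v
    unfolding same_circle_def by (auto intro: conn_sym)
  show "((x, y) \<in> ?R' \<longleftrightarrow> (x, y) \<notin> ?R) \<and> glue ?R' x y = glue ?R x y"
    using i(1)
  proof
    assume "i = 0"
    then show ?thesis using main unfolding x y by (simp add: numeral_2_eq_2)
  next
    assume i: "i = 1"
    let ?u = "?q 1" and ?v = "?q 3"
    have R: "(?u, x) \<in> ?R" "(?v, y) \<in> ?R"
      using same_circle_crossing(1,2)[OF c(1), of s] c(2) sym(1) by (auto simp: x_def y_def edge_of_def)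
    have R': "(?u, y) \<in> ?R'" "(?v, x) \<in> ?R'"
      using same_circle_crossing(3,4)[OF c(1), of ?s'] by (auto simp: x_def y_def edge_of_def)
    have "?R `` {?u} = ?R `` {x}" "?R `` {?v} = ?R `` {y}" "?R' `` {?u} = ?R' `` {y}" "?R' `` {?v} = ?R' `` {x}"
      using R R' by (simp_all only: equiv_class_eq[OF equiv_same_circle])
    then have "(?u, ?v) \<in> ?R \<longleftrightarrow> (x, y) \<in> ?R" "(?u, ?v) \<in> ?R' \<longleftrightarrow> (y, x) \<in> ?R'"
      by (simp_all flip: eq_equiv_class_iff[OF equiv_same_circle UNIV_I UNIV_I])
    moreover have "glue ?R ?u ?v = glue ?R x y"
      by (rule glue_cong[OF equiv_same_circle R])
    moreover have "glue ?R' ?u ?v = glue ?R' x y"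
      using glue_cong[OF equiv_same_circle R'] by (simp add: glue_def insert_commute)
    moreover have "(1 :: nat) + 2 = 3" by simp
    ultimately show ?thesis using main sym(2)[of x y] sym(2)[of y x] unfolding i by metis
  qed
qed

section \<open>Flips act on monomials\<close>

abbreviation circ :: "(nat \<Rightarrow> int) \<Rightarrow> 'e \<Rightarrow> 'e set" where
  "circ s e \<equiv> same_circle s `` {e}"

definition marked_state :: "(nat \<Rightarrow> int) \<Rightarrow> 'e set set \<Rightarrow> 'e estate" where
  "marked_state s P = (s, \<lambda>\<gamma>\<in>circles D s. if \<gamma> \<in> P then 1 else -1)"

text \<open>
  The product of the edge variables \<open>x\<^sub>e\<close> for \<open>e\<close> in \<open>w\<close>, in the polynomial ring on the edges modulo
  the relations that \<open>x\<^sub>e = x\<^sub>f\<close> when \<open>e\<close> and \<open>f\<close> lie on the same circle, and that squares vanish.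
  A positive circle stands for the variable and a negative one for the unit. The advantage over
  enhanced states is that one list \<open>w\<close> makes sense for all Kauffman states at once.
\<close>

definition monomial :: "(nat \<Rightarrow> int) \<Rightarrow> 'e list \<Rightarrow> 'e estate \<Rightarrow>\<^sub>0 int" where
  "monomial s w = (if distinct (map (circ s) w) then frag_of (marked_state s (circ s ` set w)) else 0)"

text \<open>
  The enhanced states with nonzero incidence to \<open>S\<close> that arise by changing the marker at \<open>c\<close>.
  The condition on \<open>tau_deg\<close> expresses that the second grading is preserved.
\<close>

definition successors :: "nat \<Rightarrow> 'e estate \<Rightarrow> 'e estate set" where
  "successors c S = {S' \<in> enhanced_states D. fst S c = 1 \<and> fst S' = (fst S)(c := -1) \<and>
     (\<forall>\<gamma> \<in> circles D (fst S) \<union> circles D (fst S').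
        \<gamma> \<inter> set (crossings D ! c) = {} \<longrightarrow> snd S \<gamma> = snd S' \<gamma>) \<and>
     tau_deg D S' = tau_deg D S + 1}"

definition flip :: "nat \<Rightarrow> 'e estate \<Rightarrow> 'e estate \<Rightarrow>\<^sub>0 int" where
  "flip c S = (\<Sum>S' \<in> successors c S. frag_of S')"

definition merges :: "nat \<Rightarrow> (nat \<Rightarrow> int) \<Rightarrow> (nat \<Rightarrow> int) \<Rightarrow> bool" where
  "merges c s s' \<longleftrightarrow> (crossings D ! c ! 0, crossings D ! c ! 2) \<notin> same_circle s \<and>
     same_circle s' = glue (same_circle s) (crossings D ! c ! 0) (crossings D ! c ! 2)"

lemma merges_cases:
  assumes "c < ncross D" "s c = 1"
  shows "merges c s (s(c := -1)) \<or> merges c (s(c := -1)) s"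
proof (cases "(crossings D ! c ! 0, crossings D ! c ! 2) \<in> same_circle s")
  case True
  with same_circle_flip[of c s, OF assms] glue_absorb[OF equiv_same_circle True] show ?thesis
    unfolding merges_def by simp
next
  case False
  with same_circle_flip[of c s, OF assms]
  have "(crossings D ! c ! 0, crossings D ! c ! 2) \<in> same_circle (s(c := -1))" by simp
  from glue_absorb[OF equiv_same_circle this] same_circle_flip[of c s, OF assms] False show ?thesis
    unfolding merges_def by simp
qed

lemma finite_circles: "finite (circles D s)"
  by (simp add: circles_eq finite_quot finite_edges)

lemma crossing_in_edges: "c < ncross D \<Longrightarrow> i < 4 \<Longrightarrow> crossings D ! c ! i \<in> edges D"
  using crossing_edges[of c] length_crossing[of c] by (metis nth_mem subsetD)

lemma circ_in_circles: "e \<in> edges D \<Longrightarrow> circ s e \<in> circles D s"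
  by (auto simp: circles_eq intro: quotientI)

lemma circ_eq_iff: "circ s e = circ s e' \<longleftrightarrow> (e, e') \<in> same_circle s"
  by (simp add: eq_equiv_class_iff[OF equiv_same_circle])

lemma untouched_iff:
  assumes "c < ncross D" "\<gamma> \<in> circles D s"
  shows "\<gamma> \<inter> set (crossings D ! c) = {} \<longleftrightarrow>
    \<gamma> \<noteq> circ s (crossings D ! c ! 0) \<and> \<gamma> \<noteq> circ s (crossings D ! c ! 2)"
proof -
  let ?q = "\<lambda>i. crossings D ! c ! i"
  have "set (crossings D ! c) = {?q 0, ?q 1, ?q 2, ?q 3}"
    using length_crossing[OF assms(1)]
    by (auto simp: set_conv_nth nat_less_4)
  moreover obtain e where e: "\<gamma> = circ s e"
    using assms(2) by (auto simp: circles_eq elim: quotientE)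
  have "x \<in> \<gamma> \<longleftrightarrow> circ s e = circ s x" for x
    by (simp add: e circ_eq_iff)
  moreover have "circ s (?q 1) = circ s (?q 0) \<and> circ s (?q 3) = circ s (?q 2) \<or>
      circ s (?q 1) = circ s (?q 2) \<and> circ s (?q 3) = circ s (?q 0)"
    using same_circle_crossing[OF assms(1), of s] unfolding circ_eq_iff[symmetric] by metis
  ultimately show ?thesis unfolding e by auto
qed

text \<open>
  Complete bookkeeping for a merging of the circles \<open>g0\<close> and \<open>g2\<close> into \<open>g\<close>. It is used in both
  directions, since a splitting is a merging read backwards. The remaining circles \<open>Z\<close> are common
  to both states and are exactly those that do not touch the crossing.
\<close>

lemma merges_circles:
  assumes m: "merges c s s'" and c: "c < ncross D"
  defines "g0 \<equiv> circ s (crossings D ! c ! 0)" and "g2 \<equiv> circ s (crossings D ! c ! 2)"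
  defines "g \<equiv> circ s' (crossings D ! c ! 0)"
  defines "Z \<equiv> circles D s - {g0, g2}"
  shows "circles D s = insert g0 (insert g2 Z)" "circles D s' = insert g Z"
    "g0 \<noteq> g2" "g \<notin> Z" "circ s' (crossings D ! c ! 2) = g"
    "circ s' e = (if circ s e = g0 \<or> circ s e = g2 then g else circ s e)"
    "g0 \<notin> Z" "g2 \<notin> Z" "finite Z"
    "{\<gamma> \<in> circles D s \<union> circles D s'. \<gamma> \<inter> set (crossings D ! c) = {}} = Z"
proof -
  let ?x = "crossings D ! c ! 0" and ?y = "crossings D ! c ! 2"
  let ?R = "same_circle s" and ?R' = "same_circle s'"
  have xy: "(?x, ?y) \<notin> ?R" and R': "?R' = glue ?R ?x ?y" using m by (simp_all add: merges_def)
  have in_edges: "?x \<in> edges D" "?y \<in> edges D" using c by (simp_all add: crossing_in_edges)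
  have Z: "Z = edges D // ?R - {?R `` {?x}, ?R `` {?y}}" by (simp add: Z_def g0_def g2_def circles_eq)
  note q = quotient_glue[OF equiv_same_circle in_edges xy, folded Z R' circles_eq g0_def g2_def]
  have rfl: "(e, e) \<in> ?R" for e by (simp add: same_circle_def)
  have R'_iff: "circ s' e = (if circ s e = g0 \<or> circ s e = g2 then g0 \<union> g2 else circ s e)" for e
  proof -
    have *: "(e, u) \<in> ?R' \<longleftrightarrow> (e, u) \<in> ?R \<or> (e \<in> g0 \<union> g2 \<and> u \<in> g0 \<union> g2)" for u
      unfolding R' glue_def g0_def g2_def by auto
    have i: "e \<in> g0 \<longleftrightarrow> circ s e = g0" "e \<in> g2 \<longleftrightarrow> circ s e = g2"
      unfolding g0_def g2_def circ_eq_iff by (auto simp: same_circle_def intro: conn_sym)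
    show ?thesis
    proof (cases "circ s e = g0 \<or> circ s e = g2")
      case True
      then show ?thesis using * i by auto
    next
      case False
      then show ?thesis using * i by auto
    qed
  qed
  have g: "g = g0 \<union> g2" unfolding g_def R'_iff g0_def[symmetric] by simp
  show "circles D s = insert g0 (insert g2 Z)" "circles D s' = insert g Z"
    "g0 \<noteq> g2" "g \<notin> Z" using q by (simp_all add: g)
  show g': "circ s' ?y = g" unfolding R'_iff g2_def[symmetric] g by simp
  show "circ s' e = (if circ s e = g0 \<or> circ s e = g2 then g else circ s e)"
    unfolding g by (rule R'_iff)
  show "g0 \<notin> Z" "g2 \<notin> Z" "finite Z" using finite_circles by (auto simp: Z_def)
  show "{\<gamma> \<in> circles D s \<union> circles D s'. \<gamma> \<inter> set (crossings D ! c) = {}} = Z"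
  proof -
    have 1: "\<gamma> \<inter> set (crossings D ! c) = {} \<longleftrightarrow> \<gamma> \<in> Z" if "\<gamma> \<in> circles D s" for \<gamma>
      using untouched_iff[OF c that] that by (simp add: Z_def g0_def g2_def)
    have 2: "\<gamma> \<inter> set (crossings D ! c) = {} \<longleftrightarrow> \<gamma> \<in> Z" if "\<gamma> \<in> circles D s'" for \<gamma>
      using untouched_iff[OF c that] g' q(2,4) that unfolding g_def[symmetric] g[symmetric] by auto
    have 3: "Z \<subseteq> circles D s" by (simp add: Z_def)
    show ?thesis
    proof (rule Set.set_eqI)
      fix \<gamma> show "\<gamma> \<in> {\<gamma> \<in> circles D s \<union> circles D s'. \<gamma> \<inter> set (crossings D ! c) = {}} \<longleftrightarrow> \<gamma> \<in> Z"
        using 1[of \<gamma>] 2[of \<gamma>] subsetD[OF 3, of \<gamma>] by auto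
    qed
  qed
qed

lemma marked_state_inj:
  assumes "marked_state s P = marked_state s P'" "P \<subseteq> circles D s" "P' \<subseteq> circles D s"
  shows "P = P'"
proof -
  have "\<gamma> \<in> P \<longleftrightarrow> \<gamma> \<in> P'" if "\<gamma> \<in> circles D s" for \<gamma>
    using fun_cong[OF conjunct2[OF assms(1)[unfolded marked_state_def prod.inject]], of \<gamma>] that
    by (simp split: if_splits)
  then show ?thesis using assms(2,3) by blast
qed

lemma enhanced_states_eq:
  "enhanced_states D = (\<Union>s \<in> kauffman_states D. marked_state s ` Pow (circles D s))"
proof
  show "enhanced_states D \<subseteq> (\<Union>s \<in> kauffman_states D. marked_state s ` Pow (circles D s))"
  proof
    fix S assume "S \<in> enhanced_states D"
    then obtain s l where S: "S = (s, l)" "s \<in> kauffman_states D" "l \<in> circles D s \<rightarrow>\<^sub>E {1, -1}"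
      by (auto simp: enhanced_states_def)
    have "l = snd (marked_state s {\<gamma> \<in> circles D s. l \<gamma> = 1})"
    proof
      fix \<gamma> show "l \<gamma> = snd (marked_state s {\<gamma> \<in> circles D s. l \<gamma> = 1}) \<gamma>"
        using S(3) by (cases "\<gamma> \<in> circles D s") (auto simp: marked_state_def PiE_def extensional_def Pi_def)
    qed
    then have "S = marked_state s {\<gamma> \<in> circles D s. l \<gamma> = 1}" using S(1) by (simp add: marked_state_def)
    then show "S \<in> (\<Union>s \<in> kauffman_states D. marked_state s ` Pow (circles D s))" using S(2) by blast
  qed
  show "(\<Union>s \<in> kauffman_states D. marked_state s ` Pow (circles D s)) \<subseteq> enhanced_states D"
    by (auto simp: enhanced_states_def marked_state_def)
qed

lemma tau_deg_marked_state:
  assumes "P \<subseteq> circles D s"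
  shows "tau_deg D (marked_state s P) = 2 * int (card P) - int (card (circles D s))"
proof -
  have "tau_deg D (marked_state s P) = (\<Sum>\<gamma> \<in> circles D s. if \<gamma> \<in> P then 1 else -1)"
    by (simp add: tau_deg_def marked_state_def)
  also have "\<dots> = (\<Sum>\<gamma> \<in> circles D s. 2 * (if \<gamma> \<in> P then 1 else 0) - 1)"
    by (rule sum.cong) auto
  also have "\<dots> = 2 * int (card P) - int (card (circles D s))"
    using assms finite_circles
    by (simp add: sum_subtractf sum.If_cases Int_absorb1 flip: sum_distrib_left)
  finally show ?thesis .
qed

lemma flip_kauffman: "s \<in> kauffman_states D \<Longrightarrow> c < ncross D \<Longrightarrow> s(c := -1) \<in> kauffman_states D"
  by (auto simp: kauffman_states_def PiE_def extensional_def Pi_def)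

text \<open>
  Translation into sets of positive circles: the successors agree with \<open>P\<close> away from the crossing,
  and the degree condition fixes the number of positive circles among those that touch it.
\<close>

lemma successors_marked_state:
  assumes s: "s \<in> kauffman_states D" and c: "c < ncross D" "s c = 1" and P: "P \<subseteq> circles D s"
  defines "s' \<equiv> s(c := -1)"
  defines "Z \<equiv> {\<gamma> \<in> circles D s \<union> circles D s'. \<gamma> \<inter> set (crossings D ! c) = {}}"
  shows "successors c (marked_state s P) = marked_state s' ` {P'. P' \<subseteq> circles D s' \<and>
     P' \<inter> Z = P \<inter> Z \<and>
     2 * int (card P') - int (card (circles D s')) = 2 * int (card P) - int (card (circles D s)) + 1}"
    (is "_ = marked_state s' ` ?X")
proof -
  have Z: "Z \<subseteq> circles D s \<inter> circles D s'"
    using merges_cases[of c s, OF c, folded s'_def]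
  proof
    assume m: "merges c s s'"
    then show ?thesis
      unfolding Z_def merges_circles(10)[OF m c(1)] using merges_circles(2)[OF m c(1)] by auto
  next
    assume m: "merges c s' s"
    have "Z = {\<gamma> \<in> circles D s' \<union> circles D s. \<gamma> \<inter> set (crossings D ! c) = {}}"
      unfolding Z_def by (simp add: Un_commute)
    then show ?thesis
      unfolding merges_circles(10)[OF m c(1)] using merges_circles(2)[OF m c(1)] by auto
  qed
  have agree: "(\<forall>\<gamma> \<in> Z. snd (marked_state s P) \<gamma> = snd (marked_state s' P') \<gamma>) \<longleftrightarrow> P' \<inter> Z = P \<inter> Z" for P'
  proof -
    have "snd (marked_state s P) \<gamma> = snd (marked_state s' P') \<gamma> \<longleftrightarrow> (\<gamma> \<in> P' \<longleftrightarrow> \<gamma> \<in> P)" if "\<gamma> \<in> Z" for \<gamma>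
      using that Z by (auto simp: marked_state_def)
    then show ?thesis by blast
  qed
  have succ: "marked_state s' P' \<in> successors c (marked_state s P) \<longleftrightarrow> P' \<in> ?X" if P': "P' \<subseteq> circles D s'" for P'
  proof -
    have "marked_state s' P' \<in> enhanced_states D"
      using flip_kauffman[OF s c(1)] P' by (auto simp: enhanced_states_eq s'_def)
    moreover have "(\<forall>\<gamma> \<in> circles D s \<union> circles D s'. \<gamma> \<inter> set (crossings D ! c) = {} \<longrightarrow>
        snd (marked_state s P) \<gamma> = snd (marked_state s' P') \<gamma>) \<longleftrightarrow> P' \<inter> Z = P \<inter> Z"
      using agree[of P'] unfolding Z_def by blast
    moreover have "fst (marked_state s P) = s" "fst (marked_state s' P') = s'" by (simp_all add: marked_state_def)
    ultimately show ?thesis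
      using c P P' unfolding successors_def by (simp add: tau_deg_marked_state s'_def)
  qed
  show ?thesis
  proof
    show "marked_state s' ` ?X \<subseteq> successors c (marked_state s P)"
      using succ by blast
    show "successors c (marked_state s P) \<subseteq> marked_state s' ` ?X"
    proof
      fix S' assume S': "S' \<in> successors c (marked_state s P)"
      then have "S' \<in> enhanced_states D" "fst S' = s'"
        by (simp_all add: successors_def marked_state_def s'_def)
      then obtain P' where "S' = marked_state s' P'" "P' \<subseteq> circles D s'"
        by (auto simp: enhanced_states_eq marked_state_def)
      then show "S' \<in> marked_state s' ` ?X" using succ S' by blast
    qed
  qed
qed

text \<open>
  A merging keeps the number of positive circles. Among those touching the crossing this leaves no
  choice for the sign of the new circle, and no solution if both old circles are positive; the
  monomial then vanishes too, because two of its edges lie on the new circle.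
\<close>

lemma flip_monomial_merge:
  assumes s: "s \<in> kauffman_states D" and c: "c < ncross D" "s c = 1" and w: "set w \<subseteq> edges D"
    and m: "merges c s (s(c := -1))"
  shows "frag_extend (flip c) (monomial s w) = monomial (s(c := -1)) w"
proof -
  define s' where "s' = s(c := -1)"
  define g0 where "g0 = circ s (crossings D ! c ! 0)"
  define g2 where "g2 = circ s (crossings D ! c ! 2)"
  define g where "g = circ s' (crossings D ! c ! 0)"
  define Z where "Z = circles D s - {g0, g2}"
  note C = merges_circles[OF m c(1), folded g0_def g2_def s'_def, folded g_def Z_def]
  have circ_cong: "circ s x = circ s y \<Longrightarrow> circ s' x = circ s' y" for x y by (simp add: C(6))
  show ?thesis
  proof (cases "distinct (map (circ s) w)")
    case False
    then have "\<not> distinct (map (circ s') w)"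
      using distinct_map_mono[of "circ s'" w "circ s"] circ_cong by blast
    with False show ?thesis by (simp add: monomial_def s'_def)
  next
    case True
    define P where "P = circ s ` set w"
    define P1 where "P1 = circ s' ` set w"
    have P: "P \<subseteq> circles D s" "P1 \<subseteq> circles D s'"
      using w by (auto simp: P_def P1_def circ_in_circles)
    have "P1 = (\<lambda>\<gamma>. if \<gamma> = g0 \<or> \<gamma> = g2 then g else \<gamma>) ` P"
      unfolding P1_def P_def image_image by (rule image_cong[OF refl C(6)])
    then have P1Z: "P1 \<inter> Z = P \<inter> Z" and gP1: "g \<in> P1 \<longleftrightarrow> g0 \<in> P \<or> g2 \<in> P"
      using P(1) C(4,7,8) unfolding C(1) by (auto split: if_splits)
    have cardP: "card P = length w"
      using distinct_card[OF True] by (simp add: P_def)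
    have cc: "card (circles D s) = card (circles D s') + 1"
      using C by (simp add: C(1) C(2))
    define X where "X = {P'. P' \<subseteq> insert g Z \<and> P' \<inter> Z = P \<inter> Z \<and> card P' = card P}"
    have succ: "successors c (marked_state s P) = marked_state s' ` X"
      unfolding X_def
      using successors_marked_state[of s c P, OF s c P(1), folded s'_def] cc unfolding C(10) C(2)[symmetric] by auto
    have flip: "frag_extend (flip c) (monomial s w) = (\<Sum>S' \<in> marked_state s' ` X. frag_of S')"
      using True succ by (simp add: monomial_def flip_def P_def[symmetric])
    have card1: "card P' = card (P' \<inter> Z) + of_bool (g \<in> P')" if "P' \<subseteq> insert g Z" for P'
      using that C by (intro card_subset_insert) auto
    have card2: "card P = card (P \<inter> Z) + of_bool (g0 \<in> P) + of_bool (g2 \<in> P)"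
      using P(1) C by (intro card_subset_insert2) auto
    show ?thesis
    proof (cases "g0 \<in> P \<and> g2 \<in> P")
      case both: True
      have "card P1 \<noteq> length w"
        using card1[of P1] card2 both P(2) gP1 P1Z unfolding C(2) cardP[symmetric] by simp
      then have "\<not> distinct (map (circ s') w)"
        using distinct_card[of "map (circ s') w"] by (auto simp: P1_def)
      then have "monomial s' w = 0" by (simp add: monomial_def)
      moreover have "X = {}"
        using card1 card2 both by (auto simp: X_def)
      ultimately show ?thesis unfolding flip by (simp flip: s'_def)
    next
      case not_both: False
      have "distinct (map (circ s') w)"
      proof (rule distinct_map_mono[OF True])
        fix x y assume xy: "x \<in> set w" "y \<in> set w" "circ s' x = circ s' y"
        then have "circ s x \<in> P" "circ s y \<in> P" by (auto simp: P_def)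
        then show "circ s x = circ s y"
          using xy(3) C(4) P(1) not_both unfolding C(6) C(1) by (auto split: if_splits)
      qed
      then have d: "monomial s' w = frag_of (marked_state s' P1)" and card_eq: "card P1 = card P"
        using distinct_card[of "map (circ s') w"] cardP by (simp_all add: monomial_def P1_def)
      have uniq: "P' = P1" if P': "P' \<subseteq> insert g Z" "P' \<inter> Z = P \<inter> Z" "card P' = card P" for P'
      proof -
        have "of_bool (g \<in> P') = (of_bool (g \<in> P1) :: nat)"
          using card1[OF P'(1)] card1[of P1] P(2) P' P1Z card_eq unfolding C(2) by simp
        then have "g \<in> P' \<longleftrightarrow> g \<in> P1" by (cases "g \<in> P'"; cases "g \<in> P1") simp_all
        then show ?thesis using P'(1,2) P(2) P1Z unfolding C(2) by blast
      qed
      have "P1 \<in> X" using P(2) P1Z card_eq unfolding C(2) X_def by simp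
      then have "X = {P1}" using uniq unfolding X_def by blast
      then show ?thesis unfolding flip using d by (simp flip: s'_def)
    qed
  qed
qed

text \<open>
  A splitting raises the number of positive circles by one. If the old circle was negative, one of
  the two new circles becomes positive, which gives the two summands. If it was positive, both
  become positive: one of them already contains an edge of \<open>w\<close>, so that the corresponding summand
  vanishes and the other one survives.
\<close>

lemma flip_monomial_split:
  assumes s: "s \<in> kauffman_states D" and c: "c < ncross D" "s c = 1" and w: "set w \<subseteq> edges D"
    and m: "merges c (s(c := -1)) s"
  shows "frag_extend (flip c) (monomial s w) =
    monomial (s(c := -1)) (crossings D ! c ! 0 # w) + monomial (s(c := -1)) (crossings D ! c ! 2 # w)"
proof -
  define s' where "s' = s(c := -1)"
  let ?x = "crossings D ! c ! 0" and ?y = "crossings D ! c ! 2"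
  define g0 where "g0 = circ s' ?x"
  define g2 where "g2 = circ s' ?y"
  define g where "g = circ s ?x"
  define Z where "Z = circles D s' - {g0, g2}"
  note C = merges_circles[OF m[folded s'_def] c(1), folded g0_def g2_def, folded g_def Z_def]
  have circ_cong: "circ s' x = circ s' y \<Longrightarrow> circ s x = circ s y" for x y by (simp add: C(6))
  define P where "P = circ s ` set w"
  define P1 where "P1 = circ s' ` set w"
  have P: "P \<subseteq> circles D s" "P1 \<subseteq> circles D s'"
    using w by (auto simp: P_def P1_def circ_in_circles)
  have mon0: "monomial s' (?x # w) =
      (if g0 \<notin> P1 \<and> distinct (map (circ s') w) then frag_of (marked_state s' (insert g0 P1)) else 0)"
    by (simp add: monomial_def g0_def P1_def image_iff)
  have mon2: "monomial s' (?y # w) =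
      (if g2 \<notin> P1 \<and> distinct (map (circ s') w) then frag_of (marked_state s' (insert g2 P1)) else 0)"
    by (simp add: monomial_def g2_def P1_def image_iff)
  have "frag_extend (flip c) (monomial s w) = monomial s' (?x # w) + monomial s' (?y # w)"
  proof (cases "distinct (map (circ s) w)")
    case False
    have "g0 \<in> P1 \<and> g2 \<in> P1" if d: "distinct (map (circ s') w)"
    proof -
      have "\<exists>x \<in> set w. \<exists>y \<in> set w. circ s x = circ s y \<and> circ s' x \<noteq> circ s' y"
      proof (rule ccontr)
        assume "\<not> ?thesis"
        then have "distinct (map (circ s) w)"
          by (intro distinct_map_mono[OF d]) metis
        with False show False ..
      qed
      then obtain x y where xy: "x \<in> set w" "y \<in> set w" "circ s x = circ s y" "circ s' x \<noteq> circ s' y"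
        by (elim bexE conjE)
      define u v where "u = circ s' x" and "v = circ s' y"
      have uv: "u \<in> P1" "v \<in> P1" using xy(1,2) by (auto simp: P1_def u_def v_def)
      then have "u \<in> insert g0 (insert g2 Z)" "v \<in> insert g0 (insert g2 Z)"
        using P(2) unfolding C(1) by (simp_all add: subset_iff)
      moreover have "(if u = g0 \<or> u = g2 then g else u) = (if v = g0 \<or> v = g2 then g else v)" "u \<noteq> v"
        using xy(3,4) unfolding C(6) u_def v_def by simp_all
      ultimately have "u = g0 \<and> v = g2 \<or> u = g2 \<and> v = g0"
        using C(4) by (metis insertE)
      then show ?thesis using uv by auto
    qed
    then show ?thesis using False unfolding mon0 mon2 by (auto simp: monomial_def)
  next
    case True
    have d: "distinct (map (circ s') w)"
      by (rule distinct_map_mono[OF True]) (rule circ_cong)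
    have not_both: "\<not> (g0 \<in> P1 \<and> g2 \<in> P1)"
    proof
      assume "g0 \<in> P1 \<and> g2 \<in> P1"
      then obtain x y where xy: "x \<in> set w" "y \<in> set w" "circ s' x = g0" "circ s' y = g2"
        by (auto simp: P1_def)
      then have "circ s x = circ s y" by (simp add: C(6))
      then have "x = y" using True xy(1,2) by (auto simp: distinct_map inj_on_def)
      then show False using xy C(3) by simp
    qed
    have "P = (\<lambda>\<gamma>. if \<gamma> = g0 \<or> \<gamma> = g2 then g else \<gamma>) ` P1"
      unfolding P1_def P_def image_image by (rule image_cong[OF refl C(6)])
    then have PZ: "P \<inter> Z = P1 \<inter> Z"
      using P(2) C(4,7,8) unfolding C(1) by (auto split: if_splits)
    have card_eq: "card P = card P1"
      using distinct_card[OF True] distinct_card[OF d] by (simp add: P_def P1_def)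
    have cc: "card (circles D s') = card (circles D s) + 1"
      using C by (simp add: C(1) C(2))
    define X where "X = {P'. P' \<subseteq> circles D s' \<and> P' \<inter> Z = P1 \<inter> Z \<and> card P' = card P1 + 1}"
    have ZZ: "{\<gamma> \<in> circles D s \<union> circles D s'. \<gamma> \<inter> set (crossings D ! c) = {}} = Z"
      using C(10) by (simp add: Un_commute)
    have succ: "successors c (marked_state s P) = marked_state s' ` X"
      using successors_marked_state[of s c P, OF s c P(1), folded s'_def] cc
      unfolding ZZ PZ card_eq X_def by auto
    have card1: "card P' = card (P' \<inter> Z) + of_bool (g0 \<in> P') + of_bool (g2 \<in> P')"
      if "P' \<subseteq> circles D s'" for P'
      using that C by (intro card_subset_insert2) auto
    have X_iff: "P' \<in> X \<longleftrightarrow> P' \<subseteq> circles D s' \<and> P' \<inter> Z = P1 \<inter> Z \<and>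
        of_bool (g0 \<in> P') + of_bool (g2 \<in> P') = of_bool (g0 \<in> P1) + of_bool (g2 \<in> P1) + (1 :: nat)" for P'
      using card1[of P'] card1[OF P(2)] unfolding X_def by auto
    have eqI: "A = B" if "A \<subseteq> circles D s'" "B \<subseteq> circles D s'" "A \<inter> Z = B \<inter> Z"
      "g0 \<in> A \<longleftrightarrow> g0 \<in> B" "g2 \<in> A \<longleftrightarrow> g2 \<in> B" for A B
      using that unfolding C(1) by blast
    have g02: "g0 \<in> circles D s'" "g2 \<in> circles D s'" using C(1) by auto
    have ins: "insert g0 P1 \<subseteq> circles D s'" "insert g2 P1 \<subseteq> circles D s'"
      "insert g0 P1 \<inter> Z = P1 \<inter> Z" "insert g2 P1 \<inter> Z = P1 \<inter> Z"
      using g02 P(2) C(7,8) by auto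
    have flip: "frag_extend (flip c) (monomial s w) = (\<Sum>S' \<in> marked_state s' ` X. frag_of S')"
      using True succ by (simp add: monomial_def flip_def P_def[symmetric])
    consider "g0 \<in> P1" "g2 \<notin> P1" | "g0 \<notin> P1" "g2 \<in> P1" | "g0 \<notin> P1" "g2 \<notin> P1" using not_both by blast
    then show ?thesis
    proof cases
      case 1
      have "X = {insert g2 P1}"
      proof (rule Set.set_eqI)
        fix P' show "P' \<in> X \<longleftrightarrow> P' \<in> {insert g2 P1}"
          using X_iff[of P'] eqI[of P' "insert g2 P1"] ins 1 C(3) by (auto split: if_splits simp: of_bool_def)
      qed
      then show ?thesis unfolding flip mon0 mon2 using d 1 by simp
    next
      case 2
      have "X = {insert g0 P1}"
      proof (rule Set.set_eqI)
        fix P' show "P' \<in> X \<longleftrightarrow> P' \<in> {insert g0 P1}"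
          using X_iff[of P'] eqI[of P' "insert g0 P1"] ins 2 C(3) by (auto split: if_splits simp: of_bool_def)
      qed
      then show ?thesis unfolding flip mon0 mon2 using d 2 by simp
    next
      case 3
      have "X = {insert g0 P1, insert g2 P1}"
      proof (rule Set.set_eqI)
        fix P' show "P' \<in> X \<longleftrightarrow> P' \<in> {insert g0 P1, insert g2 P1}"
          using X_iff[of P'] eqI[of P' "insert g0 P1"] eqI[of P' "insert g2 P1"] ins 3 C(3)
          by (auto split: if_splits simp: of_bool_def)
      qed
      moreover have "marked_state s' (insert g0 P1) \<noteq> marked_state s' (insert g2 P1)"
        using marked_state_inj[of s' "insert g0 P1" "insert g2 P1"] ins 3 C(3) by blast
      ultimately show ?thesis unfolding flip mon0 mon2 using d 3 by simp
    qed
  qed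
  then show ?thesis by (simp add: s'_def)
qed

section \<open>Flips at different crossings commute\<close>

lemma monomial_Cons_cong: "circ s x = circ s y \<Longrightarrow> monomial s (x # w) = monomial s (y # w)"
  by (simp add: monomial_def)

lemma monomial_swap: "monomial s (x # y # w) = monomial s (y # x # w)"
  by (auto simp: monomial_def insert_commute)

lemma ex_edges_of_circles:
  assumes "P \<subseteq> circles D s"
  shows "\<exists>w. set w \<subseteq> edges D \<and> distinct (map (circ s) w) \<and> circ s ` set w = P"
proof -
  have "finite P" using assms finite_circles by (rule finite_subset)
  then obtain gs where gs: "set gs = P" "distinct gs" using finite_distinct_list by blast
  have "\<exists>e. e \<in> edges D \<and> circ s e = \<gamma>" if "\<gamma> \<in> P" for \<gamma>
    using that assms by (auto simp: circles_eq quotient_def)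
  then obtain r where r: "\<And>\<gamma>. \<gamma> \<in> P \<Longrightarrow> r \<gamma> \<in> edges D \<and> circ s (r \<gamma>) = \<gamma>" by metis
  have m: "map (circ s) (map r gs) = gs" unfolding map_map by (rule map_idI) (use r gs(1) in simp)
  have "circ s ` set (map r gs) = set (map (circ s) (map r gs))" by (simp only: set_map)
  then have "circ s ` set (map r gs) = P" unfolding m gs(1) .
  moreover have "distinct (map (circ s) (map r gs))" unfolding m by (rule gs(2))
  moreover have "set (map r gs) \<subseteq> edges D" using r gs(1) by auto
  ultimately show ?thesis by blast
qed

lemma estate_monomial:
  assumes "S \<in> enhanced_states D"
  obtains s w where "s \<in> kauffman_states D" "set w \<subseteq> edges D" "frag_of S = monomial s w" "fst S = s"
proof -
  obtain s P where S: "s \<in> kauffman_states D" "P \<subseteq> circles D s" "S = marked_state s P"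
    using assms by (auto simp: enhanced_states_eq)
  obtain w where "set w \<subseteq> edges D" "distinct (map (circ s) w)" "circ s ` set w = P"
    using ex_edges_of_circles[OF S(2)] by blast
  then show ?thesis using that[of s w] S by (simp add: monomial_def) (simp add: marked_state_def)
qed

lemma successors_empty: "fst S c \<noteq> 1 \<Longrightarrow> successors c S = {}"
  by (auto simp: successors_def)

lemma flip_monomial_zero: "s c \<noteq> 1 \<Longrightarrow> frag_extend (flip c) (monomial s w) = 0"
  by (simp add: monomial_def flip_def successors_empty marked_state_def)

lemma flip_frag: "flip c S = frag_extend (flip c) (frag_of S)"
  by simp

lemma merges_card:
  assumes "merges c s s'" "c < ncross D"
  shows "card (circles D s) = card (circles D s') + 1"
proof -
  note C = merges_circles[OF assms]
  define g0 where "g0 = circ s (crossings D ! c ! 0)"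
  define g2 where "g2 = circ s (crossings D ! c ! 2)"
  define Z where "Z = circles D s - {g0, g2}"
  note C = C[folded g0_def g2_def, folded Z_def]
  show ?thesis
    unfolding C(1) C(2) using C(3,4,7-9) by simp
qed

text \<open>
  By the flip formulas, a path of two flips multiplies a monomial by \<open>x\<^sub>0 + x\<^sub>2\<close> for
  each splitting crossing on it. Counting circles shows that both paths have equally many
  splittings. If the splittings occur at the same crossings, the products agree. Otherwise there is
  one splitting on each path, at different crossings. In one case (merge, then split, on both paths)
  the two edge ends of either crossing lie on the same two circles of the final state. In the other
  (split, then merge) all four edge ends lie on one circle of the final state. In both cases the two
  multipliers coincide.
\<close>

lemma flip_commute:
  assumes S: "S \<in> enhanced_states D" and ab: "a < ncross D" "b < ncross D" "a \<noteq> b"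
  shows "frag_extend (flip b) (flip a S) = frag_extend (flip a) (flip b S)"
proof -
  let ?F = "\<lambda>c. frag_extend (flip c)"
  obtain s w where s: "s \<in> kauffman_states D" and w: "set w \<subseteq> edges D" and Sw: "frag_of S = monomial s w"
    and "fst S = s"
    by (rule estate_monomial[OF S])
  have "?F b (?F a (monomial s w)) = ?F a (?F b (monomial s w))"
  proof (cases "s a = 1 \<and> s b = 1")
    case False
    have zero: "?F d (?F c (monomial s w)) = 0" if "s c = 1 \<Longrightarrow> s d \<noteq> 1" "c < ncross D" "c \<noteq> d" for c d
    proof (cases "s c = 1")
      case True
      then have d: "(s(c := -1)) d \<noteq> 1" using that by simp
      from merges_cases[of c s, OF that(2) True] show ?thesis
      proof
        assume "merges c s (s(c := -1))"
        then show ?thesis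
          using flip_monomial_merge[OF s that(2) True w] flip_monomial_zero[of "s(c := -1)" d, OF d] by simp
      next
        assume "merges c (s(c := -1)) s"
        then show ?thesis
          using flip_monomial_split[OF s that(2) True w] flip_monomial_zero[of "s(c := -1)" d, OF d]
          by (simp add: frag_extend_add)
      qed
    qed (simp add: flip_monomial_zero)
    show ?thesis using False ab zero[of a b] zero[of b a] by auto
  next
    case True
    define sa where "sa = s(a := -1)"
    define sb where "sb = s(b := -1)"
    define sab where "sab = sa(b := -1)"
    have sab': "sab = sb(a := -1)" using ab by (simp add: sab_def sa_def sb_def fun_upd_twist)
    have K: "sa \<in> kauffman_states D" "sb \<in> kauffman_states D"
      using flip_kauffman[OF s] ab by (simp_all add: sa_def sb_def)
    have one: "s a = 1" "s b = 1" "sa b = 1" "sb a = 1" using True ab by (simp_all add: sa_def sb_def)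
    define a0 a2 b0 b2 where "a0 = crossings D ! a ! 0" and "a2 = crossings D ! a ! 2"
      and "b0 = crossings D ! b ! 0" and "b2 = crossings D ! b ! 2"
    have e: "a0 \<in> edges D" "a2 \<in> edges D" "b0 \<in> edges D" "b2 \<in> edges D"
      using ab by (simp_all add: a0_def a2_def b0_def b2_def crossing_in_edges)
    note Ma = flip_monomial_merge[OF s ab(1) one(1), folded sa_def]
    note Sa = flip_monomial_split[OF s ab(1) one(1), folded sa_def a0_def a2_def]
    note Mb = flip_monomial_merge[OF s ab(2) one(2), folded sb_def]
    note Sb = flip_monomial_split[OF s ab(2) one(2), folded sb_def b0_def b2_def]
    note Mb' = flip_monomial_merge[OF K(1) ab(2) one(3), folded sab_def]
    note Sb' = flip_monomial_split[OF K(1) ab(2) one(3), folded sab_def b0_def b2_def]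
    note Ma' = flip_monomial_merge[OF K(2) ab(1) one(4), folded sab']
    note Sa' = flip_monomial_split[OF K(2) ab(1) one(4), folded sab' a0_def a2_def]
    note rules = Ma Sa Mb Sb Mb' Sb' Ma' Sa' frag_extend_add
    have ca: "merges a s sa \<or> merges a sa s" using merges_cases[of a s, OF ab(1) one(1)] by (simp add: sa_def)
    have cb: "merges b s sb \<or> merges b sb s" using merges_cases[of b s, OF ab(2) one(2)] by (simp add: sb_def)
    have cb': "merges b sa sab \<or> merges b sab sa" using merges_cases[of b sa, OF ab(2) one(3)] by (simp add: sab_def)
    have ca': "merges a sb sab \<or> merges a sab sb" using merges_cases[of a sb, OF ab(1) one(4)] by (simp add: sab')
    note card = merges_card[OF _ ab(1)] merges_card[OF _ ab(2)]
    have mD: "(a0, a2) \<notin> same_circle t \<and> same_circle t' = glue (same_circle t) a0 a2" if "merges a t t'" for t t'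
      using that by (simp add: merges_def a0_def a2_def)
    have mD': "(b0, b2) \<notin> same_circle t \<and> same_circle t' = glue (same_circle t) b0 b2" if "merges b t t'" for t t'
      using that by (simp add: merges_def b0_def b2_def)
    \<comment> \<open>The cases are the types of the flips on the path through \<open>sa\<close>; counting circles then leaves
      few types for the path through \<open>sb\<close>.\<close>
    from ca cb' show ?thesis
    proof (elim disjE)
      assume m: "merges a s sa" "merges b sa sab"
      then have n: "merges b s sb" "merges a sb sab"
        using cb ca' card[of s sa] card[of sa sab] card[of s sb] card[of sb s] card[of sb sab] card[of sab sb]
        by linarith+
      show ?thesis using m n w by (simp add: rules)
    next
      assume m: "merges a s sa" "merges b sab sa"
      show ?thesis
      proof (cases "merges b s sb")
        case True
        then have n: "merges a sab sb"
          using ca' card[of s sa] card[of sab sa] card[of s sb] card[of sb sab] m by linarith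
        \<comment> \<open>Both paths merge and then split, at different crossings.\<close>
        have "(a0, a2) \<in> same_circle sa" using mD[OF m(1)] glue_pair[OF equiv_same_circle] by simp
        then have "(a0, a2) \<in> glue (same_circle sab) b0 b2" "(a0, a2) \<notin> same_circle sab"
          using mD'[OF m(2)] mD[OF n] by simp_all
        from glue_new[OF equiv_same_circle this]
        have "monomial sab (a0 # w) + monomial sab (a2 # w) = monomial sab (b0 # w) + monomial sab (b2 # w)"
        proof (elim disjE conjE)
          assume "circ sab a0 = circ sab b0" "circ sab a2 = circ sab b2"
          then show ?thesis using monomial_Cons_cong by metis
        next
          assume "circ sab a0 = circ sab b2" "circ sab a2 = circ sab b0"
          then show ?thesis using monomial_Cons_cong add.commute by metis
        qed
        then show ?thesis using m n True w by (simp add: rules)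
      next
        case False
        then have n: "merges b sb s" using cb by simp
        then have "merges a sb sab"
          using ca' card[of s sa] card[of sab sa] card[of sb s] card[of sab sb] m by linarith
        then show ?thesis using m n w e by (simp add: rules)
      qed
    next
      assume m: "merges a sa s" "merges b sa sab"
      show ?thesis
      proof (cases "merges b s sb")
        case True
        then have n: "merges a sab sb"
          using ca' card[of sa s] card[of sa sab] card[of s sb] card[of sb sab] m by linarith
        show ?thesis using m n True w e by (simp add: rules)
      next
        case False
        then have n: "merges b sb s" using cb by simp
        then have n': "merges a sb sab"
          using ca' card[of sa s] card[of sa sab] card[of sb s] card[of sab sb] m by linarith
        \<comment> \<open>Both paths split and then merge, at different crossings.\<close>
        have "(b0, b2) \<in> same_circle s" using mD'[OF n] glue_pair[OF equiv_same_circle] by simp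
        then have "(b0, b2) \<in> glue (same_circle sa) a0 a2" "(b0, b2) \<notin> same_circle sa"
          using mD[OF m(1)] mD'[OF m(2)] by simp_all
        from glue_new[OF equiv_same_circle this]
        have "(a0, b0) \<in> same_circle sa \<and> (a2, b2) \<in> same_circle sa \<or>
            (a0, b2) \<in> same_circle sa \<and> (a2, b0) \<in> same_circle sa"
          unfolding circ_eq_iff[symmetric] by metis
        moreover have "same_circle sa \<subseteq> same_circle sab" "(b0, b2) \<in> same_circle sab"
          using mD'[OF m(2)] glue_pair[OF equiv_same_circle] glue_mono by simp_all
        ultimately have "circ sab a0 = circ sab b0 \<and> circ sab a2 = circ sab b0 \<and> circ sab b2 = circ sab b0"
          unfolding circ_eq_iff using conn_sym conn_trans unfolding same_circle_def by (meson subsetD)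
        then have "monomial sab (a0 # w) + monomial sab (a2 # w) = monomial sab (b0 # w) + monomial sab (b2 # w)"
          using monomial_Cons_cong by metis
        then show ?thesis using m n n' w e by (simp add: rules)
      qed
    next
      assume m: "merges a sa s" "merges b sab sa"
      then have n: "merges b sb s" "merges a sab sb"
        using cb ca' card[of sa s] card[of sab sa] card[of s sb] card[of sb s] card[of sb sab] card[of sab sb]
        by linarith+
      show ?thesis using m n w e
        by (simp add: rules monomial_swap[of sab a0] monomial_swap[of sab a2] add_ac)
    qed
  qed
  then show ?thesis using Sw by (simp add: flip_frag[of _ S] del: frag_extend_of)
qed

section \<open>The Khovanov differential\<close>

definition state_sign :: "nat \<Rightarrow> (nat \<Rightarrow> int) \<Rightarrow> int" where
  "state_sign c s = (-1) ^ card {k. k < ncross D \<and> c < k \<and> s k = -1}"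

lemma finite_gens: "finite (gens D i j)"
proof -
  have "finite (enhanced_states D)"
    unfolding enhanced_states_def kauffman_states_def
    by (intro finite_SigmaI finite_PiE finite_circles) auto
  then show ?thesis by (simp add: gens_def)
qed

lemma gens_enhanced: "S \<in> gens D i j \<Longrightarrow> S \<in> enhanced_states D"
  by (simp add: gens_def)

lemma enhanced_kauffman: "S \<in> enhanced_states D \<Longrightarrow> fst S \<in> kauffman_states D"
  by (auto simp: enhanced_states_def)

lemma sigma_deg_flip:
  assumes "c < ncross D" "fst S c = 1" "fst S' = (fst S)(c := -1)"
  shows "sigma_deg D S' = sigma_deg D S - 2"
proof -
  have split: "(\<Sum>k<ncross D. f k) = f c + (\<Sum>k\<in>{..<ncross D} - {c}. f k)" for f :: "nat \<Rightarrow> int"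
    using assms(1) by (simp add: sum.remove)
  have "(\<Sum>k\<in>{..<ncross D} - {c}. fst S' k) = (\<Sum>k\<in>{..<ncross D} - {c}. fst S k)"
    using assms(3) by (intro sum.cong) auto
  then show ?thesis unfolding sigma_deg_def split[of "fst S"] split[of "fst S'"] using assms by simp
qed

lemma successors_gens:
  assumes "S \<in> gens D i j" "c < ncross D" "S' \<in> successors c S"
  shows "S' \<in> gens D (i - 2) j"
  using assms sigma_deg_flip[of c S S'] by (auto simp: gens_def successors_def)

lemma successors_differ:
  assumes "c < ncross D" "S' \<in> successors c S"
  shows "differ_at D S S' c"
  using assms by (auto simp: differ_at_def successors_def)

lemma differ_at_unique: "differ_at D S S' c \<Longrightarrow> differ_at D S S' c' \<Longrightarrow> c = c'"
  by (simp add: differ_at_def)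

lemma differ_at_flip:
  assumes S: "S \<in> gens D i j" "S' \<in> gens D (i - 2) j" and d: "differ_at D S S' c"
  shows "c < ncross D" "fst S c = 1" "fst S' = (fst S)(c := -1)"
proof -
  have c: "c < ncross D" and other: "k < ncross D \<Longrightarrow> k \<noteq> c \<Longrightarrow> fst S k = fst S' k" for k
    using d by (auto simp: differ_at_def)
  show "c < ncross D" by (rule c)
  have split: "(\<Sum>k<ncross D. f k) = f c + (\<Sum>k\<in>{..<ncross D} - {c}. f k)" for f :: "nat \<Rightarrow> int"
    using c by (simp add: sum.remove)
  have "(\<Sum>k\<in>{..<ncross D} - {c}. fst S' k) = (\<Sum>k\<in>{..<ncross D} - {c}. fst S k)"
    using other by (intro sum.cong) auto
  moreover have "sigma_deg D S' = sigma_deg D S - 2" using S by (simp add: gens_def)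
  ultimately have diff: "fst S' c = fst S c - 2"
    unfolding sigma_deg_def split[of "fst S"] split[of "fst S'"] by simp
  have K: "fst S \<in> kauffman_states D" "fst S' \<in> kauffman_states D"
    using S gens_enhanced enhanced_kauffman by blast+
  have "fst S c \<in> {1, -1}" "fst S' c \<in> {1, -1}"
    using K c by (auto simp: kauffman_states_def PiE_def Pi_def)
  with diff show 1: "fst S c = 1" by auto
  show "fst S' = (fst S)(c := -1)"
  proof
    fix k
    show "fst S' k = ((fst S)(c := -1)) k"
      using diff 1 other[of k] K
      by (cases "k < ncross D") (auto simp: kauffman_states_def PiE_def extensional_def)
  qed
qed

lemma successors_iff:
  assumes S: "S \<in> gens D i j" "S' \<in> gens D (i - 2) j" and c: "c < ncross D"
  shows "S' \<in> successors c S \<longleftrightarrow> differ_at D S S' c \<and>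
     (\<forall>\<gamma> \<in> circles D (fst S) \<union> circles D (fst S').
        \<gamma> \<inter> set (crossings D ! c) = {} \<longrightarrow> snd S \<gamma> = snd S' \<gamma>)"
proof
  assume "S' \<in> successors c S"
  then show "differ_at D S S' c \<and> (\<forall>\<gamma> \<in> circles D (fst S) \<union> circles D (fst S').
        \<gamma> \<inter> set (crossings D ! c) = {} \<longrightarrow> snd S \<gamma> = snd S' \<gamma>)"
    using successors_differ[OF c] unfolding successors_def by blast
next
  assume *: "differ_at D S S' c \<and> (\<forall>\<gamma> \<in> circles D (fst S) \<union> circles D (fst S').
        \<gamma> \<inter> set (crossings D ! c) = {} \<longrightarrow> snd S \<gamma> = snd S' \<gamma>)"
  note f = differ_at_flip[OF S conjunct1[OF *]]
  have "tau_deg D S' = tau_deg D S + 1"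
    using S by (simp add: gens_def)
  then show "S' \<in> successors c S"
    using * f(2,3) gens_enhanced[OF S(2)] unfolding successors_def by blast
qed

text \<open>
  A pair of generators is incident through at most one crossing, so the sum on the right has at most
  one nonzero term.
\<close>

lemma khov_d_term:
  assumes S: "S \<in> gens D i j" "S' \<in> gens D (i - 2) j"
  shows "frag_cmul ((-1) ^ t_exponent D S S' * incidence D S S') (frag_of S') =
    (\<Sum>c<ncross D. if S' \<in> successors c S then frag_cmul (state_sign c (fst S)) (frag_of S') else 0)"
proof (cases "\<exists>c<ncross D. S' \<in> successors c S")
  case True
  then obtain c where c: "c < ncross D" "S' \<in> successors c S" by blast
  then have d: "differ_at D S S' c" by (rule successors_differ)
  then have "(THE c. differ_at D S S' c) = c" using differ_at_unique by (intro the_equality)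
  then have "(-1) ^ t_exponent D S S' = state_sign c (fst S)"
    by (simp add: t_exponent_def state_sign_def)
  moreover have "incidence D S S' = 1"
    using c(2) d unfolding successors_iff[OF S c(1)] incidence_def by auto
  moreover have "S' \<in> successors k S \<longleftrightarrow> k = c" if "k < ncross D" for k
    using successors_differ[OF that, of S' S] differ_at_unique[OF d] c(2) by blast
  then have "(\<Sum>k<ncross D. if S' \<in> successors k S then frag_cmul (state_sign k (fst S)) (frag_of S') else 0) =
      (\<Sum>k<ncross D. if k = c then frag_cmul (state_sign c (fst S)) (frag_of S') else 0)"
    by (intro sum.cong) auto
  ultimately show ?thesis using c(1) by simp
next
  case False
  have "incidence D S S' = 0"
  proof -
    have "\<not> (\<exists>c. differ_at D S S' c \<and> (\<forall>\<gamma> \<in> circles D (fst S) \<union> circles D (fst S').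
        \<gamma> \<inter> set (crossings D ! c) = {} \<longrightarrow> snd S \<gamma> = snd S' \<gamma>))"
      using False differ_at_flip(1)[OF S] successors_iff[OF S] by metis
    then show ?thesis unfolding incidence_def by (rule if_not_P)
  qed
  then show ?thesis using False by simp
qed

lemma khov_d_frag_of:
  assumes S: "S \<in> gens D i j"
  shows "khov_d D i j (frag_of S) = (\<Sum>c<ncross D. frag_cmul (state_sign c (fst S)) (flip c S))"
proof -
  have "khov_d D i j (frag_of S) = (\<Sum>S'\<in>gens D (i - 2) j. \<Sum>c<ncross D.
      if S' \<in> successors c S then frag_cmul (state_sign c (fst S)) (frag_of S') else 0)"
    unfolding khov_d_def frag_extend_of by (rule sum.cong[OF refl]) (rule khov_d_term[OF S])
  also have "\<dots> = (\<Sum>c<ncross D. \<Sum>S'\<in>gens D (i - 2) j.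
      if S' \<in> successors c S then frag_cmul (state_sign c (fst S)) (frag_of S') else 0)"
    by (rule sum.swap)
  also have "\<dots> = (\<Sum>c<ncross D. frag_cmul (state_sign c (fst S)) (flip c S))"
  proof (rule sum.cong[OF refl])
    fix c assume "c \<in> {..<ncross D}"
    then have "gens D (i - 2) j \<inter> successors c S = successors c S"
      using successors_gens[OF S] by auto
    then have "(\<Sum>S'\<in>gens D (i - 2) j. if S' \<in> successors c S
        then frag_cmul (state_sign c (fst S)) (frag_of S') else 0) =
        (\<Sum>S'\<in>successors c S. frag_cmul (state_sign c (fst S)) (frag_of S'))"
      using sum.inter_restrict[OF finite_gens, of "\<lambda>S'. frag_cmul (state_sign c (fst S)) (frag_of S')"
          i "j" "successors c S"]
      by (simp add: sum.inter_restrict[OF finite_gens, symmetric])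
    also have "\<dots> = frag_cmul (state_sign c (fst S)) (flip c S)"
      unfolding flip_def by (rule frag_cmul_sum[symmetric])
    finally show "(\<Sum>S'\<in>gens D (i - 2) j. if S' \<in> successors c S
        then frag_cmul (state_sign c (fst S)) (frag_of S') else 0) =
        frag_cmul (state_sign c (fst S)) (flip c S)" .
  qed
  finally show ?thesis .
qed

lemma finite_successors: "S \<in> gens D i j \<Longrightarrow> c < ncross D \<Longrightarrow> finite (successors c S)"
  using successors_gens finite_gens by (metis finite_subset subsetI)

lemma keys_flip:
  assumes "S \<in> gens D i j" "c < ncross D"
  shows "Poly_Mapping.keys (flip c S) \<subseteq> successors c S"
proof -
  have "Poly_Mapping.keys (flip c S) \<subseteq> (\<Union>S'\<in>successors c S. Poly_Mapping.keys (frag_of S' :: 'e estate \<Rightarrow>\<^sub>0 int))"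
    unfolding flip_def by (rule keys_sum)
  then show ?thesis by (simp add: keys_frag_of)
qed

lemma state_sign_flip:
  assumes "c < d" "d < ncross D" "s d = 1"
  shows "state_sign d (s(c := -1)) = state_sign d s" "state_sign c (s(d := -1)) = - state_sign c s"
proof -
  have "{k. k < ncross D \<and> d < k \<and> (s(c := -1)) k = -1} = {k. k < ncross D \<and> d < k \<and> s k = -1}"
    using assms(1) by auto
  then show "state_sign d (s(c := -1)) = state_sign d s" by (simp add: state_sign_def)
  have "{k. k < ncross D \<and> c < k \<and> (s(d := -1)) k = -1} = insert d {k. k < ncross D \<and> c < k \<and> s k = -1}"
    using assms by auto
  moreover have "d \<notin> {k. k < ncross D \<and> c < k \<and> s k = -1}" using assms(3) by simp
  ultimately have "card {k. k < ncross D \<and> c < k \<and> (s(d := -1)) k = -1} = Suc (card {k. k < ncross D \<and> c < k \<and> s k = -1})"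
    by simp
  then show "state_sign c (s(d := -1)) = - state_sign c s" by (simp add: state_sign_def)
qed

text \<open>
  The flips commute, but a path through the smaller crossing first sees one negative marker
  fewer than the path through the larger crossing first. Hence the signed terms \<open>T c d\<close> are
  antisymmetric and cancel in pairs.
\<close>

lemma khov_d_khov_d_frag_of:
  assumes S: "S \<in> gens D i j"
  shows "khov_d D (i - 2) j (khov_d D i j (frag_of S)) = 0"
proof -
  let ?n = "{..<ncross D}" and ?s = "fst S"
  define T where "T = (\<lambda>c d. frag_cmul (state_sign c ?s * state_sign d (?s(c := -1)))
    (frag_extend (flip d) (flip c S)))"
  have zero: "T c d = 0" if "?s c \<noteq> 1" for c d
    using that by (simp add: T_def flip_def successors_empty)
  have zero': "T c d = 0" if "?s c = 1" "(?s(c := -1)) d \<noteq> 1" "c < ncross D" for c d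
  proof -
    have "frag_extend (flip d) (flip c S) = 0"
    proof (rule frag_extend_eq_0)
      fix S' assume "S' \<in> Poly_Mapping.keys (flip c S)"
      then have "S' \<in> successors c S" using keys_flip[OF S that(3)] by blast
      then have "fst S' d \<noteq> 1" using that(2) by (simp add: successors_def)
      then show "flip d S' = 0" by (simp add: flip_def successors_empty)
    qed
    then show ?thesis by (simp add: T_def)
  qed
  have anti_less: "T c d = - T d c" if "c < d" "c \<in> ?n" "d \<in> ?n" for c d
  proof (cases "?s c = 1 \<and> ?s d = 1")
    case True
    have comm: "frag_extend (flip d) (flip c S) = frag_extend (flip c) (flip d S)"
      using that by (intro flip_commute gens_enhanced[OF S]) auto
    show ?thesis
      using state_sign_flip[of c d ?s] True that unfolding T_def comm by (simp add: mult.commute)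
  next
    case False
    have off: "T x y = 0" if "\<not> (?s x = 1 \<and> ?s y = 1)" "x < ncross D" "x \<noteq> y" for x y
      using that zero[of x y] zero'[of x y] by (cases "?s x = 1") simp_all
    have "T c d = 0" "T d c = 0" using False that off[of c d] off[of d c] by auto
    then show ?thesis by simp
  qed
  have diag: "T c c = 0" if "c \<in> ?n" for c
    using zero[of c c] zero'[of c c] that by (cases "?s c = 1") auto
  have anti: "T c d = - T d c" if "c \<in> ?n" "d \<in> ?n" for c d
    using anti_less[of c d] anti_less[of d c] diag[of c] that by (cases c d rule: linorder_cases) auto
  have "khov_d D (i - 2) j (flip c S) =
      (\<Sum>d<ncross D. frag_cmul (state_sign d (?s(c := -1))) (frag_extend (flip d) (flip c S)))"
    if c: "c < ncross D" for c
  proof -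
    have "khov_d D (i - 2) j (flip c S) = (\<Sum>S'\<in>successors c S. khov_d D (i - 2) j (frag_of S'))"
      unfolding flip_def khov_d_def by (simp add: frag_extend_sum[OF finite_successors[OF S c]])
    also have "\<dots> = (\<Sum>S'\<in>successors c S. \<Sum>d<ncross D. frag_cmul (state_sign d (?s(c := -1))) (flip d S'))"
      using khov_d_frag_of[OF successors_gens[OF S c]] by (intro sum.cong) (auto simp: successors_def)
    also have "\<dots> = (\<Sum>d<ncross D. frag_cmul (state_sign d (?s(c := -1))) (\<Sum>S'\<in>successors c S. flip d S'))"
      by (subst sum.swap) (simp add: frag_cmul_sum)
    also have "\<dots> = (\<Sum>d<ncross D. frag_cmul (state_sign d (?s(c := -1))) (frag_extend (flip d) (flip c S)))"
      unfolding flip_def[of c] by (simp add: frag_extend_sum[OF finite_successors[OF S c]] comp_def)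
    finally show ?thesis .
  qed
  then have "khov_d D (i - 2) j (frag_cmul (state_sign c ?s) (flip c S)) = (\<Sum>d<ncross D. T c d)"
    if "c < ncross D" for c
    using that unfolding khov_d_def frag_extend_cmul by (simp add: T_def frag_cmul_sum)
  then have "khov_d D (i - 2) j (khov_d D i j (frag_of S)) = (\<Sum>c<ncross D. \<Sum>d<ncross D. T c d)"
    unfolding khov_d_frag_of[OF S] by (simp add: khov_d_def[of D "i - 2"] frag_extend_sum)
  also have "\<dots> = 0" by (rule sum_antisymmetric) (rule anti)
  finally show ?thesis .
qed

lemma keys_khov_d: "Poly_Mapping.keys (khov_d D i j x) \<subseteq> gens D (i - 2) j"
proof -
  have "Poly_Mapping.keys (\<Sum>S'\<in>gens D (i - 2) j. frag_cmul (m S') (frag_of S')) \<subseteq> gens D (i - 2) j"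
    for m :: "'e estate \<Rightarrow> int"
    using keys_sum[of "\<lambda>S'. frag_cmul (m S') (frag_of S')" "gens D (i - 2) j"]
    by (rule order_trans) (auto simp: keys_frag_of)
  then show ?thesis
    unfolding khov_d_def by (intro order_trans[OF keys_frag_extend] UN_least)
qed

lemma khov_d_add: "khov_d D i j (x + y) = khov_d D i j x + khov_d D i j y"
  by (simp add: khov_d_def frag_extend_add)

lemma khov_d_diff: "khov_d D i j (x - y) = khov_d D i j x - khov_d D i j y"
  by (simp add: khov_d_def frag_extend_diff)

lemma khov_d_khov_d:
  assumes "Poly_Mapping.keys x \<subseteq> gens D i j"
  shows "khov_d D (i - 2) j (khov_d D i j x) = 0"
  using assms
proof (induction x rule: frag_induction)
  case zero
  show ?case by (simp add: khov_d_def)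
next
  case (one S)
  then show ?case by (rule khov_d_khov_d_frag_of)
next
  case (diff x y)
  then show ?case by (simp add: khov_d_diff)
qed

section \<open>States that are positive at the base point\<close>

lemma base_circle_eq:
  assumes "b \<in> edges D"
  shows "base_circle D b s = circ s b"
  unfolding base_circle_def
proof (rule the_equality)
  have "(b, b) \<in> same_circle s" by (simp add: same_circle_def)
  then show "circ s b \<in> circles D s \<and> b \<in> circ s b" using circ_in_circles[OF assms] by simp
  fix \<gamma> assume g: "\<gamma> \<in> circles D s \<and> b \<in> \<gamma>"
  then obtain e where e: "\<gamma> = circ s e" by (auto simp: circles_eq elim: quotientE)
  then have "(e, b) \<in> same_circle s" using g by simp
  then show "\<gamma> = circ s b" unfolding e circ_eq_iff[symmetric] .
qed

lemma keys_monomial_S_plus: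
  assumes "b \<in> set w" "set w \<subseteq> edges D" "s \<in> kauffman_states D"
  shows "Poly_Mapping.keys (monomial s w) \<subseteq> S_plus D b"
proof -
  have b: "b \<in> edges D" using assms by auto
  have "marked_state s (circ s ` set w) \<in> S_plus D b"
  proof -
    have "circ s ` set w \<subseteq> circles D s" using assms(2) by (auto intro: circ_in_circles)
    then have "marked_state s (circ s ` set w) \<in> enhanced_states D"
      unfolding enhanced_states_eq using assms(3) by blast
    moreover have "circ s b \<in> circ s ` set w" using assms(1) by blast
    ultimately show ?thesis
      using circ_in_circles[OF b, of s] base_circle_eq[OF b, of s]
      by (simp add: S_plus_def marked_state_def)
  qed
  then show ?thesis by (simp add: monomial_def keys_frag_of)
qed

text \<open>
  A state is positive at the base point exactly if it is a monomial with the factor \<open>b\<close>, and both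
  flip formulas keep all factors.
\<close>

lemma keys_flip_S_plus:
  assumes b: "b \<in> edges D" and S: "S \<in> S_plus D b" and c: "c < ncross D"
  shows "Poly_Mapping.keys (flip c S) \<subseteq> S_plus D b"
proof -
  have "S \<in> enhanced_states D" using S by (simp add: S_plus_def)
  then obtain s P where s: "s \<in> kauffman_states D" "P \<subseteq> circles D s" "S = marked_state s P"
    by (auto simp: enhanced_states_eq)
  have bP: "circ s b \<in> P"
  proof -
    have "snd S (base_circle D b (fst S)) = 1" using S by (simp add: S_plus_def)
    then show ?thesis
      using circ_in_circles[OF b, of s] unfolding s(3) marked_state_def fst_conv snd_conv base_circle_eq[OF b]
      by (simp split: if_splits)
  qed
  have "P - {circ s b} \<subseteq> circles D s" using s(2) by auto
  from ex_edges_of_circles[OF this] obtain w0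
    where w0: "set w0 \<subseteq> edges D" "distinct (map (circ s) w0)" "circ s ` set w0 = P - {circ s b}"
    by (elim exE conjE)
  define w where "w = b # w0"
  have w: "set w \<subseteq> edges D" "b \<in> set w" using w0(1) b by (auto simp: w_def)
  have "circ s ` set w = P" using w0(3) bP by (auto simp: w_def)
  moreover have "distinct (map (circ s) w)"
  proof -
    have "set (map (circ s) w0) = P - {circ s b}" using w0(3) by (simp only: set_map)
    then show ?thesis using w0(2) unfolding w_def by (simp only: list.map distinct.simps) blast
  qed
  ultimately have Sw: "frag_of S = monomial s w" unfolding s(3) by (simp add: monomial_def)
  have fl: "flip c S = frag_extend (flip c) (monomial s w)" unfolding Sw[symmetric] by simp
  note K = flip_kauffman[OF s(1) c]
  show ?thesis
  proof (cases "s c = 1")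
    case True
    from merges_cases[of c s, OF c True] show ?thesis
    proof
      assume "merges c s (s(c := -1))"
      then show ?thesis
        unfolding fl using flip_monomial_merge[OF s(1) c True w(1)] keys_monomial_S_plus[OF w(2,1) K] by simp
    next
      assume m: "merges c (s(c := -1)) s"
      have "Poly_Mapping.keys (monomial (s(c := -1)) (crossings D ! c ! i # w)) \<subseteq> S_plus D b" if "i < 4" for i
        using w crossing_in_edges[OF c that] by (intro keys_monomial_S_plus K) auto
      then show ?thesis
        unfolding fl flip_monomial_split[OF s(1) c True w(1) m]
        by (intro order_trans[OF keys_add] Un_least) simp_all
    qed
  next
    case False
    then show ?thesis unfolding fl by (simp add: flip_monomial_zero)
  qed
qed

lemma keys_khov_d_S_plus:
  assumes b: "b \<in> edges D" and x: "Poly_Mapping.keys x \<subseteq> gens D i j \<inter> S_plus D b"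
  shows "Poly_Mapping.keys (khov_d D i j x) \<subseteq> gens D (i - 2) j \<inter> S_plus D b"
proof -
  have "Poly_Mapping.keys (khov_d D i j x) \<subseteq> S_plus D b"
    using x
  proof (induction x rule: frag_induction)
    case zero
    show ?case by (simp add: khov_d_def)
  next
    case (diff x y)
    then show ?case unfolding khov_d_diff by (meson Un_least keys_diff order_trans)
  next
    case (one S)
    then have S: "S \<in> gens D i j" "S \<in> S_plus D b" by auto
    have "Poly_Mapping.keys (frag_cmul (state_sign c (fst S)) (flip c S)) \<subseteq> S_plus D b" if "c < ncross D" for c
      using keys_flip_S_plus[OF b S(2) that] by (rule order_trans[OF keys_cmul])
    then show ?case
      unfolding khov_d_frag_of[OF S(1)]
      by (intro order_trans[OF keys_sum] UN_least) auto
  qed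
  with keys_khov_d show ?thesis by blast
qed

end

section \<open>The long exact sequence of a short exact sequence of complexes\<close>

text \<open>
  The degrees are shifted so that the differentials ending in degree \<open>i\<close> start in \<open>i + 2\<close>, as in the
  definition of the boundaries.
\<close>

lemma chain_complexD:
  assumes "chain_complex C"
  shows "comm_group (grp C i j)" "group (grp C i j)"
    "bdry C i j \<in> hom (grp C i j) (grp C (i - 2) j)"
    "bdry C (i + 2) j \<in> hom (grp C (i + 2) j) (grp C i j)"
    "x \<in> carrier (grp C i j) \<Longrightarrow> bdry C i j x \<in> carrier (grp C (i - 2) j)"
    "x \<in> carrier (grp C (i + 2) j) \<Longrightarrow> bdry C (i + 2) j x \<in> carrier (grp C i j)"
    "x \<in> carrier (grp C (i + 2) j) \<Longrightarrow> bdry C i j (bdry C (i + 2) j x) = \<one>\<^bsub>grp C (i - 2) j\<^esub>"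
proof -
  show "comm_group (grp C i j)" "bdry C i j \<in> hom (grp C i j) (grp C (i - 2) j)"
    using assms by (simp_all add: chain_complex_def)
  then show "group (grp C i j)" by (simp add: comm_group_def)
  have "bdry C (i + 2) j \<in> hom (grp C (i + 2) j) (grp C (i + 2 - 2) j)"
    using assms unfolding chain_complex_def by blast
  then show 4: "bdry C (i + 2) j \<in> hom (grp C (i + 2) j) (grp C i j)" by simp
  show "x \<in> carrier (grp C i j) \<Longrightarrow> bdry C i j x \<in> carrier (grp C (i - 2) j)"
    using assms unfolding chain_complex_def by (meson hom_in_carrier)
  show "x \<in> carrier (grp C (i + 2) j) \<Longrightarrow> bdry C (i + 2) j x \<in> carrier (grp C i j)"
    using 4 by (rule hom_in_carrier)
  have "\<forall>x \<in> carrier (grp C (i + 2) j). bdry C (i + 2 - 2) j (bdry C (i + 2) j x) = \<one>\<^bsub>grp C (i + 2 - 4) j\<^esub>"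
    using assms unfolding chain_complex_def by blast
  then show "x \<in> carrier (grp C (i + 2) j) \<Longrightarrow> bdry C i j (bdry C (i + 2) j x) = \<one>\<^bsub>grp C (i - 2) j\<^esub>"
    by simp
qed

lemma cycles_iff:
  "z \<in> cycles C i j \<longleftrightarrow> z \<in> carrier (grp C i j) \<and> bdry C i j z = \<one>\<^bsub>grp C (i - 2) j\<^esub>"
  by (simp add: cycles_def kernel_def)

context
  fixes C :: "'g bicomplex" and i j :: int
  assumes C: "chain_complex C"
begin

lemma boundary_hom: "group_hom (grp C i j) (grp C (i - 2) j) (bdry C i j)"
  using chain_complexD(2,3)[OF C] by (simp add: group_hom_def group_hom_axioms_def)

lemma boundary_hom': "group_hom (grp C (i + 2) j) (grp C i j) (bdry C (i + 2) j)"
  using chain_complexD(2,4)[OF C] by (simp add: group_hom_def group_hom_axioms_def)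

lemma subgroup_cycles: "subgroup (cycles C i j) (grp C i j)"
  unfolding cycles_def by (rule group_hom.subgroup_kernel[OF boundary_hom])

lemma boundaries_subset_cycles: "boundaries C i j \<subseteq> cycles C i j"
  using chain_complexD(6,7)[OF C] by (auto simp: boundaries_def cycles_iff)

lemma subgroup_boundaries: "subgroup (boundaries C i j) (grp C i j)"
  unfolding boundaries_def by (rule group_hom.img_is_subgroup[OF boundary_hom'])

abbreviation (input) "cycle_group \<equiv> (grp C i j)\<lparr>carrier := cycles C i j\<rparr>"

lemma normal_boundaries: "boundaries C i j \<lhd> cycle_group"
proof -
  interpret comm_group "grp C i j" by (rule chain_complexD(1)[OF C])
  interpret Z: group cycle_group by (rule subgroup.subgroup_is_group[OF subgroup_cycles is_group])
  interpret Z: comm_group cycle_group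
    by (rule Z.group_comm_groupI) (simp add: m_comm subgroup.mem_carrier[OF subgroup_cycles])
  show ?thesis
    by (rule Z.subgroup_imp_normal)
      (use subgroup_incl[OF subgroup_boundaries subgroup_cycles boundaries_subset_cycles] in simp)
qed

lemma group_homology: "group (homology C i j)"
  unfolding homology_def by (rule normal.factorgroup_is_group[OF normal_boundaries])

lemma hclass_eq: "hclass C i j z = boundaries C i j #>\<^bsub>cycle_group\<^esub> z"
  by (simp add: hclass_def r_coset_def)

lemma carrier_homology: "carrier (homology C i j) = hclass C i j ` cycles C i j"
  by (auto simp: homology_def FactGroup_def RCOSETS_def hclass_eq)

lemma mult_homology:
  assumes "x \<in> cycles C i j" "y \<in> cycles C i j"
  shows "hclass C i j x \<otimes>\<^bsub>homology C i j\<^esub> hclass C i j y = hclass C i j (x \<otimes>\<^bsub>grp C i j\<^esub> y)"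
  using normal.rcos_sum[OF normal_boundaries, of x y] assms
  by (simp add: homology_def FactGroup_def hclass_eq)

lemma one_homology: "\<one>\<^bsub>homology C i j\<^esub> = boundaries C i j"
  by (simp add: homology_def FactGroup_def)

lemma hclass_eq_iff:
  assumes "x \<in> carrier (grp C i j)" "y \<in> carrier (grp C i j)"
  shows "hclass C i j x = hclass C i j y \<longleftrightarrow>
    (\<exists>w \<in> carrier (grp C (i + 2) j). x = bdry C (i + 2) j w \<otimes>\<^bsub>grp C i j\<^esub> y)"
proof -
  interpret group "grp C i j" by (rule chain_complexD(2)[OF C])
  have "hclass C i j x = hclass C i j y \<longleftrightarrow> x \<in> hclass C i j y"
    unfolding hclass_def
    using assms subgroup_boundaries by (metis rcos_self repr_independence)
  also have "\<dots> \<longleftrightarrow> (\<exists>w \<in> carrier (grp C (i + 2) j). x = bdry C (i + 2) j w \<otimes>\<^bsub>grp C i j\<^esub> y)"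
    by (auto simp: hclass_def boundaries_def r_coset_def)
  finally show ?thesis .
qed

lemma mem_hclass_iff:
  "x \<in> hclass C i j y \<longleftrightarrow> (\<exists>w \<in> carrier (grp C (i + 2) j). x = bdry C (i + 2) j w \<otimes>\<^bsub>grp C i j\<^esub> y)"
  by (auto simp: hclass_def boundaries_def r_coset_def)

lemma hclass_self: "z \<in> carrier (grp C i j) \<Longrightarrow> z \<in> hclass C i j z"
  unfolding hclass_def using group.rcos_self[OF chain_complexD(2)[OF C] _ subgroup_boundaries] .

lemma hclass_one_iff:
  assumes "z \<in> carrier (grp C i j)"
  shows "hclass C i j z = \<one>\<^bsub>homology C i j\<^esub> \<longleftrightarrow> z \<in> boundaries C i j"
proof -
  interpret group "grp C i j" by (rule chain_complexD(2)[OF C])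
  show ?thesis
    unfolding one_homology hclass_def
    using assms subgroup_boundaries coset_join1 coset_join2 by metis
qed

end

context
  fixes A :: "'a bicomplex" and B :: "'b bicomplex" and f :: "int \<Rightarrow> int \<Rightarrow> 'a \<Rightarrow> 'b"
  assumes A: "chain_complex A" and B: "chain_complex B" and f: "chain_map A B f"
begin

lemma chain_map_hom: "f i j \<in> hom (grp A i j) (grp B i j)"
  using f by (simp add: chain_map_def)

lemma chain_map_closed: "x \<in> carrier (grp A i j) \<Longrightarrow> f i j x \<in> carrier (grp B i j)"
  by (rule hom_in_carrier[OF chain_map_hom])

lemma chain_map_mult:
  "x \<in> carrier (grp A i j) \<Longrightarrow> y \<in> carrier (grp A i j) \<Longrightarrow>
   f i j (x \<otimes>\<^bsub>grp A i j\<^esub> y) = f i j x \<otimes>\<^bsub>grp B i j\<^esub> f i j y"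
  by (rule hom_mult[OF chain_map_hom])

lemma chain_map_one: "f i j \<one>\<^bsub>grp A i j\<^esub> = \<one>\<^bsub>grp B i j\<^esub>"
  using hom_one[OF chain_map_hom chain_complexD(2)[OF A] chain_complexD(2)[OF B]] .

lemma chain_map_bdry: "x \<in> carrier (grp A i j) \<Longrightarrow> bdry B i j (f i j x) = f (i - 2) j (bdry A i j x)"
  using f by (simp add: chain_map_def)

lemma chain_map_bdry': "x \<in> carrier (grp A (i + 2) j) \<Longrightarrow> f i j (bdry A (i + 2) j x) = bdry B (i + 2) j (f (i + 2) j x)"
  using chain_map_bdry[of x "i + 2" j] by simp

lemma chain_map_cycles: "z \<in> cycles A i j \<Longrightarrow> f i j z \<in> cycles B i j"
  by (simp add: cycles_iff chain_map_closed chain_map_bdry chain_map_one)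

lemma homology_map_hclass:
  assumes z: "z \<in> cycles A i j"
  shows "homology_map B f i j (hclass A i j z) = hclass B i j (f i j z)"
proof -
  have zc: "z \<in> carrier (grp A i j)" using z by (simp add: cycles_iff)
  have const: "hclass B i j (f i j x) = hclass B i j (f i j z)" if x: "x \<in> hclass A i j z" for x
  proof -
    obtain w where w: "w \<in> carrier (grp A (i + 2) j)" "x = bdry A (i + 2) j w \<otimes>\<^bsub>grp A i j\<^esub> z"
      using x unfolding mem_hclass_iff[OF A] by blast
    have bw: "bdry A (i + 2) j w \<in> carrier (grp A i j)" using w(1) by (rule chain_complexD(6)[OF A])
    then have "f i j x = bdry B (i + 2) j (f (i + 2) j w) \<otimes>\<^bsub>grp B i j\<^esub> f i j z"
      using w zc by (simp add: chain_map_mult chain_map_bdry')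
    moreover have fx: "f i j x \<in> carrier (grp B i j)"
      using w(2) bw zc chain_complexD(2)[OF A] by (intro chain_map_closed) (simp add: group.is_monoid monoid.m_closed)
    ultimately show ?thesis
      unfolding hclass_eq_iff[OF B fx chain_map_closed[OF zc]]
      by (intro bexI[of _ "f (i + 2) j w"]) (use chain_map_closed[OF w(1)] in simp_all)
  qed
  show ?thesis
    unfolding homology_map_def
    by (rule the_elem_image_unique) (use hclass_self[OF A zc] in blast, rule const)
qed

lemma homology_map_hom: "homology_map B f i j \<in> hom (homology A i j) (homology B i j)"
proof (rule homI)
  fix X Y assume "X \<in> carrier (homology A i j)" "Y \<in> carrier (homology A i j)"
  then obtain x y where x: "x \<in> cycles A i j" "X = hclass A i j x" and y: "y \<in> cycles A i j" "Y = hclass A i j y"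
    unfolding carrier_homology[OF A] by blast
  show "homology_map B f i j X \<in> carrier (homology B i j)"
    unfolding x(2) homology_map_hclass[OF x(1)] carrier_homology[OF B] using chain_map_cycles[OF x(1)] by blast
  have xy: "x \<otimes>\<^bsub>grp A i j\<^esub> y \<in> cycles A i j"
    using subgroup.m_closed[OF subgroup_cycles[OF A] x(1) y(1)] .
  show "homology_map B f i j (X \<otimes>\<^bsub>homology A i j\<^esub> Y) =
      homology_map B f i j X \<otimes>\<^bsub>homology B i j\<^esub> homology_map B f i j Y"
    unfolding x(2) y(2) mult_homology[OF A x(1) y(1)] homology_map_hclass[OF xy]
      homology_map_hclass[OF x(1)] homology_map_hclass[OF y(1)]
      mult_homology[OF B chain_map_cycles[OF x(1)] chain_map_cycles[OF y(1)]]
    using x(1) y(1) by (simp add: chain_map_mult cycles_iff)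
qed

end

locale short_exact =
  fixes A :: "'a bicomplex" and f :: "int \<Rightarrow> int \<Rightarrow> 'a \<Rightarrow> 'b" and B :: "'b bicomplex"
    and g :: "int \<Rightarrow> int \<Rightarrow> 'b \<Rightarrow> 'q" and Q :: "'q bicomplex"
  assumes exact: "short_exact_complexes A f B g Q"
begin

lemma complexes: "chain_complex A" "chain_complex B" "chain_complex Q"
  and maps: "chain_map A B f" "chain_map B Q g"
  using exact by (simp_all add: short_exact_complexes_def)

lemmas f_closed = chain_map_closed[OF complexes(1,2) maps(1)]
  and f_mult = chain_map_mult[OF complexes(1,2) maps(1)]
  and f_one = chain_map_one[OF complexes(1,2) maps(1)]
  and f_bdry = chain_map_bdry[OF complexes(1,2) maps(1)]
  and g_closed = chain_map_closed[OF complexes(2,3) maps(2)]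
  and g_mult = chain_map_mult[OF complexes(2,3) maps(2)]
  and g_bdry = chain_map_bdry[OF complexes(2,3) maps(2)]
  and g_bdry' = chain_map_bdry'[OF complexes(2,3) maps(2)]
  and A_bdry = chain_complexD(5)[OF complexes(1)]
  and B_bdry = chain_complexD(5)[OF complexes(2)]
  and B_bdry' = chain_complexD(6)[OF complexes(2)]

lemma f_inj: "x \<in> carrier (grp A i j) \<Longrightarrow> y \<in> carrier (grp A i j) \<Longrightarrow> f i j x = f i j y \<Longrightarrow> x = y"
  using exact by (simp add: short_exact_complexes_def inj_on_def)

lemma g_surj: "q \<in> carrier (grp Q i j) \<Longrightarrow> \<exists>c \<in> carrier (grp B i j). g i j c = q"
proof -
  assume q: "q \<in> carrier (grp Q i j)"
  have "g i j ` carrier (grp B i j) = carrier (grp Q i j)"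
    using exact by (simp add: short_exact_complexes_def)
  then show ?thesis using q by (metis imageE)
qed

lemma image_f: "f i j ` carrier (grp A i j) = kernel (grp B i j) (grp Q i j) (g i j)"
  using exact by (simp add: short_exact_complexes_def exact_at_def)

lemma g_f: "a \<in> carrier (grp A i j) \<Longrightarrow> g i j (f i j a) = \<one>\<^bsub>grp Q i j\<^esub>"
  using image_f[of i j] by (auto simp: kernel_def)

lemma g_one_imp: "c \<in> carrier (grp B i j) \<Longrightarrow> g i j c = \<one>\<^bsub>grp Q i j\<^esub> \<Longrightarrow> \<exists>a \<in> carrier (grp A i j). f i j a = c"
proof -
  assume "c \<in> carrier (grp B i j)" "g i j c = \<one>\<^bsub>grp Q i j\<^esub>"
  then have "c \<in> f i j ` carrier (grp A i j)" unfolding image_f by (simp add: kernel_def)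
  then show ?thesis by (metis imageE)
qed

lemma g_eq_imp:
  assumes b: "b \<in> carrier (grp B i j)" "b' \<in> carrier (grp B i j)" and eq: "g i j b = g i j b'"
  shows "\<exists>a \<in> carrier (grp A i j). b = f i j a \<otimes>\<^bsub>grp B i j\<^esub> b'"
proof -
  interpret B: comm_group "grp B i j" by (rule chain_complexD(1)[OF complexes(2)])
  interpret Q: comm_group "grp Q i j" by (rule chain_complexD(1)[OF complexes(3)])
  interpret gh: group_hom "grp B i j" "grp Q i j" "g i j"
    by unfold_locales (rule chain_map_hom[OF complexes(2,3) maps(2)])
  have "g i j (b \<otimes>\<^bsub>grp B i j\<^esub> inv\<^bsub>grp B i j\<^esub> b') = \<one>\<^bsub>grp Q i j\<^esub>"
    using b eq g_closed by simp
  then obtain a where a: "a \<in> carrier (grp A i j)" "f i j a = b \<otimes>\<^bsub>grp B i j\<^esub> inv\<^bsub>grp B i j\<^esub> b'"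
    using g_one_imp[of "b \<otimes>\<^bsub>grp B i j\<^esub> inv\<^bsub>grp B i j\<^esub> b'" i j] b by auto
  then have "b = f i j a \<otimes>\<^bsub>grp B i j\<^esub> b'" using b by (simp add: B.m_assoc)
  then show ?thesis using a(1) by blast
qed

text \<open>
  Lift \<open>q\<close> along \<open>g\<close> to \<open>c\<close>. Since \<open>q\<close> is a cycle, the boundary of \<open>c\<close> dies in \<open>Q\<close> and comes from a
  unique \<open>a\<close>, which is a cycle because \<open>f\<close> is injective.
\<close>

lemma ex_zigzag:
  assumes q: "q \<in> cycles Q i j"
  shows "\<exists>c a. c \<in> carrier (grp B i j) \<and> a \<in> cycles A (i - 2) j \<and> g i j c = q \<and> f (i - 2) j a = bdry B i j c"
proof -
  obtain c where c: "c \<in> carrier (grp B i j)" "g i j c = q"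
    using q g_surj[of q i j] by (auto simp: cycles_iff)
  have "g (i - 2) j (bdry B i j c) = \<one>\<^bsub>grp Q (i - 2) j\<^esub>"
    using q c by (simp add: g_bdry[symmetric] cycles_iff)
  then obtain a where a: "a \<in> carrier (grp A (i - 2) j)" "f (i - 2) j a = bdry B i j c"
    using g_one_imp[OF B_bdry[OF c(1)]] by blast
  have "f (i - 2 - 2) j (bdry A (i - 2) j a) = bdry B (i - 2) j (bdry B i j c)"
    using f_bdry[OF a(1)] a(2) by simp
  also have "\<dots> = \<one>\<^bsub>grp B (i - 2 - 2) j\<^esub>"
    using chain_complexD(7)[OF complexes(2), of c "i - 2" j] c(1) by simp
  also have "\<dots> = f (i - 2 - 2) j \<one>\<^bsub>grp A (i - 2 - 2) j\<^esub>" by (rule f_one[symmetric])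
  finally have "bdry A (i - 2) j a = \<one>\<^bsub>grp A (i - 2 - 2) j\<^esub>"
    by (rule f_inj[rotated 2]) (use A_bdry[OF a(1)] chain_complexD(2)[OF complexes(1)] in \<open>simp_all add: group.is_monoid monoid.one_closed\<close>)
  then show ?thesis using a c by (auto simp: cycles_iff)
qed

text \<open>
  The class of \<open>a\<close> does not depend on the zigzag: two lifts of homologous cycles differ by a boundary
  in \<open>B\<close> and an element of \<open>A\<close>, and only the boundary of the latter reaches \<open>a\<close>. So any convenient
  lift computes the connecting map.
\<close>

lemma connecting_map_hclass:
  assumes q: "q \<in> cycles Q i j" and c: "c \<in> carrier (grp B i j)" "g i j c = q"
    and a: "a \<in> carrier (grp A (i - 2) j)" "f (i - 2) j a = bdry B i j c"
  shows "connecting_map A B f g i j (hclass Q i j q) = hclass A (i - 2) j a"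
proof -
  interpret A: comm_group "grp A (i - 2) j" by (rule chain_complexD(1)[OF complexes(1)])
  interpret B: comm_group "grp B i j" by (rule chain_complexD(1)[OF complexes(2)])
  interpret B2: comm_group "grp B (i - 2) j" by (rule chain_complexD(1)[OF complexes(2)])
  interpret dB: group_hom "grp B i j" "grp B (i - 2) j" "bdry B i j" by (rule boundary_hom[OF complexes(2)])
  have qc: "q \<in> carrier (grp Q i j)" using q by (simp add: cycles_iff)
  have uniq: "hclass A (i - 2) j a' = hclass A (i - 2) j a"
    if c': "c' \<in> carrier (grp B i j)" "g i j c' \<in> hclass Q i j q"
      and a': "a' \<in> carrier (grp A (i - 2) j)" "f (i - 2) j a' = bdry B i j c'" for a' c'
  proof -
    obtain w where w: "w \<in> carrier (grp Q (i + 2) j)" "g i j c' = bdry Q (i + 2) j w \<otimes>\<^bsub>grp Q i j\<^esub> q"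
      using c'(2) unfolding mem_hclass_iff[OF complexes(3)] by blast
    obtain v where v: "v \<in> carrier (grp B (i + 2) j)" "g (i + 2) j v = w" using g_surj[OF w(1)] by blast
    have dv: "bdry B (i + 2) j v \<in> carrier (grp B i j)" using v(1) by (rule B_bdry')
    have "g i j c' = g i j (bdry B (i + 2) j v \<otimes>\<^bsub>grp B i j\<^esub> c)"
      unfolding w(2) v(2)[symmetric] c(2)[symmetric] using g_mult[OF dv c(1)] g_bdry'[OF v(1)] by simp
    then obtain u where u: "u \<in> carrier (grp A i j)"
      "c' = f i j u \<otimes>\<^bsub>grp B i j\<^esub> (bdry B (i + 2) j v \<otimes>\<^bsub>grp B i j\<^esub> c)"
      using g_eq_imp[OF c'(1)] dv c(1) by (meson B.m_closed)
    have "bdry B i j c' = f (i - 2) j (bdry A i j u) \<otimes>\<^bsub>grp B (i - 2) j\<^esub> f (i - 2) j a"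
      using u c(1) dv f_closed[OF u(1)] chain_complexD(7)[OF complexes(2) v(1)] a
      by (simp add: f_bdry)
    then have "f (i - 2) j a' = f (i - 2) j (bdry A i j u \<otimes>\<^bsub>grp A (i - 2) j\<^esub> a)"
      using a' a u(1) A_bdry by (simp add: f_mult)
    then have "a' = bdry A i j u \<otimes>\<^bsub>grp A (i - 2) j\<^esub> a"
      using a' a u(1) A_bdry by (intro f_inj) auto
    then show ?thesis
      using hclass_eq_iff[OF complexes(1) a'(1) a(1)] u(1) by auto
  qed
  have "{hclass A (i - 2) j a' | a' c'. a' \<in> carrier (grp A (i - 2) j) \<and> c' \<in> carrier (grp B i j) \<and>
      g i j c' \<in> hclass Q i j q \<and> f (i - 2) j a' = bdry B i j c'} = {hclass A (i - 2) j a}"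
    using uniq a c hclass_self[OF complexes(3) qc] by blast
  then show ?thesis by (simp add: connecting_map_def)
qed

lemma connecting_map_hom:
  "connecting_map A B f g i j \<in> hom (homology Q i j) (homology A (i - 2) j)"
proof (rule homI)
  interpret A: comm_group "grp A (i - 2) j" by (rule chain_complexD(1)[OF complexes(1)])
  interpret B: comm_group "grp B i j" by (rule chain_complexD(1)[OF complexes(2)])
  interpret dB: group_hom "grp B i j" "grp B (i - 2) j" "bdry B i j" by (rule boundary_hom[OF complexes(2)])
  fix X Y assume "X \<in> carrier (homology Q i j)" "Y \<in> carrier (homology Q i j)"
  then obtain x y where x: "x \<in> cycles Q i j" "X = hclass Q i j x" and y: "y \<in> cycles Q i j" "Y = hclass Q i j y"
    unfolding carrier_homology[OF complexes(3)] by blast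
  obtain c a where ca: "c \<in> carrier (grp B i j)" "a \<in> cycles A (i - 2) j" "g i j c = x" "f (i - 2) j a = bdry B i j c"
    using ex_zigzag[OF x(1)] by blast
  obtain c' a' where ca': "c' \<in> carrier (grp B i j)" "a' \<in> cycles A (i - 2) j" "g i j c' = y" "f (i - 2) j a' = bdry B i j c'"
    using ex_zigzag[OF y(1)] by blast
  have ac: "a \<in> carrier (grp A (i - 2) j)" "a' \<in> carrier (grp A (i - 2) j)"
    using ca(2) ca'(2) by (simp_all add: cycles_iff)
  have X: "connecting_map A B f g i j X = hclass A (i - 2) j a"
    unfolding x(2) by (rule connecting_map_hclass[OF x(1) ca(1,3) ac(1) ca(4)])
  have Y: "connecting_map A B f g i j Y = hclass A (i - 2) j a'"
    unfolding y(2) by (rule connecting_map_hclass[OF y(1) ca'(1,3) ac(2) ca'(4)])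
  show "connecting_map A B f g i j X \<in> carrier (homology A (i - 2) j)"
    unfolding X carrier_homology[OF complexes(1)] using ca(2) by blast
  have xy: "x \<otimes>\<^bsub>grp Q i j\<^esub> y \<in> cycles Q i j"
    by (rule subgroup.m_closed[OF subgroup_cycles[OF complexes(3)] x(1) y(1)])
  have "connecting_map A B f g i j (hclass Q i j (x \<otimes>\<^bsub>grp Q i j\<^esub> y)) =
      hclass A (i - 2) j (a \<otimes>\<^bsub>grp A (i - 2) j\<^esub> a')"
    by (rule connecting_map_hclass[OF xy, of "c \<otimes>\<^bsub>grp B i j\<^esub> c'"])
      (use ca ca' ac in \<open>simp_all add: g_mult f_mult\<close>)
  moreover have "X \<otimes>\<^bsub>homology Q i j\<^esub> Y = hclass Q i j (x \<otimes>\<^bsub>grp Q i j\<^esub> y)"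
    unfolding x(2) y(2) by (rule mult_homology[OF complexes(3) x(1) y(1)])
  ultimately show "connecting_map A B f g i j (X \<otimes>\<^bsub>homology Q i j\<^esub> Y) =
      connecting_map A B f g i j X \<otimes>\<^bsub>homology A (i - 2) j\<^esub> connecting_map A B f g i j Y"
    by (simp only: X Y mult_homology[OF complexes(1) ca(2) ca'(2)])
qed

lemmas f_homology = homology_map_hclass[OF complexes(1,2) maps(1)]
  and g_homology = homology_map_hclass[OF complexes(2,3) maps(2)]
  and f_cycles = chain_map_cycles[OF complexes(1,2) maps(1)]
  and g_cycles = chain_map_cycles[OF complexes(2,3) maps(2)]

text \<open>
  If \<open>g b\<close> bounds, then lifting what it bounds and subtracting the boundary of the lift from \<open>b\<close>
  moves \<open>b\<close> into the image of \<open>f\<close> without changing its class.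
\<close>

lemma exact_at_homology_B:
  "exact_at (homology A i j) (homology_map B f i j) (homology B i j) (homology_map Q g i j) (homology Q i j)"
proof -
  have "homology_map B f i j ` carrier (homology A i j) = kernel (homology B i j) (homology Q i j) (homology_map Q g i j)"
  proof
    show "homology_map B f i j ` carrier (homology A i j) \<subseteq> kernel (homology B i j) (homology Q i j) (homology_map Q g i j)"
    proof
      fix Y assume "Y \<in> homology_map B f i j ` carrier (homology A i j)"
      then obtain a where a: "a \<in> cycles A i j" "Y = hclass B i j (f i j a)"
        unfolding carrier_homology[OF complexes(1)] by (auto simp: f_homology)
      have ac: "a \<in> carrier (grp A i j)" using a(1) by (simp add: cycles_iff)
      have "homology_map Q g i j Y = hclass Q i j \<one>\<^bsub>grp Q i j\<^esub>"
        unfolding a(2) g_homology[OF f_cycles[OF a(1)]] g_f[OF ac] ..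
      also have "\<dots> = \<one>\<^bsub>homology Q i j\<^esub>"
        using hclass_one_iff[OF complexes(3), of "\<one>\<^bsub>grp Q i j\<^esub>" i j] subgroup.one_closed[OF subgroup_boundaries[OF complexes(3)]]
          subgroup.mem_carrier[OF subgroup_boundaries[OF complexes(3)]] by blast
      finally show "Y \<in> kernel (homology B i j) (homology Q i j) (homology_map Q g i j)"
        using f_cycles[OF a(1)] a(2) unfolding kernel_def carrier_homology[OF complexes(2)] by blast
    qed
    show "kernel (homology B i j) (homology Q i j) (homology_map Q g i j) \<subseteq> homology_map B f i j ` carrier (homology A i j)"
    proof
      interpret B: comm_group "grp B i j" by (rule chain_complexD(1)[OF complexes(2)])
      interpret B2: comm_group "grp B (i - 2) j" by (rule chain_complexD(1)[OF complexes(2)])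
      interpret A2: comm_group "grp A (i - 2) j" by (rule chain_complexD(1)[OF complexes(1)])
      interpret dB: group_hom "grp B i j" "grp B (i - 2) j" "bdry B i j" by (rule boundary_hom[OF complexes(2)])
      fix Y assume "Y \<in> kernel (homology B i j) (homology Q i j) (homology_map Q g i j)"
      then obtain b where b: "b \<in> cycles B i j" "Y = hclass B i j b" and "homology_map Q g i j Y = \<one>\<^bsub>homology Q i j\<^esub>"
        unfolding kernel_def carrier_homology[OF complexes(2)] by blast
      then have "hclass Q i j (g i j b) = \<one>\<^bsub>homology Q i j\<^esub>" by (simp add: g_homology)
      moreover have bc: "b \<in> carrier (grp B i j)" using b(1) by (simp add: cycles_iff)
      ultimately obtain w where w: "w \<in> carrier (grp Q (i + 2) j)" "g i j b = bdry Q (i + 2) j w"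
        using hclass_one_iff[OF complexes(3) g_closed[OF bc]] by (auto simp: boundaries_def)
      obtain v where v: "v \<in> carrier (grp B (i + 2) j)" "g (i + 2) j v = w" using g_surj[OF w(1)] by blast
      have dv: "bdry B (i + 2) j v \<in> carrier (grp B i j)" using v(1) by (rule B_bdry')
      have "g i j b = g i j (bdry B (i + 2) j v)" using w(2) v g_bdry' by simp
      then obtain a where a: "a \<in> carrier (grp A i j)" "b = f i j a \<otimes>\<^bsub>grp B i j\<^esub> bdry B (i + 2) j v"
        using g_eq_imp[OF bc dv] by blast
      have "bdry B i j b = f (i - 2) j (bdry A i j a)"
        using a dv f_closed[OF a(1)] chain_complexD(7)[OF complexes(2) v(1)] A_bdry[OF a(1)] f_closed
        by (simp add: f_bdry)
      then have "f (i - 2) j (bdry A i j a) = f (i - 2) j \<one>\<^bsub>grp A (i - 2) j\<^esub>"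
        using b(1) by (simp add: cycles_iff f_one)
      then have "bdry A i j a = \<one>\<^bsub>grp A (i - 2) j\<^esub>"
        by (rule f_inj[rotated 2]) (use A_bdry[OF a(1)] in simp_all)
      then have az: "a \<in> cycles A i j" using a(1) by (simp add: cycles_iff)
      have "b = bdry B (i + 2) j v \<otimes>\<^bsub>grp B i j\<^esub> f i j a"
        using a dv f_closed by (simp add: B.m_comm)
      then have "Y = hclass B i j (f i j a)"
        unfolding b(2) using hclass_eq_iff[OF complexes(2) bc f_closed[OF a(1)]] v(1) by blast
      then have "Y = homology_map B f i j (hclass A i j a)" by (simp add: f_homology[OF az])
      then show "Y \<in> homology_map B f i j ` carrier (homology A i j)"
        unfolding carrier_homology[OF complexes(1)] using az by blast
    qed
  qed
  then show ?thesis
    by (simp add: exact_at_def group_homology complexes homology_map_hom maps)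
qed

text \<open>
  If the class of \<open>a\<close> in the zigzag of \<open>q\<close> vanishes, \<open>a\<close> bounds some \<open>u\<close>, and correcting the lift of
  \<open>q\<close> by \<open>f u\<close> makes it a cycle.
\<close>

lemma exact_at_homology_Q:
  "exact_at (homology B i j) (homology_map Q g i j) (homology Q i j) (connecting_map A B f g i j) (homology A (i - 2) j)"
proof -
  interpret A: comm_group "grp A (i - 2) j" by (rule chain_complexD(1)[OF complexes(1)])
  interpret B: comm_group "grp B i j" by (rule chain_complexD(1)[OF complexes(2)])
  interpret Q: comm_group "grp Q i j" by (rule chain_complexD(1)[OF complexes(3)])
  interpret dB: group_hom "grp B i j" "grp B (i - 2) j" "bdry B i j" by (rule boundary_hom[OF complexes(2)])
  interpret gh: group_hom "grp B i j" "grp Q i j" "g i j"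
    by unfold_locales (rule chain_map_hom[OF complexes(2,3) maps(2)])
  have "homology_map Q g i j ` carrier (homology B i j) = kernel (homology Q i j) (homology A (i - 2) j) (connecting_map A B f g i j)"
  proof
    show "homology_map Q g i j ` carrier (homology B i j) \<subseteq> kernel (homology Q i j) (homology A (i - 2) j) (connecting_map A B f g i j)"
    proof
      fix Y assume "Y \<in> homology_map Q g i j ` carrier (homology B i j)"
      then obtain b where b: "b \<in> cycles B i j" "Y = hclass Q i j (g i j b)"
        unfolding carrier_homology[OF complexes(2)] by (auto simp: g_homology)
      have "connecting_map A B f g i j Y = hclass A (i - 2) j \<one>\<^bsub>grp A (i - 2) j\<^esub>"
        unfolding b(2)
        by (rule connecting_map_hclass[OF g_cycles[OF b(1)], of b]) (use b(1) in \<open>simp_all add: cycles_iff f_one\<close>)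
      also have "\<dots> = \<one>\<^bsub>homology A (i - 2) j\<^esub>"
        using hclass_one_iff[OF complexes(1) A.one_closed] subgroup.one_closed[OF subgroup_boundaries[OF complexes(1)]] by blast
      finally show "Y \<in> kernel (homology Q i j) (homology A (i - 2) j) (connecting_map A B f g i j)"
        using g_cycles[OF b(1)] b(2) unfolding kernel_def carrier_homology[OF complexes(3)] by blast
    qed
    show "kernel (homology Q i j) (homology A (i - 2) j) (connecting_map A B f g i j) \<subseteq> homology_map Q g i j ` carrier (homology B i j)"
    proof
      fix Y assume "Y \<in> kernel (homology Q i j) (homology A (i - 2) j) (connecting_map A B f g i j)"
      then obtain q where q: "q \<in> cycles Q i j" "Y = hclass Q i j q"
        and Y: "connecting_map A B f g i j Y = \<one>\<^bsub>homology A (i - 2) j\<^esub>"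
        unfolding kernel_def carrier_homology[OF complexes(3)] by blast
      obtain c a where ca: "c \<in> carrier (grp B i j)" "a \<in> cycles A (i - 2) j" "g i j c = q" "f (i - 2) j a = bdry B i j c"
        using ex_zigzag[OF q(1)] by blast
      have ac: "a \<in> carrier (grp A (i - 2) j)" using ca(2) by (simp add: cycles_iff)
      have "hclass A (i - 2) j a = \<one>\<^bsub>homology A (i - 2) j\<^esub>"
        using Y connecting_map_hclass[OF q(1) ca(1,3) ac ca(4)] q(2) by simp
      then obtain u where u: "u \<in> carrier (grp A i j)" "a = bdry A i j u"
        using hclass_one_iff[OF complexes(1) ac] by (auto simp: boundaries_def)
      define b where "b = c \<otimes>\<^bsub>grp B i j\<^esub> inv\<^bsub>grp B i j\<^esub> f i j u"
      have fu: "f i j u \<in> carrier (grp B i j)" by (rule f_closed[OF u(1)])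
      have "bdry B i j (f i j u) = bdry B i j c"
        using f_bdry[OF u(1)] u(2) ca(4) by simp
      then have "bdry B i j b = \<one>\<^bsub>grp B (i - 2) j\<^esub>"
        unfolding b_def using ca(1) fu B_bdry[OF ca(1)] by simp
      then have bz: "b \<in> cycles B i j" using ca(1) fu by (simp add: cycles_iff b_def)
      have "g i j b = q"
        unfolding b_def using ca(1,3) fu g_f[OF u(1)] g_closed[OF ca(1)] by simp
      then have "Y = homology_map Q g i j (hclass B i j b)"
        using q(2) g_homology[OF bz] by simp
      then show "Y \<in> homology_map Q g i j ` carrier (homology B i j)"
        unfolding carrier_homology[OF complexes(2)] using bz by blast
    qed
  qed
  then show ?thesis
    by (simp add: exact_at_def group_homology complexes homology_map_hom maps connecting_map_hom)
qed

text \<open>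
  If \<open>f a\<close> bounds \<open>c\<close>, then \<open>c\<close> and \<open>a\<close> form the zigzag of \<open>g c\<close>.
\<close>

lemma exact_at_homology_A:
  "exact_at (homology Q i j) (connecting_map A B f g i j) (homology A (i - 2) j)
     (homology_map B f (i - 2) j) (homology B (i - 2) j)"
proof -
  have "connecting_map A B f g i j ` carrier (homology Q i j) =
      kernel (homology A (i - 2) j) (homology B (i - 2) j) (homology_map B f (i - 2) j)"
  proof
    show "connecting_map A B f g i j ` carrier (homology Q i j) \<subseteq>
        kernel (homology A (i - 2) j) (homology B (i - 2) j) (homology_map B f (i - 2) j)"
    proof
      fix Y assume "Y \<in> connecting_map A B f g i j ` carrier (homology Q i j)"
      then obtain q where q: "q \<in> cycles Q i j" "Y = connecting_map A B f g i j (hclass Q i j q)"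
        unfolding carrier_homology[OF complexes(3)] by blast
      obtain c a where ca: "c \<in> carrier (grp B i j)" "a \<in> cycles A (i - 2) j" "g i j c = q" "f (i - 2) j a = bdry B i j c"
        using ex_zigzag[OF q(1)] by blast
      have ac: "a \<in> carrier (grp A (i - 2) j)" using ca(2) by (simp add: cycles_iff)
      have Y: "Y = hclass A (i - 2) j a"
        unfolding q(2) by (rule connecting_map_hclass[OF q(1) ca(1,3) ac ca(4)])
      have "f (i - 2) j a \<in> boundaries B (i - 2) j"
        using ca(1,4) by (simp add: boundaries_def)
      then have "homology_map B f (i - 2) j Y = \<one>\<^bsub>homology B (i - 2) j\<^esub>"
        unfolding Y f_homology[OF ca(2)] hclass_one_iff[OF complexes(2) f_closed[OF ac]] .
      then show "Y \<in> kernel (homology A (i - 2) j) (homology B (i - 2) j) (homology_map B f (i - 2) j)"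
        using Y ca(2) unfolding kernel_def carrier_homology[OF complexes(1)] by blast
    qed
    show "kernel (homology A (i - 2) j) (homology B (i - 2) j) (homology_map B f (i - 2) j) \<subseteq>
        connecting_map A B f g i j ` carrier (homology Q i j)"
    proof
      fix Y assume "Y \<in> kernel (homology A (i - 2) j) (homology B (i - 2) j) (homology_map B f (i - 2) j)"
      then obtain a where a: "a \<in> cycles A (i - 2) j" "Y = hclass A (i - 2) j a"
        and Y: "homology_map B f (i - 2) j Y = \<one>\<^bsub>homology B (i - 2) j\<^esub>"
        unfolding kernel_def carrier_homology[OF complexes(1)] by blast
      have ac: "a \<in> carrier (grp A (i - 2) j)" using a(1) by (simp add: cycles_iff)
      have "f (i - 2) j a \<in> boundaries B (i - 2) j"
        using Y unfolding a(2) f_homology[OF a(1)] hclass_one_iff[OF complexes(2) f_closed[OF ac]] .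
      then obtain c where c: "c \<in> carrier (grp B i j)" "f (i - 2) j a = bdry B i j c"
        by (auto simp: boundaries_def)
      have "bdry Q i j (g i j c) = \<one>\<^bsub>grp Q (i - 2) j\<^esub>"
        using g_bdry[OF c(1)] c(2) g_f[OF ac] by simp
      then have q: "g i j c \<in> cycles Q i j" using g_closed[OF c(1)] by (simp add: cycles_iff)
      have "Y = connecting_map A B f g i j (hclass Q i j (g i j c))"
        unfolding a(2) by (rule connecting_map_hclass[OF q c(1) refl ac c(2), symmetric])
      then show "Y \<in> connecting_map A B f g i j ` carrier (homology Q i j)"
        unfolding carrier_homology[OF complexes(3)] using q by blast
    qed
  qed
  then show ?thesis
    by (simp add: exact_at_def group_homology complexes homology_map_hom maps connecting_map_hom)
qed

end

section \<open>The reduced Khovanov complex\<close>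

context planar_diagram
begin

lemma chain_complex_khovanov: "chain_complex (khovanov D)"
  unfolding chain_complex_def
proof (intro allI conjI ballI)
  fix i j :: int
  show "comm_group (grp (khovanov D) i j)"
    by (simp add: khovanov_def abelian_free_Abelian_group)
  show "bdry (khovanov D) i j \<in> hom (grp (khovanov D) i j) (grp (khovanov D) (i - 2) j)"
    by (rule homI) (simp_all add: khovanov_def keys_khov_d khov_d_add)
  fix x assume "x \<in> carrier (grp (khovanov D) i j)"
  then show "bdry (khovanov D) (i - 2) j (bdry (khovanov D) i j x) = \<one>\<^bsub>grp (khovanov D) (i - 4) j\<^esub>"
    by (simp add: khovanov_def khov_d_khov_d)
qed

lemma chain_complex_khovanov_plus:
  assumes b: "b \<in> edges D"
  shows "chain_complex (khovanov_plus D b)"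
  unfolding chain_complex_def
proof (intro allI conjI ballI)
  fix i j :: int
  show "comm_group (grp (khovanov_plus D b) i j)"
    by (simp add: khovanov_plus_def abelian_free_Abelian_group)
  show "bdry (khovanov_plus D b) i j \<in> hom (grp (khovanov_plus D b) i j) (grp (khovanov_plus D b) (i - 2) j)"
    unfolding khovanov_plus_def using keys_khov_d_S_plus[OF b]
    by (intro homI) (simp_all add: khov_d_add)
  fix x assume "x \<in> carrier (grp (khovanov_plus D b) i j)"
  then show "bdry (khovanov_plus D b) (i - 2) j (bdry (khovanov_plus D b) i j x) =
      \<one>\<^bsub>grp (khovanov_plus D b) (i - 4) j\<^esub>"
    by (simp add: khovanov_plus_def khov_d_khov_d)
qed

lemma psi_eq:
  "psi D b i j x = (\<lambda>n. n + x) ` {n. Poly_Mapping.keys n \<subseteq> gens D i j \<inter> S_plus D b}"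
proof -
  have "carrier (grp (khovanov_plus D b) i j) = {n. Poly_Mapping.keys n \<subseteq> gens D i j \<inter> S_plus D b}"
    by (rule Set.set_eqI) (simp add: khovanov_plus_def)
  then show ?thesis by (auto simp: psi_def r_coset_def khovanov_def)
qed

lemma psi_eq_iff:
  "psi D b i j x = psi D b i j y \<longleftrightarrow> Poly_Mapping.keys (x - y) \<subseteq> gens D i j \<inter> S_plus D b"
  (is "_ \<longleftrightarrow> Poly_Mapping.keys _ \<subseteq> ?G")
proof
  assume "psi D b i j x = psi D b i j y"
  moreover have "x \<in> psi D b i j x"
    unfolding psi_eq by (intro image_eqI[of _ _ 0]) simp_all
  ultimately obtain n where "Poly_Mapping.keys n \<subseteq> ?G" "x = n + y" unfolding psi_eq by blast
  then show "Poly_Mapping.keys (x - y) \<subseteq> ?G" by simp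
next
  assume d: "Poly_Mapping.keys (x - y) \<subseteq> ?G"
  have sub: "psi D b i j x \<subseteq> psi D b i j y" if d: "Poly_Mapping.keys (x - y) \<subseteq> ?G" for x y
  proof
    fix z assume "z \<in> psi D b i j x"
    then obtain n where n: "Poly_Mapping.keys n \<subseteq> ?G" "z = n + x" unfolding psi_eq by blast
    have "Poly_Mapping.keys (n + (x - y)) \<subseteq> ?G"
      using n(1) d by (intro order_trans[OF keys_add] Un_least)
    moreover have "z = n + (x - y) + y" using n(2) by simp
    ultimately show "z \<in> psi D b i j y" unfolding psi_eq by blast
  qed
  have "Poly_Mapping.keys (y - x) = Poly_Mapping.keys (- (x - y))" by simp
  also have "\<dots> = Poly_Mapping.keys (x - y)" by (rule keys_minus)
  finally show "psi D b i j x = psi D b i j y"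
    using sub[OF d] sub[of y x] d by (intro subset_antisym) simp_all
qed

lemma normal_plus: "carrier (grp (khovanov_plus D b) i j) \<lhd> grp (khovanov D) i j"
proof (rule comm_group.subgroup_imp_normal)
  show "comm_group (grp (khovanov D) i j)" by (simp add: khovanov_def abelian_free_Abelian_group)
  show "subgroup (carrier (grp (khovanov_plus D b) i j)) (grp (khovanov D) i j)"
  proof (rule group.subgroupI)
    show "group (grp (khovanov D) i j)" by (simp add: khovanov_def)
    fix x y assume "x \<in> carrier (grp (khovanov_plus D b) i j)" "y \<in> carrier (grp (khovanov_plus D b) i j)"
    then have xy: "Poly_Mapping.keys x \<subseteq> gens D i j \<inter> S_plus D b" "Poly_Mapping.keys y \<subseteq> gens D i j \<inter> S_plus D b"
      by (simp_all add: khovanov_plus_def)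
    then have "Poly_Mapping.keys (x + y) \<subseteq> gens D i j \<inter> S_plus D b"
      by (intro order_trans[OF keys_add] Un_least)
    then show "x \<otimes>\<^bsub>grp (khovanov D) i j\<^esub> y \<in> carrier (grp (khovanov_plus D b) i j)"
      by (simp add: khovanov_plus_def khovanov_def)
    show "inv\<^bsub>grp (khovanov D) i j\<^esub> x \<in> carrier (grp (khovanov_plus D b) i j)"
      using xy(1) by (simp add: khovanov_plus_def khovanov_def keys_minus)
  next
    have "0 \<in> carrier (grp (khovanov_plus D b) i j)" by (simp add: khovanov_plus_def)
    then show "carrier (grp (khovanov_plus D b) i j) \<noteq> {}" by blast
    show "carrier (grp (khovanov_plus D b) i j) \<subseteq> carrier (grp (khovanov D) i j)"
      by (auto simp: khovanov_plus_def khovanov_def)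
  qed
qed

lemma psi_hom: "psi D b i j \<in> hom (grp (khovanov D) i j) (grp (khovanov_quot D b) i j)"
  using normal.r_coset_hom_Mod[OF normal_plus[of b i j]]
  by (simp add: khovanov_quot_def psi_def[abs_def])

lemma carrier_quot: "carrier (grp (khovanov_quot D b) i j) = psi D b i j ` carrier (grp (khovanov D) i j)"
  by (simp add: khovanov_quot_def carrier_FactGroup psi_def[abs_def])

lemma one_quot: "\<one>\<^bsub>grp (khovanov_quot D b) i j\<^esub> = psi D b i j 0"
proof -
  have "\<one>\<^bsub>grp (khovanov_quot D b) i j\<^esub> = carrier (grp (khovanov_plus D b) i j)"
    by (simp add: khovanov_quot_def)
  also have "\<dots> = psi D b i j 0"
    unfolding psi_eq by (rule Set.set_eqI) (simp add: khovanov_plus_def)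
  finally show ?thesis .
qed

lemma comm_group_quot: "comm_group (grp (khovanov_quot D b) i j)"
  unfolding khovanov_quot_def
  using comm_group.abelian_FactGroup[OF _ normal_imp_subgroup[OF normal_plus[of b i j]]]
  by (simp add: khovanov_def abelian_free_Abelian_group)

text \<open>
  The differential of the quotient is well defined because the differential maps positive states to
  positive states.
\<close>

lemma bdry_quot:
  assumes b: "b \<in> edges D"
  shows "bdry (khovanov_quot D b) i j (psi D b i j x) = psi D b (i - 2) j (khov_d D i j x)"
proof -
  have self: "x \<in> psi D b i j x"
    unfolding psi_eq by (intro image_eqI[of _ _ 0]) simp_all
  have const: "psi D b (i - 2) j (khov_d D i j y) = psi D b (i - 2) j (khov_d D i j x)"
    if y: "y \<in> psi D b i j x" for y
  proof -
    obtain n where n: "Poly_Mapping.keys n \<subseteq> gens D i j \<inter> S_plus D b" "y = n + x"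
      using y unfolding psi_eq by blast
    then have "khov_d D i j y - khov_d D i j x = khov_d D i j n" by (simp add: khov_d_add)
    then show ?thesis unfolding psi_eq_iff using keys_khov_d_S_plus[OF b n(1)] by simp
  qed
  have "the_elem ((\<lambda>x. psi D b (i - 2) j (khov_d D i j x)) ` psi D b i j x) =
      psi D b (i - 2) j (khov_d D i j x)"
    by (rule the_elem_image_unique) (use self in blast, rule const)
  then show ?thesis by (simp add: khovanov_quot_def)
qed

lemma khov_d_closed:
  "x \<in> carrier (grp (khovanov D) i j) \<Longrightarrow> khov_d D i j x \<in> carrier (grp (khovanov D) (i - 2) j)"
  by (simp add: khovanov_def keys_khov_d)

lemma chain_complex_quot:
  assumes b: "b \<in> edges D"
  shows "chain_complex (khovanov_quot D b)"
  unfolding chain_complex_def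
proof (intro allI conjI)
  fix i j :: int
  show "comm_group (grp (khovanov_quot D b) i j)" by (rule comm_group_quot)
  show "bdry (khovanov_quot D b) i j \<in> hom (grp (khovanov_quot D b) i j) (grp (khovanov_quot D b) (i - 2) j)"
  proof (rule homI)
    fix X Y assume "X \<in> carrier (grp (khovanov_quot D b) i j)" "Y \<in> carrier (grp (khovanov_quot D b) i j)"
    then obtain x y where x: "x \<in> carrier (grp (khovanov D) i j)" "X = psi D b i j x"
      and y: "y \<in> carrier (grp (khovanov D) i j)" "Y = psi D b i j y"
      unfolding carrier_quot by blast
    show "bdry (khovanov_quot D b) i j X \<in> carrier (grp (khovanov_quot D b) (i - 2) j)"
      unfolding x(2) bdry_quot[OF b] carrier_quot using khov_d_closed[OF x(1)] by blast
    have "X \<otimes>\<^bsub>grp (khovanov_quot D b) i j\<^esub> Y = psi D b i j (x + y)"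
      using hom_mult[OF psi_hom x(1) y(1)] unfolding x(2) y(2) by (simp add: khovanov_def)
    moreover have "psi D b (i - 2) j (khov_d D i j x + khov_d D i j y) =
        psi D b (i - 2) j (khov_d D i j x) \<otimes>\<^bsub>grp (khovanov_quot D b) (i - 2) j\<^esub> psi D b (i - 2) j (khov_d D i j y)"
      using hom_mult[OF psi_hom khov_d_closed[OF x(1)] khov_d_closed[OF y(1)]] by (simp add: khovanov_def)
    ultimately show "bdry (khovanov_quot D b) i j (X \<otimes>\<^bsub>grp (khovanov_quot D b) i j\<^esub> Y) =
        bdry (khovanov_quot D b) i j X \<otimes>\<^bsub>grp (khovanov_quot D b) (i - 2) j\<^esub> bdry (khovanov_quot D b) i j Y"
      unfolding x(2) y(2) by (simp add: bdry_quot[OF b] khov_d_add)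
  qed
  show "\<forall>X\<in>carrier (grp (khovanov_quot D b) i j).
      bdry (khovanov_quot D b) (i - 2) j (bdry (khovanov_quot D b) i j X) = \<one>\<^bsub>grp (khovanov_quot D b) (i - 4) j\<^esub>"
    unfolding carrier_quot
  proof (clarify)
    fix x assume "x \<in> carrier (grp (khovanov D) i j)"
    then show "bdry (khovanov_quot D b) (i - 2) j (bdry (khovanov_quot D b) i j (psi D b i j x)) =
        \<one>\<^bsub>grp (khovanov_quot D b) (i - 4) j\<^esub>"
      by (simp add: bdry_quot[OF b] one_quot khovanov_def khov_d_khov_d)
  qed
qed

lemma short_exact_khovanov:
  assumes b: "b \<in> edges D"
  shows "short_exact_complexes (khovanov_plus D b) phi (khovanov D) (psi D b) (khovanov_quot D b)"
  unfolding short_exact_complexes_def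
proof (intro conjI allI)
  show "chain_complex (khovanov_plus D b)" "chain_complex (khovanov D)" "chain_complex (khovanov_quot D b)"
    by (rule chain_complex_khovanov_plus[OF b] chain_complex_khovanov chain_complex_quot[OF b])+
  have phi_hom: "phi i j \<in> hom (grp (khovanov_plus D b) i j) (grp (khovanov D) i j)" for i j
    by (rule homI) (auto simp: phi_def khovanov_plus_def khovanov_def)
  show "chain_map (khovanov_plus D b) (khovanov D) phi"
    using phi_hom by (simp add: chain_map_def) (simp add: phi_def khovanov_plus_def khovanov_def)
  show "chain_map (khovanov D) (khovanov_quot D b) (psi D b)"
    using psi_hom by (simp add: chain_map_def bdry_quot[OF b]) (simp add: khovanov_def)
  fix i j
  show "inj_on (phi i j) (carrier (grp (khovanov_plus D b) i j))"
    by (simp add: inj_on_def phi_def)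
  show "psi D b i j ` carrier (grp (khovanov D) i j) = carrier (grp (khovanov_quot D b) i j)"
    by (simp add: carrier_quot)
  have "phi i j ` carrier (grp (khovanov_plus D b) i j) =
      kernel (grp (khovanov D) i j) (grp (khovanov_quot D b) i j) (psi D b i j)"
    unfolding kernel_def one_quot psi_eq_iff
    by (rule Set.set_eqI) (auto simp: phi_def khovanov_plus_def khovanov_def image_iff)
  then show "exact_at (grp (khovanov_plus D b) i j) (phi i j) (grp (khovanov D) i j) (psi D b i j)
      (grp (khovanov_quot D b) i j)"
    unfolding exact_at_def
    using phi_hom psi_hom comm_group.axioms(2)[OF comm_group_quot]
    by (simp add: khovanov_plus_def khovanov_def)
qed

end

text \<open>
  For a cycle of the quotient the differential of a representative lies in the positive part
  already, so that restricting it changes nothing.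
\<close>

lemma plus_part_id:
  assumes "Poly_Mapping.keys x \<subseteq> S_plus D b"
  shows "plus_part D b x = x"
proof -
  have "plus_part D b x = frag_extend frag_of x"
    unfolding plus_part_def using assms by (intro frag_extend_eq) auto
  then show ?thesis by (simp flip: frag_expansion)
qed

theorem theorem7p3:
  fixes D :: "'e diagram" and b :: 'e
  assumes "link_diagram D" and "b \<in> edges D"
  shows
    "short_exact_complexes (khovanov_plus D b) phi (khovanov D) (psi D b) (khovanov_quot D b) \<and>
     (\<forall>i j.
        exact_at
          (homology (khovanov_plus D b) i j) (homology_map (khovanov D) phi i j)
          (homology (khovanov D) i j) (homology_map (khovanov_quot D b) (psi D b) i j)
          (homology (khovanov_quot D b) i j) \<and>
        exact_at
          (homology (khovanov D) i j) (homology_map (khovanov_quot D b) (psi D b) i j)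
          (homology (khovanov_quot D b) i j) (khov_connecting D b i j)
          (homology (khovanov_plus D b) (i - 2) j) \<and>
        exact_at
          (homology (khovanov_quot D b) i j) (khov_connecting D b i j)
          (homology (khovanov_plus D b) (i - 2) j) (homology_map (khovanov D) phi (i - 2) j)
          (homology (khovanov D) (i - 2) j)) \<and>
     (\<forall>i j. \<forall>z \<in> carrier (C_minus D b i j).
        psi D b i j z \<in> cycles (khovanov_quot D b) i j \<longrightarrow>
        khov_connecting D b i j (hclass (khovanov_quot D b) i j (psi D b i j z)) =
          hclass (khovanov_plus D b) (i - 2) j (plus_part D b (khov_d D i j z)))"
proof -
  interpret planar_diagram D by unfold_locales (rule assms(1))
  have ses: "short_exact_complexes (khovanov_plus D b) phi (khovanov D) (psi D b) (khovanov_quot D b)"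
    by (rule short_exact_khovanov[OF assms(2)])
  interpret short_exact "khovanov_plus D b" phi "khovanov D" "psi D b" "khovanov_quot D b"
    by unfold_locales (rule ses)
  have "khov_connecting D b i j (hclass (khovanov_quot D b) i j (psi D b i j z)) =
      hclass (khovanov_plus D b) (i - 2) j (plus_part D b (khov_d D i j z))"
    if z: "z \<in> carrier (C_minus D b i j)" and cyc: "psi D b i j z \<in> cycles (khovanov_quot D b) i j" for i j z
  proof -
    have zc: "z \<in> carrier (grp (khovanov D) i j)"
      using z by (simp add: C_minus_def khovanov_def)
    have "psi D b (i - 2) j (khov_d D i j z) = psi D b (i - 2) j 0"
      using cyc by (simp add: cycles_iff bdry_quot[OF assms(2)] one_quot)
    then have keys: "Poly_Mapping.keys (khov_d D i j z) \<subseteq> gens D (i - 2) j \<inter> S_plus D b"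
      by (simp add: psi_eq_iff)
    then have part: "plus_part D b (khov_d D i j z) = khov_d D i j z"
      by (intro plus_part_id) auto
    have "khov_d D i j z \<in> carrier (grp (khovanov_plus D b) (i - 2) j)"
      using keys by (simp add: khovanov_plus_def)
    moreover have "phi (i - 2) j (khov_d D i j z) = bdry (khovanov D) i j z"
      by (simp add: phi_def khovanov_def)
    ultimately show ?thesis
      unfolding khov_connecting_def part by (rule connecting_map_hclass[OF cyc zc refl])
  qed
  with ses exact_at_homology_B exact_at_homology_Q exact_at_homology_A show ?thesis
    unfolding khov_connecting_def by (intro conjI allI ballI impI) simp_all
qed

end
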